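(* If $A$ is a separable unital C*-algebra, then neither the derivation length $\ell_{\mathrm{aut}}(A)$ nor the automorphism length $\ell_{\mathrm{Aut}}(A)$ of $A$ is a limit ordinal.
   Context: Zero is not counted as a limit ordinal. **Fractional ordinals.** $\omega_1^{\mathrm{Ph}}$ is the linearly ordered set consisting, for every countable ordinal $\alpha$, of $\alpha$, $\alpha+1/2$ and $\alpha+1/2+\varepsilon$ ($\varepsilon$ a formal symbol), with $\alpha<\alpha+1/2<\alpha+1/2+\varepsilon<\alpha+1$, and with $\beta+(\alpha+1/2)=(\beta+\alpha)+1/2$, $\beta+(\alpha+1/2+\varepsilon)=(\beta+\alpha)+1/2+\varepsilon$. **Polish covers and phantom subgroups.** A Polish subgroup of a Polish group $G$ is a subgroup $N$ that is a Polish group in a (necessarily unique) topology making the inclusion $N\to G$ continuous (not necessarily the subspace topology). A homogeneous space with a Polish cover is $G/N$ with $G$ Polish and $N$ a Polish subgroup; it is a group with a Polish cover if $N$ is normal. For $\lambda$ zero or a countable limit ordinal and $n<\omega$ let $\Gamma_{\lambda}=\boldsymbol\Pi^0_{1+\lambda}$ and $\Gamma_{\lambda+n}=\boldsymbol\Pi^0_{1+\lambda+n+1}$ for $n\ge 1$. It is known that for each $\alpha<\omega_1$ there is a least Polish subgroup $G_\alpha$ of $G$ with $N\subseteq G_\alpha$ and $G_\alpha\in\Gamma_\alpha(G)$; put $\mathrm{Ph}^\alpha(G/N)=G_\alpha/N$ ($G_\alpha$ carries its Polish group topology, and is normal in $G$ when $N$ is). $D(\boldsymbol\Pi^0_\beta)$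 is the class of intersections of a $\boldsymbol\Pi^0_\beta$ set and a $\boldsymbol\Sigma^0_\beta$ set. The phantom length $\ell_{\mathrm{Ph}}(G/N)\in\omega_1^{\mathrm{Ph}}$ is determined by, for $\alpha<\omega_1$: $\ell_{\mathrm{Ph}}(G/N)\le\alpha$ iff $G_\alpha=N$; $\ell_{\mathrm{Ph}}(G/N)\le\alpha+1/2$ iff $N\in\boldsymbol\Sigma^0_2(G_\alpha)$; $\ell_{\mathrm{Ph}}(G/N)\le\alpha+1/2+\varepsilon$ iff $N\in D(\boldsymbol\Pi^0_2)(G_\alpha)$. **Derivation length.** For a separable unital C*-algebra $A$, $\mathrm{aut}(A)$ is the space of *-derivations of $A$ (derivations mapping self-adjoint elements to self-adjoint elements) with the operator norm, and $\mathrm{inn}(A)=\{\mathrm{ad}(ih):h\in A_{\mathrm{sa}}\}$, $\mathrm{ad}(x)(y)=xy-yx$, with the quotient norm $\|\mathrm{ad}(ih)\|_{\mathrm{inn}(A)}=\inf\{\|h-z\|: z\in A_{\mathrm{sa}}\text{ central}\}$. $\mathrm{Ph}^1\mathrm{aut}(A)$ is the operator-norm closure of $\mathrm{inn}(A)$ in $\mathrm{aut}(A)$, a separable Banach space having $\mathrm{inn}(A)$ as a Polish subgroup, and $\mathrm{Ph}^1\mathrm{out}(A)=\mathrm{Ph}^1\mathrm{aut}(A)/\mathrm{inn}(A)$. The derivation length $\ell_{\mathrm{aut}}(A)\in\omega_1^{\mathrm{Ph}}$ is $0$ if every *-derivation of $A$ is inner, and otherwise is $1+\ell_{\mathrm{Ph}}(\mathrm{Ph}^1\mathrm{out}(A))$.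 **Automorphism length.** $\mathrm{Aut}(A)$ is the Polish group of *-automorphisms of $A$ with the topology of pointwise norm convergence; $\mathrm{Inn}(A)=\{\mathrm{Ad}(u):u\in U(A)\}$ is the normal Polish subgroup of inner automorphisms, where $U(A)$ is the unitary group and $\mathrm{Ad}(u)(x)=uxu^*$; $\mathrm{Out}(A)=\mathrm{Aut}(A)/\mathrm{Inn}(A)$. The automorphism length is $\ell_{\mathrm{Aut}}(A)=\ell_{\mathrm{Ph}}(\mathrm{Out}(A))$. *)

theory Defs
  imports "HOL-Analysis.Analysis" "HOL-Algebra.Group"
begin

unbundle no m_inv_syntax

section \<open>Countable ordinals\<close>

text \<open>
  A countable ordinal is a point of the well-order of type \<open>\<omega>\<^sub>1\<close>, realised as
  the successor cardinal of \<^term>\<open>natLeq\<close>.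
\<close>

typedef countable_ordinal = "Field (cardSuc natLeq)"
proof -
  show ?thesis
    using Field_cardSuc_not_empty[OF natLeq_Card_order] by blast
qed

lemma cardSuc_natLeq: "Card_order (cardSuc natLeq)" "Well_order (cardSuc natLeq)"
  by (simp_all add: cardSuc_Card_order natLeq_Card_order card_order_on_well_order_on)

instantiation countable_ordinal :: wellorder
begin

definition less_eq_countable_ordinal :: "countable_ordinal \<Rightarrow> countable_ordinal \<Rightarrow> bool" where
  "a \<le> b \<longleftrightarrow> (Rep_countable_ordinal a, Rep_countable_ordinal b) \<in> cardSuc natLeq"

definition less_countable_ordinal :: "countable_ordinal \<Rightarrow> countable_ordinal \<Rightarrow> bool" where
  "a < b \<longleftrightarrow> a \<le> b \<and> \<not> b \<le> (a :: countable_ordinal)"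

instance
proof
  note order = cardSuc_natLeq(2)[unfolded well_order_on_def linear_order_on_def
      partial_order_on_def preorder_on_def]
  fix a b c :: countable_ordinal
  show "a < b \<longleftrightarrow> a \<le> b \<and> \<not> b \<le> a"
    by (rule less_countable_ordinal_def)
  show refl: "a \<le> a" for a :: countable_ordinal
    using order Rep_countable_ordinal[of a]
    by (auto simp: less_eq_countable_ordinal_def refl_on_def)
  show "a \<le> b \<Longrightarrow> b \<le> c \<Longrightarrow> a \<le> c"
    using order unfolding less_eq_countable_ordinal_def by (meson transD)
  show antisym: "a = b" if "a \<le> b" "b \<le> a" for a b :: countable_ordinal
    using order that unfolding less_eq_countable_ordinal_def
    by (metis antisymD Rep_countable_ordinal_inject)
  show "a \<le> b \<or> b \<le> a"
    using order Rep_countable_ordinal[of a] Rep_countable_ordinal[of b] refl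
    unfolding less_eq_countable_ordinal_def total_on_def
    by (metis Rep_countable_ordinal_inject)
  show "P a" if step: "\<And>x. (\<And>y. y < x \<Longrightarrow> P y) \<Longrightarrow> P x"
    for P :: "countable_ordinal \<Rightarrow> bool" and a
  proof -
    have "wf (cardSuc natLeq - Id)"
      using order by blast
    then have "wf (inv_image (cardSuc natLeq - Id) Rep_countable_ordinal)"
      by (rule wf_inv_image)
    then show ?thesis
    proof (induction a rule: wf_induct_rule)
      case (less x)
      have "(y, x) \<in> inv_image (cardSuc natLeq - Id) Rep_countable_ordinal" if "y < x" for y
        using that refl unfolding less_countable_ordinal_def
        by (auto simp: less_eq_countable_ordinal_def Rep_countable_ordinal_inject)
      with less show ?case by (blast intro: step)
    qed
  qed
qed

end

context
  includes cardinal_syntax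
begin

lemma countable_iff_ordLeq_natLeq: "countable A \<longleftrightarrow> |A| \<le>o natLeq"
proof -
  have "countable A \<longleftrightarrow> |A| \<le>o |UNIV :: nat set|"
    unfolding card_of_ordLeq[symmetric] countable_def by simp
  also have "\<dots> \<longleftrightarrow> |A| \<le>o natLeq"
    using card_of_nat ordIso_symmetric[OF card_of_nat] ordLeq_ordIso_trans by blast
  finally show ?thesis .
qed

lemma countable_lessThan_ordinal: "countable {..<a :: countable_ordinal}"
proof -
  let ?r = "cardSuc natLeq" and ?R = Rep_countable_ordinal
  have "|underS ?r (?R a)| <o ?r"
    using card_of_underS[OF cardSuc_natLeq(1)] Rep_countable_ordinal by blast
  then have "|underS ?r (?R a)| \<le>o natLeq"
    using cardSuc_ordLeq_ordLess[OF natLeq_Card_order card_of_Card_order] by blast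
  then have "countable (underS ?r (?R a))"
    by (simp add: countable_iff_ordLeq_natLeq)
  moreover have "?R ` {..<a} \<subseteq> underS ?r (?R a)"
    by (auto simp: underS_def less_countable_ordinal_def less_eq_countable_ordinal_def)
  ultimately have "countable (?R ` {..<a})"
    by (rule countable_subset[rotated])
  then show ?thesis
    by (rule countable_image_inj_on) (simp add: inj_on_def Rep_countable_ordinal_inject)
qed

lemma uncountable_ordinals: "uncountable (UNIV :: countable_ordinal set)"
proof
  assume "countable (UNIV :: countable_ordinal set)"
  then have "countable (Field (cardSuc natLeq))"
    using countable_image[of UNIV Rep_countable_ordinal]
    by (simp add: type_definition.Rep_range[OF type_definition_countable_ordinal])
  then have "|Field (cardSuc natLeq)| \<le>o natLeq"
    by (simp add: countable_iff_ordLeq_natLeq)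
  moreover have "natLeq <o |Field (cardSuc natLeq)|"
    using card_of_Field_ordIso[OF cardSuc_natLeq(1)] cardSuc_greater[OF natLeq_Card_order]
    by (rule ordLess_ordIso_trans[OF _ ordIso_symmetric, rotated])
  ultimately show False
    using not_ordLess_ordLeq by blast
qed

end

lemma countable_ordinals_bounded:
  assumes "countable (A :: countable_ordinal set)"
  shows "\<exists>b. \<forall>a\<in>A. a < b"
proof (rule ccontr)
  assume "\<not> ?thesis"
  then have ex: "\<exists>a\<in>A. b \<le> a" for b
    by (meson not_le)
  have "b \<in> (\<Union>a\<in>A. insert a {..<a})" for b
    using ex[of b] by (auto simp: order.order_iff_strict)
  then have "UNIV = (\<Union>a\<in>A. insert a {..<a})"
    by blast
  then show False
    using countable_UN[of A "\<lambda>a. insert a {..<a}"] assms uncountable_ordinals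
    by (simp add: countable_lessThan_ordinal)
qed

instantiation countable_ordinal :: "{zero, one, plus}"
begin

definition zero_countable_ordinal :: countable_ordinal where
  "0 = (LEAST a :: countable_ordinal. True)"

definition one_countable_ordinal :: countable_ordinal where
  "1 = (LEAST a :: countable_ordinal. 0 < a)"

text \<open>\<open>a + b\<close> is the least ordinal above \<open>a\<close> and strictly above all \<open>a + d\<close> with \<open>d < b\<close>.\<close>

function plus_countable_ordinal ::
    "countable_ordinal \<Rightarrow> countable_ordinal \<Rightarrow> countable_ordinal" where
  "plus_countable_ordinal a b =
     (LEAST c. a \<le> c \<and> (\<forall>d\<in>{..<b}. plus_countable_ordinal a d < c))"
  by pat_completeness auto
termination
  by (relation "inv_image {(x, y). x < y} snd") (auto intro: wf_inv_image wf)

instance ..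

end

declare plus_countable_ordinal.simps [simp del]

definition is_limit :: "countable_ordinal \<Rightarrow> bool" where
  "is_limit a \<longleftrightarrow> a \<noteq> 0 \<and> (\<nexists>b. a = b + 1)"

lemma zero_le_ordinal: "0 \<le> (a :: countable_ordinal)"
  unfolding zero_countable_ordinal_def by (rule Least_le) simp

lemma ordinal_plus_props:
  fixes a b :: countable_ordinal
  shows ordinal_le_plus: "a \<le> a + b"
    and ordinal_plus_strict_mono: "d < b \<Longrightarrow> a + d < a + b"
    and ordinal_plus_le: "a \<le> c \<Longrightarrow> (\<And>d. d < b \<Longrightarrow> a + d < c) \<Longrightarrow> a + b \<le> c"
proof -
  let ?P = "\<lambda>c. a \<le> c \<and> (\<forall>d\<in>{..<b}. a + d < c)"
  have eq: "a + b = (LEAST c. ?P c)"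
    by (rule plus_countable_ordinal.simps)
  have "countable (insert a ((+) a ` {..<b}))"
    by (simp add: countable_lessThan_ordinal)
  from countable_ordinals_bounded[OF this]
  obtain c' where "\<forall>x\<in>insert a ((+) a ` {..<b}). x < c'" ..
  then have "?P c'"
    by (simp add: less_imp_le)
  then have "?P (a + b)"
    unfolding eq by (rule LeastI)
  then show "a \<le> a + b" "d < b \<Longrightarrow> a + d < a + b"
    by blast+
  show "a + b \<le> c" if "a \<le> c" "\<And>d. d < b \<Longrightarrow> a + d < c"
    unfolding eq by (rule Least_le) (use that in auto)
qed

lemma ordinal_plus_zero: "a + 0 = (a :: countable_ordinal)"
proof (rule order.antisym)
  show "a + 0 \<le> a"
    by (rule ordinal_plus_le) (use zero_le_ordinal in \<open>auto simp: not_le[symmetric]\<close>)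
qed (rule ordinal_le_plus)

lemma less_one_ordinal_iff: "d < 1 \<longleftrightarrow> d = (0 :: countable_ordinal)"
proof -
  obtain c :: countable_ordinal where "0 < c"
    using countable_ordinals_bounded[of "{0}"] by auto
  then have "(0 :: countable_ordinal) < 1"
    unfolding one_countable_ordinal_def by (rule LeastI)
  moreover have "\<not> 0 < d" if "d < 1"
    using that not_less_Least unfolding one_countable_ordinal_def by blast
  ultimately show ?thesis
    using zero_le_ordinal[of d] by auto
qed

lemma ordinal_plus_one: "a + 1 = (LEAST b :: countable_ordinal. a < b)"
proof (rule Least_equality[symmetric])
  show "a < a + 1"
    using ordinal_plus_strict_mono[of 0 1 a] by (simp add: less_one_ordinal_iff ordinal_plus_zero)
  show "a + 1 \<le> b" if "a < b" for b
    using that by (intro ordinal_plus_le) (auto simp: less_one_ordinal_iff ordinal_plus_zero)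
qed

lemma ordinal_less_plus_one_iff: "d < a + 1 \<longleftrightarrow> d \<le> (a :: countable_ordinal)"
proof
  obtain c where "a < c"
    using countable_ordinals_bounded[of "{a}"] by auto
  then have "a < a + 1"
    unfolding ordinal_plus_one by (rule LeastI)
  then show "d \<le> a \<Longrightarrow> d < a + 1" by simp
  show "d < a + 1 \<Longrightarrow> d \<le> a"
    unfolding ordinal_plus_one using not_less_Least by (meson not_le)
qed

lemma ordinal_plus_succ: "a + (b + 1) = (a + b) + (1 :: countable_ordinal)"
proof (rule order.antisym)
  show "a + (b + 1) \<le> (a + b) + 1"
  proof (rule ordinal_plus_le)
    show "a \<le> a + b + 1"
      by (meson ordinal_le_plus order_trans)
    show "a + d < a + b + 1" if "d < b + 1" for d
      using that by (auto simp: ordinal_less_plus_one_iff order.order_iff_strict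
          intro: ordinal_plus_strict_mono)
  qed
  show "(a + b) + 1 \<le> a + (b + 1)"
  proof (rule ordinal_plus_le)
    have "a + b < a + (b + 1)"
      by (rule ordinal_plus_strict_mono) (simp add: ordinal_less_plus_one_iff)
    then show "a + b \<le> a + (b + 1)" "\<And>d. d < 1 \<Longrightarrow> (a + b) + d < a + (b + 1)"
      by (auto simp: less_one_ordinal_iff ordinal_plus_zero)
  qed
qed

lemma ordinal_plus_limit:
  assumes "is_limit b"
  shows "a + b = (LEAST c. \<forall>d<b. a + d \<le> c)"
proof (rule Least_equality[symmetric])
  show "\<forall>d<b. a + d \<le> a + b"
    by (auto intro: less_imp_le ordinal_plus_strict_mono)
  fix c assume c: "\<forall>d<b. a + d \<le> c"
  show "a + b \<le> c"
  proof (rule ordinal_plus_le)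
    have "0 < b"
      using assms zero_le_ordinal[of b] by (auto simp: is_limit_def)
    with c show "a \<le> c"
      by (metis ordinal_plus_zero)
    fix d assume "d < b"
    then have "d + 1 \<le> b"
      by (intro ordinal_plus_le) (auto simp: less_one_ordinal_iff ordinal_plus_zero)
    then have "d + 1 < b"
      using assms by (auto simp: is_limit_def order.order_iff_strict)
    then have "(a + d) + 1 \<le> c"
      using c by (metis ordinal_plus_succ)
    then show "a + d < c"
      using ordinal_less_plus_one_iff[of "a + d" "a + d"] by (meson order_refl less_le_trans)
  qed
qed


section \<open>Fractional ordinals\<close>

datatype fractional_ordinal =
    Whole countable_ordinal    \<comment> \<open>\<open>\<alpha>\<close>\<close>
  | Half countable_ordinal     \<comment> \<open>\<open>\<alpha> + 1/2\<close>\<close>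
  | HalfEps countable_ordinal  \<comment> \<open>\<open>\<alpha> + 1/2 + \<epsilon>\<close>\<close>

fun ordinal_part :: "fractional_ordinal \<Rightarrow> countable_ordinal" where
  "ordinal_part (Whole a) = a"
| "ordinal_part (Half a) = a"
| "ordinal_part (HalfEps a) = a"

fun fraction_rank :: "fractional_ordinal \<Rightarrow> nat" where
  "fraction_rank (Whole a) = 0"
| "fraction_rank (Half a) = 1"
| "fraction_rank (HalfEps a) = 2"

instantiation fractional_ordinal :: linorder
begin

definition less_eq_fractional_ordinal :: "fractional_ordinal \<Rightarrow> fractional_ordinal \<Rightarrow> bool" where
  "x \<le> y \<longleftrightarrow> ordinal_part x < ordinal_part y \<or>
     ordinal_part x = ordinal_part y \<and> fraction_rank x \<le> fraction_rank y"

definition less_fractional_ordinal :: "fractional_ordinal \<Rightarrow> fractional_ordinal \<Rightarrow> bool" where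
  "x < y \<longleftrightarrow> x \<le> y \<and> \<not> y \<le> (x :: fractional_ordinal)"

instance
proof
  fix x y z :: fractional_ordinal
  show "x < y \<longleftrightarrow> x \<le> y \<and> \<not> y \<le> x"
    by (rule less_fractional_ordinal_def)
  show "x \<le> x" "x \<le> y \<Longrightarrow> y \<le> z \<Longrightarrow> x \<le> z" "x \<le> y \<or> y \<le> x"
    by (auto simp: less_eq_fractional_ordinal_def)
  show "x \<le> y \<Longrightarrow> y \<le> x \<Longrightarrow> x = y"
    by (cases x; cases y) (auto simp: less_eq_fractional_ordinal_def)
qed

end

lemma fractional_ordinal_order:
  "Whole a < Half a" "Half a < HalfEps a" "HalfEps a < Whole (a + 1)"
  using ordinal_less_plus_one_iff[of a a]
  by (auto simp: less_fractional_ordinal_def less_eq_fractional_ordinal_def)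

fun plus_fractional :: "countable_ordinal \<Rightarrow> fractional_ordinal \<Rightarrow> fractional_ordinal" where
  "plus_fractional b (Whole a) = Whole (b + a)"
| "plus_fractional b (Half a) = Half (b + a)"
| "plus_fractional b (HalfEps a) = HalfEps (b + a)"

definition is_limit_ordinal :: "fractional_ordinal \<Rightarrow> bool" where
  "is_limit_ordinal x \<longleftrightarrow> (\<exists>a. x = Whole a \<and> is_limit a)"


section \<open>Borel classes\<close>

text \<open>\<open>sigma0 T a A\<close> and \<open>pi0 T a A\<close> can only hold for \<open>1 \<le> a\<close>.\<close>

inductive sigma0 :: "'a topology \<Rightarrow> countable_ordinal \<Rightarrow> 'a set \<Rightarrow> bool"
  and pi0 :: "'a topology \<Rightarrow> countable_ordinal \<Rightarrow> 'a set \<Rightarrow> bool"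
  for T :: "'a topology" where
  sigma0_open: "openin T U \<Longrightarrow> sigma0 T 1 U"
| sigma0_Union: "1 < a \<Longrightarrow> \<forall>n :: nat. \<exists>b. 1 \<le> b \<and> b < a \<and> pi0 T b (A n) \<Longrightarrow>
    sigma0 T a (\<Union>n. A n)"
| pi0_complement: "sigma0 T a A \<Longrightarrow> pi0 T a (topspace T - A)"

definition difference_pi0 :: "'a topology \<Rightarrow> countable_ordinal \<Rightarrow> 'a set \<Rightarrow> bool" where
  "difference_pi0 T a A \<longleftrightarrow> (\<exists>B C. pi0 T a B \<and> sigma0 T a C \<and> A = B \<inter> C)"

text \<open>
  If \<open>a = \<lambda> + n\<close> with \<open>\<lambda>\<close> zero or limit and \<open>n\<close> finite, then \<open>n \<ge> 1\<close> exactly when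
  \<open>a\<close> is neither zero nor limit, and \<open>1 + \<lambda> + n + 1 = 1 + a + 1\<close>.
\<close>

definition gamma_class :: "'a topology \<Rightarrow> countable_ordinal \<Rightarrow> 'a set \<Rightarrow> bool" where
  "gamma_class T a = (if a = 0 \<or> is_limit a then pi0 T (1 + a) else pi0 T (1 + a + 1))"


section \<open>Polish groups and phantom length\<close>

definition polish_space_topology :: "'a topology \<Rightarrow> bool" where
  "polish_space_topology T \<longleftrightarrow> separable_space T \<and> completely_metrizable_space T"

definition topological_group :: "('a, 'b) monoid_scheme \<Rightarrow> 'a topology \<Rightarrow> bool" where
  "topological_group G T \<longleftrightarrow> group G \<and> topspace T = carrier G \<and>
     continuous_map (prod_topology T T) T (\<lambda>(x, y). x \<otimes>\<^bsub>G\<^esub> y) \<and>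
     continuous_map T T (m_inv G)"

definition polish_group :: "('a, 'b) monoid_scheme \<Rightarrow> 'a topology \<Rightarrow> bool" where
  "polish_group G T \<longleftrightarrow> topological_group G T \<and> polish_space_topology T"

definition polish_subgroup_topology ::
    "('a, 'b) monoid_scheme \<Rightarrow> 'a topology \<Rightarrow> 'a set \<Rightarrow> 'a topology \<Rightarrow> bool" where
  "polish_subgroup_topology G T H S \<longleftrightarrow>
     polish_group (G\<lparr>carrier := H\<rparr>) S \<and> continuous_map S T (\<lambda>x. x)"

definition polish_subgroup :: "('a, 'b) monoid_scheme \<Rightarrow> 'a topology \<Rightarrow> 'a set \<Rightarrow> bool" where
  "polish_subgroup G T H \<longleftrightarrow> subgroup H G \<and> (\<exists>S. polish_subgroup_topology G T H S)"

definition polish_topology_of ::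
    "('a, 'b) monoid_scheme \<Rightarrow> 'a topology \<Rightarrow> 'a set \<Rightarrow> 'a topology" where
  "polish_topology_of G T H = (THE S. polish_subgroup_topology G T H S)"

text \<open>
  A homogeneous space with a Polish cover \<open>G/N\<close> is given by a group \<open>G\<close>, its Polish topology
  \<open>T\<close> and a Polish subgroup \<open>N\<close>; \<open>phantom_subgroup G T N a\<close> is the group \<open>G\<^sub>a\<close>,
  so that \<open>Ph\<^sup>a(G/N) = G\<^sub>a/N\<close>. The Polish topology of \<open>N\<close> is determined by \<open>N\<close>
  and plays no role in the definitions.
\<close>

definition phantom_subgroup ::
    "('a, 'b) monoid_scheme \<Rightarrow> 'a topology \<Rightarrow> 'a set \<Rightarrow> countable_ordinal \<Rightarrow> 'a set" where
  "phantom_subgroup G T N a =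
     (LEAST H. polish_subgroup G T H \<and> N \<subseteq> H \<and> gamma_class T a H)"

definition phantom_length ::
    "('a, 'b) monoid_scheme \<Rightarrow> 'a topology \<Rightarrow> 'a set \<Rightarrow> fractional_ordinal" where
  "phantom_length G T N = (THE l. \<forall>a.
     (let Ga = phantom_subgroup G T N a; Ta = polish_topology_of G T Ga in
       (l \<le> Whole a \<longleftrightarrow> Ga = N) \<and>
       (l \<le> Half a \<longleftrightarrow> sigma0 Ta (1 + 1) N) \<and>
       (l \<le> HalfEps a \<longleftrightarrow> difference_pi0 Ta (1 + 1) N)))"


section \<open>Unital C*-algebras\<close>

text \<open>
  The class \<^class>\<open>monoid_mult\<close> is used instead of \<^class>\<open>real_normed_algebra_1\<close>
  so that the zero algebra is not excluded.
\<close>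

class unital_cstar_algebra = banach + real_normed_algebra + monoid_mult +
  fixes scaleC :: "complex \<Rightarrow> 'a \<Rightarrow> 'a" (infixr \<open>*\<^sub>C\<close> 75)
    and star :: "'a \<Rightarrow> 'a"
  assumes scaleC_add_right: "c *\<^sub>C (x + y) = c *\<^sub>C x + c *\<^sub>C y"
    and scaleC_add_left: "(c + d) *\<^sub>C x = c *\<^sub>C x + d *\<^sub>C x"
    and scaleC_scaleC: "c *\<^sub>C d *\<^sub>C x = (c * d) *\<^sub>C x"
    and scaleC_of_real: "complex_of_real r *\<^sub>C x = r *\<^sub>R x"
    and mult_scaleC_left: "(c *\<^sub>C x) * y = c *\<^sub>C (x * y)"
    and mult_scaleC_right: "x * (c *\<^sub>C y) = c *\<^sub>C (x * y)"
    and norm_scaleC: "norm (c *\<^sub>C x) = cmod c * norm x"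
    and star_star: "star (star x) = x"
    and star_add: "star (x + y) = star x + star y"
    and star_scaleC: "star (c *\<^sub>C x) = cnj c *\<^sub>C star x"
    and star_mult: "star (x * y) = star y * star x"
    and cstar_identity: "norm (star x * x) = (norm x)\<^sup>2"

instantiation complex :: unital_cstar_algebra
begin

definition scaleC_complex :: "complex \<Rightarrow> complex \<Rightarrow> complex" where
  "scaleC_complex c x = c * x"

definition star_complex :: "complex \<Rightarrow> complex" where
  "star_complex x = cnj x"

instance
  by standard
     (simp_all add: scaleC_complex_def star_complex_def algebra_simps norm_mult
        power2_eq_square scaleR_conv_of_real)

end

definition clinear_map :: "('a :: unital_cstar_algebra \<Rightarrow> 'a) \<Rightarrow> bool" where
  "clinear_map f \<longleftrightarrow> (\<forall>x y. f (x + y) = f x + f y) \<and> (\<forall>c x. f (c *\<^sub>C x) = c *\<^sub>C f x)"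


section \<open>Derivation length\<close>

definition star_derivation :: "('a :: unital_cstar_algebra \<Rightarrow> 'a) \<Rightarrow> bool" where
  "star_derivation d \<longleftrightarrow> clinear_map d \<and> (\<forall>x y. d (x * y) = d x * y + x * d y) \<and>
     (\<forall>x. star x = x \<longrightarrow> star (d x) = d x)"

definition ad :: "'a :: unital_cstar_algebra \<Rightarrow> 'a \<Rightarrow> 'a" where
  "ad x y = x * y - y * x"

definition inner_derivation :: "('a :: unital_cstar_algebra \<Rightarrow> 'a) \<Rightarrow> bool" where
  "inner_derivation d \<longleftrightarrow> (\<exists>h. star h = h \<and> d = ad (\<i> *\<^sub>C h))"

text \<open>
  Derivations of a C*-algebra are automatically bounded, so \<open>aut(A)\<close> with the operator norm is
  a subspace of the normed space \<^typ>\<open>'a \<Rightarrow>\<^sub>L 'a\<close>.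
\<close>

definition aut_space :: "('a :: unital_cstar_algebra \<Rightarrow>\<^sub>L 'a) set" where
  "aut_space = {f. star_derivation (blinfun_apply f)}"

definition inn_space :: "('a :: unital_cstar_algebra \<Rightarrow>\<^sub>L 'a) set" where
  "inn_space = {f. inner_derivation (blinfun_apply f)}"

definition ph1_aut :: "('a :: unital_cstar_algebra \<Rightarrow>\<^sub>L 'a) set" where
  "ph1_aut = (top_of_set aut_space) closure_of inn_space"

definition ph1_aut_group :: "('a :: unital_cstar_algebra \<Rightarrow>\<^sub>L 'a) monoid" where
  "ph1_aut_group = \<lparr>carrier = ph1_aut, mult = (+), one = 0\<rparr>"

definition derivation_length :: "'a :: unital_cstar_algebra itself \<Rightarrow> fractional_ordinal" where
  "derivation_length _ =
     (if \<forall>d :: 'a \<Rightarrow> 'a. star_derivation d \<longrightarrow> inner_derivation d then Whole 0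
      else plus_fractional 1
        (phantom_length (ph1_aut_group :: ('a \<Rightarrow>\<^sub>L 'a) monoid) (top_of_set ph1_aut) inn_space))"


section \<open>Automorphism length\<close>

definition star_automorphism :: "('a :: unital_cstar_algebra \<Rightarrow> 'a) \<Rightarrow> bool" where
  "star_automorphism f \<longleftrightarrow> bij f \<and> clinear_map f \<and> (\<forall>x y. f (x * y) = f x * f y) \<and>
     (\<forall>x. f (star x) = star (f x))"

definition Aut :: "('a :: unital_cstar_algebra \<Rightarrow> 'a) set" where
  "Aut = {f. star_automorphism f}"

definition Aut_group :: "('a :: unital_cstar_algebra \<Rightarrow> 'a) monoid" where
  "Aut_group = \<lparr>carrier = Aut, mult = (\<circ>), one = id\<rparr>"

definition Aut_topology :: "('a :: unital_cstar_algebra \<Rightarrow> 'a) topology" where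
  "Aut_topology = subtopology (product_topology (\<lambda>_. euclidean) UNIV) Aut"

definition unitary :: "'a :: unital_cstar_algebra \<Rightarrow> bool" where
  "unitary u \<longleftrightarrow> star u * u = 1 \<and> u * star u = 1"

definition Ad :: "'a :: unital_cstar_algebra \<Rightarrow> 'a \<Rightarrow> 'a" where
  "Ad u x = u * x * star u"

definition Inn :: "('a :: unital_cstar_algebra \<Rightarrow> 'a) set" where
  "Inn = {Ad u | u. unitary u}"

definition automorphism_length :: "'a :: unital_cstar_algebra itself \<Rightarrow> fractional_ordinal" where
  "automorphism_length _ =
     phantom_length (Aut_group :: ('a \<Rightarrow> 'a) monoid) Aut_topology Inn"

end

(*
  Write N for the Polish subgroup, as the image of a complete separable group K with a two-sided
  invariant metric: the self-adjoint elements for the derivations, the unitaries for the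
  automorphisms.  Let P r be the image of the ball of radius r.  The a-th phantom subgroup S a is
  obtained by transfinite recursion together with its Polish topology tau a: for a > 0, every neighbourhood of 1
  in tau a contains the tau b-closure "core b r" of some P r, for some b < a, intersected with S a.
  Vaught transforms along K show that S a is the least subgroup of its Borel class; an open mapping
  theorem gives the uniqueness of Polish group topologies and S a = N for some a.

  If S a = N at a limit a, then by the open mapping theorem P e contains the intersection of N with a
  neighbourhood of 1 in tau b for some b < a.  In both applications an element of P e whose square
  lies in P s lies in P (2 s / 3).  Iterating, every P r contains the intersection of N with a
  neighbourhood of 1 in tau b, so N = S b already.
*)
theory Submission
  imports Defs "HOL-Algebra.Coset"
begin

section \<open>Ordinals and Borel classes\<close>

text \<open>A limit stage is special only because a basic neighbourhood mentions finitely many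
  earlier stages: below a limit there is room for the successor of their maximum. The open mapping
  theorem then controls one radius e, whereas equality of stages needs all radii at one fixed stage;
  pulling back along squaring, which is continuous in every \<open>tau b\<close>, supplies the
  remaining radii without climbing further. The factor 2/3 is what the quadratic error term for
  unitaries leaves; self-adjoint elements admit exact halving, with factor 1/2. For automorphisms
  the obstacle is that \<open>Ad u\<close> determines u only up to a central unitary, so a square
  root has to be corrected by a central square root before its distance to 1 can be estimated. The
  length and the phantom subgroups are introduced by THE and LEAST. Nothing can be inferred about
  them until the least subgroup, the uniqueness of its Polish topology and the existence of the
  length are established; this is the purpose of the general theory, which is carried out once for
  both groups.\<close>

lemma ordinal_plus_less_iff: "a + b < a + c \<longleftrightarrow> b < (c :: countable_ordinal)"
  using ordinal_plus_strict_mono[of b c a] ordinal_plus_strict_mono[of c b a]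
  by (cases b c rule: linorder_cases) auto

lemma ordinal_plus_le_iff: "a + b \<le> a + c \<longleftrightarrow> b \<le> (c :: countable_ordinal)"
  by (simp add: not_less[symmetric] ordinal_plus_less_iff)

lemma ordinal_less_succ: "a < a + (1 :: countable_ordinal)"
  by (simp add: ordinal_less_plus_one_iff)

lemma ordinal_succ_le_iff: "a + 1 \<le> b \<longleftrightarrow> a < (b :: countable_ordinal)"
  by (simp add: not_less[symmetric] ordinal_less_plus_one_iff)

lemma ordinal_succ_less_limit:
  assumes "is_limit b" "a < b" shows "a + 1 < b"
proof -
  have "a + 1 \<le> b" using assms(2) by (simp add: ordinal_succ_le_iff)
  moreover have "a + 1 \<noteq> b" using assms(1) unfolding is_limit_def by blast
  ultimately show ?thesis by simp
qed

lemma ordinal_le_plus_left: "b \<le> a + (b :: countable_ordinal)"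
proof (induction b rule: less_induct)
  case (less b)
  have "\<not> a + b < b"
  proof
    assume "a + b < b"
    from less[OF this] ordinal_plus_strict_mono[OF this, of a] show False by simp
  qed
  then show ?case by simp
qed

lemma ordinal_one_plus_ge: "1 \<le> 1 + (a :: countable_ordinal)"
  by (rule ordinal_le_plus)

lemma ordinal_one_less_one_plus: "a \<noteq> 0 \<Longrightarrow> 1 < 1 + (a :: countable_ordinal)"
proof -
  assume "a \<noteq> 0"
  then have "0 < a" using zero_le_ordinal[of a] by simp
  then have "1 + 0 < 1 + a" by (rule ordinal_plus_strict_mono)
  then show ?thesis by (simp add: ordinal_plus_zero)
qed

text \<open>Borel indices start at 1 and stages at 0; this turns an arbitrary Borel index into a
  stage. The least c with b <= 1 + c attains equality, since 1 + d < b for all d < c bounds 1 + c by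
  b.\<close>

lemma ordinal_one_plus_cases:
  assumes "1 \<le> (b :: countable_ordinal)" obtains c where "b = 1 + c"
proof -
  define c where "c = (LEAST c. b \<le> 1 + c)"
  have "b \<le> 1 + c"
    unfolding c_def using ordinal_le_plus_left by (rule LeastI)
  moreover have "1 + c \<le> b"
    using assms by (rule ordinal_plus_le) (metis c_def not_less not_less_Least)
  ultimately show ?thesis using that by force
qed

text \<open>The derivation length is 1 plus a phantom length; this reduces its claim to the phantom
  length.\<close>

lemma is_limit_one_plus: "is_limit (1 + a) \<Longrightarrow> is_limit a"
proof -
  assume lim: "is_limit (1 + a)"
  have "(1 :: countable_ordinal) = 0 + 1"
    by (subst ordinal_plus_one) (rule one_countable_ordinal_def)
  with lim have "a \<noteq> 0"
    by (auto simp: is_limit_def ordinal_plus_zero)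
  moreover have "a \<noteq> b + 1" for b
    using lim ordinal_plus_succ[of 1 b] by (auto simp: is_limit_def)
  ultimately show "is_limit a"
    by (simp add: is_limit_def)
qed

text \<open>Each element enters at a first stage \<open>f e\<close>, and countably many countable
  ordinals have a countable upper bound.\<close>

lemma increasing_subsets_stabilize:
  fixes R :: "countable_ordinal \<Rightarrow> 'a set"
  assumes mono: "\<And>a b. a \<le> b \<Longrightarrow> R a \<subseteq> R b" and "countable E" "\<And>a. R a \<subseteq> E"
  shows "\<exists>a. R (a + 1) = R a"
proof -
  define f where "f e = (LEAST a. e \<in> R a)" for e
  have "countable (f ` (\<Union>a. R a))"
    using assms by (intro countable_image) (meson UN_least countable_subset)
  then obtain b where b: "\<And>e. e \<in> (\<Union>a. R a) \<Longrightarrow> f e < b"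
    using countable_ordinals_bounded by (metis imageI)
  have "R a \<subseteq> R b" for a
  proof
    fix e assume "e \<in> R a"
    then have "e \<in> R (f e)"
      unfolding f_def by (rule LeastI)
    moreover have "f e < b"
      using b[of e] \<open>e \<in> R a\<close> by blast
    ultimately show "e \<in> R b" using mono[OF less_imp_le] by blast
  qed
  then show ?thesis
    by (metis mono order.antisym ordinal_less_succ order.strict_implies_order)
qed

section \<open>Closure properties of the Borel classes\<close>

lemma sigma0_pi0_subset:
  shows "sigma0 T a A \<Longrightarrow> A \<subseteq> topspace T" and "pi0 T a A \<Longrightarrow> A \<subseteq> topspace T"
proof (induction rule: sigma0_pi0.inducts)
  case (sigma0_open U) then show ?case by (rule openin_subset)
qed blast+

lemma sigma0_pi0_index:
  shows "sigma0 T a A \<Longrightarrow> 1 \<le> a" and "pi0 T a A \<Longrightarrow> 1 \<le> a"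
  by (induction rule: sigma0_pi0.inducts) auto

lemma pi0_iff: "pi0 T a A \<longleftrightarrow> A \<subseteq> topspace T \<and> sigma0 T a (topspace T - A)"
proof
  assume "pi0 T a A"
  then show "A \<subseteq> topspace T \<and> sigma0 T a (topspace T - A)"
  proof cases
    case (pi0_complement B)
    then have "topspace T - A = B"
      using sigma0_pi0_subset(1) by blast
    then show ?thesis using pi0_complement by blast
  qed
next
  assume "A \<subseteq> topspace T \<and> sigma0 T a (topspace T - A)"
  then show "pi0 T a A"
    by (metis Diff_Diff_Int inf.absorb_iff2 pi0_complement)
qed

lemma sigma0_one: "sigma0 T 1 A \<longleftrightarrow> openin T A"
proof
  assume "sigma0 T 1 A"
  then show "openin T A"
    by cases auto
qed (rule sigma0_open)

lemma pi0_one: "pi0 T 1 A \<longleftrightarrow> closedin T A"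
  by (simp add: pi0_iff sigma0_one closedin_def)

lemma sigma0_cases_Union:
  assumes "sigma0 T a A" "1 < a"
  obtains B where "A = (\<Union>n :: nat. B n)" "\<And>n. \<exists>b. 1 \<le> b \<and> b < a \<and> pi0 T b (B n)"
  using assms by cases auto

lemma pi0_imp_sigma0: "pi0 T a A \<Longrightarrow> a < b \<Longrightarrow> sigma0 T b A"
  using sigma0_Union[of b T "\<lambda>_. A"] sigma0_pi0_index(2)[of T a A]
  by (metis UN_constant UNIV_not_empty order.strict_trans1)

lemma sigma0_imp_pi0: "sigma0 T a A \<Longrightarrow> a < b \<Longrightarrow> pi0 T b A"
  by (metis pi0_complement pi0_iff pi0_imp_sigma0 sigma0_pi0_subset(1))

text \<open>Only the passage from class 1 upwards uses the metric: open sets must be countable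
  unions of closed sets. From class 2 on, the same union is admissible for every larger
  index.\<close>

lemma sigma0_mono:
  assumes "metrizable_space T" "sigma0 T a A" "a \<le> b" shows "sigma0 T b A"
proof (cases "a = b")
  case False
  with assms have "a < b" by simp
  from assms(2) show ?thesis
  proof cases
    case sigma0_open
    have "fsigma_in T A"
      using assms(1) sigma0_open by (simp add: open_imp_fsigma_in)
    then obtain C :: "nat \<Rightarrow> _" where "\<And>n. closedin T (C n)" "A = (\<Union>n. C n)"
      unfolding fsigma_in_ascending by blast
    moreover have "1 < b" using sigma0_open \<open>a < b\<close> by simp
    ultimately show ?thesis
      using sigma0_Union[of b T C] pi0_one by (metis order_refl)
  next
    case (sigma0_Union B)
    then show ?thesis
      using \<open>a < b\<close> sigma0_pi0.sigma0_Union[of b T B] by (metis order.strict_trans)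
  qed
qed (use assms in simp)

lemma pi0_mono: "metrizable_space T \<Longrightarrow> pi0 T a A \<Longrightarrow> a \<le> b \<Longrightarrow> pi0 T b A"
  using sigma0_mono pi0_iff by metis

lemma sigma0_UN_nat:
  fixes A :: "nat \<Rightarrow> 'a set"
  assumes "\<And>n. sigma0 T a (A n)" shows "sigma0 T a (\<Union>n. A n)"
proof (cases "a = 1")
  case True
  with assms show ?thesis by (auto simp: sigma0_one)
next
  case False
  then have a: "1 < a" using sigma0_pi0_index(1)[OF assms[of 0]] by simp
  have "\<exists>B. A n = (\<Union>m :: nat. B m) \<and> (\<forall>m. \<exists>b. 1 \<le> b \<and> b < a \<and> pi0 T b (B m))" for n
    using sigma0_cases_Union[OF assms a] by metis
  then obtain B where B: "\<And>n. A n = (\<Union>m :: nat. B n m)"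
      "\<And>n m. \<exists>b. 1 \<le> b \<and> b < a \<and> pi0 T b (B n m)"
    by metis
  have "(\<Union>n. A n) = (\<Union>k. case_prod B (prod_decode k))"
  proof -
    have "(\<Union>n. A n) = (\<Union>z. case_prod B z)"
      unfolding B(1) by auto
    also have "\<dots> = (\<Union>k. case_prod B (prod_decode k))"
      using surj_prod_decode by (metis image_image)
    finally show ?thesis .
  qed
  moreover have "\<exists>b. 1 \<le> b \<and> b < a \<and> pi0 T b (case_prod B (prod_decode k))" for k
    using B(2) by (simp add: case_prod_unfold)
  ultimately show ?thesis
    using sigma0_Union[OF a, of T "\<lambda>k. case_prod B (prod_decode k)"] by metis
qed

lemma sigma0_empty: "1 \<le> a \<Longrightarrow> sigma0 T a {}"
  by (cases "1 < a") (auto simp: sigma0_one pi0_one intro!: pi0_imp_sigma0[of T 1])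

lemma sigma0_UN:
  assumes "countable I" "1 \<le> a" "\<And>i. i \<in> I \<Longrightarrow> sigma0 T a (A i)" shows "sigma0 T a (\<Union>i\<in>I. A i)"
proof (cases "I = {}")
  case False
  then have "(\<Union>i\<in>I. A i) = (\<Union>n. A (from_nat_into I n))"
    using assms(1) by (metis image_image range_from_nat_into)
  then show ?thesis
    using sigma0_UN_nat[of T a] assms(3) from_nat_into[OF False] by presburger
qed (simp add: sigma0_empty assms)

lemma sigma0_UN_pi0:
  assumes "countable I" "1 < a" "\<And>i. i \<in> I \<Longrightarrow> \<exists>b<a. pi0 T b (A i)" shows "sigma0 T a (\<Union>i\<in>I. A i)"
  using assms by (intro sigma0_UN) (auto intro: pi0_imp_sigma0 simp: less_imp_le)

lemma pi0_INT:
  assumes "countable I" "I \<noteq> {}" "\<And>i. i \<in> I \<Longrightarrow> pi0 T a (A i)" shows "pi0 T a (\<Inter>i\<in>I. A i)"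
proof -
  have "1 \<le> a" using assms(2,3) sigma0_pi0_index(2) by blast
  then have "sigma0 T a (\<Union>i\<in>I. topspace T - A i)"
    using assms by (intro sigma0_UN) (auto simp: pi0_iff)
  moreover have "topspace T - (\<Inter>i\<in>I. A i) = (\<Union>i\<in>I. topspace T - A i)"
    using assms(2) by blast
  ultimately show ?thesis
    using assms(2,3) pi0_iff[of T a "\<Inter>i\<in>I. A i"] sigma0_pi0_subset(2) by (metis INF_lower2 all_not_in_conv)
qed

lemma pi0_Int: "pi0 T a A \<Longrightarrow> pi0 T a B \<Longrightarrow> pi0 T a (A \<inter> B)"
  using pi0_INT[of "{True, False}" T a "\<lambda>i. if i then A else B"] by (simp add: Int_commute)

section \<open>Baire category\<close>

lemma separable_metrizable_imp_second_countable:
  assumes "separable_space X" "metrizable_space X" shows "second_countable X"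
proof -
  obtain M d where "Metric_space M d" and X: "X = Metric_space.mtopology M d"
    using assms(2) unfolding metrizable_space_def by blast
  interpret Metric_space M d by fact
  obtain D where D: "countable D" "D \<subseteq> M" "X closure_of D = M"
    using assms(1) by (auto simp: separable_space_def X)
  let ?B = "(\<lambda>(a, n). mball a (inverse (real (Suc n)))) ` (D \<times> UNIV)"
  have "countable ?B"
    using D(1) by (intro countable_image countable_SIGMA) auto
  moreover have "\<exists>V\<in>?B. x \<in> V \<and> V \<subseteq> U" if U: "openin X U" "x \<in> U" for U x
  proof -
    have "x \<in> M" using openin_subset[OF U(1)] U(2) by (auto simp: X)
    obtain r where r: "r > 0" "mball x r \<subseteq> U"
      using U unfolding X openin_mtopology by meson
    obtain n where n: "inverse (real (Suc n)) < r / 2"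
      using r(1) reals_Archimedean[of "r / 2"] by auto
    have "openin X (mball x (inverse (real (Suc n))))" "x \<in> mball x (inverse (real (Suc n)))"
      using \<open>x \<in> M\<close> by (auto simp: X)
    moreover have "x \<in> X closure_of D" using D(3) \<open>x \<in> M\<close> by simp
    ultimately obtain a where a: "a \<in> D" "a \<in> mball x (inverse (real (Suc n)))"
      unfolding in_closure_of by meson
    have "mball a (inverse (real (Suc n))) \<subseteq> mball x r"
      using a n by (intro mball_subset) (auto simp: commute)
    moreover have "x \<in> mball a (inverse (real (Suc n)))"
      using a(2) by (auto simp: commute)
    ultimately show ?thesis using a(1) r(2) by blast
  qed
  moreover have "\<forall>V\<in>?B. openin X V" by (auto simp: X)
  ultimately show ?thesis
    unfolding second_countable_def by (intro exI[of _ ?B]) simp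
qed

text \<open>Meagerness is phrased by closed sets with empty interior, the form in which
  \<open>Baire_category_alt\<close> applies.\<close>

definition meager_in :: "'a topology \<Rightarrow> 'a set \<Rightarrow> bool" where
  "meager_in X M \<longleftrightarrow>
     (\<exists>\<G>. countable \<G> \<and> (\<forall>C\<in>\<G>. closedin X C \<and> X interior_of C = {}) \<and> M \<subseteq> \<Union>\<G>)"

lemma meager_in_subset: "meager_in X M \<Longrightarrow> L \<subseteq> M \<Longrightarrow> meager_in X L"
  unfolding meager_in_def by (meson order_trans)

lemma meager_in_closed: "closedin X C \<Longrightarrow> X interior_of C = {} \<Longrightarrow> meager_in X C"
  unfolding meager_in_def by (rule exI[of _ "{C}"]) simp

lemma meager_in_empty: "meager_in X {}"
  unfolding meager_in_def by blast

lemma meager_in_UN: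
  assumes "countable I" "\<And>i. i \<in> I \<Longrightarrow> meager_in X (M i)" shows "meager_in X (\<Union>i\<in>I. M i)"
proof -
  obtain \<G> where "\<And>i. i \<in> I \<Longrightarrow> countable (\<G> i) \<and>
      (\<forall>C\<in>\<G> i. closedin X C \<and> X interior_of C = {}) \<and> M i \<subseteq> \<Union>(\<G> i)"
    using assms(2) unfolding meager_in_def by metis
  note \<G> = this
  show ?thesis
    unfolding meager_in_def
  proof (intro exI conjI)
    show "countable (\<Union>i\<in>I. \<G> i)" using assms(1) \<G> by (intro countable_UN) auto
    show "\<forall>C\<in>\<Union>i\<in>I. \<G> i. closedin X C \<and> X interior_of C = {}" using \<G> by auto
    show "(\<Union>i\<in>I. M i) \<subseteq> \<Union>(\<Union>i\<in>I. \<G> i)"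
    proof
      fix x assume "x \<in> (\<Union>i\<in>I. M i)"
      then obtain i where "i \<in> I" "x \<in> M i" by blast
      then show "x \<in> \<Union>(\<Union>i\<in>I. \<G> i)" using \<G>[of i] by (meson UN_I UnionE UnionI subsetD)
    qed
  qed
qed

lemma meager_in_Un: "meager_in X A \<Longrightarrow> meager_in X B \<Longrightarrow> meager_in X (A \<union> B)"
  using meager_in_UN[of "{True, False}" X "\<lambda>i. if i then A else B"] by (auto simp: Un_commute)

lemma meager_in_closure_diff:
  assumes "openin X U" shows "meager_in X (X closure_of U - U)"
proof (rule meager_in_closed)
  show "closedin X (X closure_of U - U)"
    using assms by (simp add: closedin_diff)
  show "X interior_of (X closure_of U - U) = {}"
  proof (rule ccontr)
    assume "\<not> ?thesis"
    then obtain x V where V: "openin X V" "x \<in> V" "V \<subseteq> X closure_of U - U"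
      unfolding interior_of_def by auto
    then show False using in_closure_of[of x X U] by blast
  qed
qed

lemma not_meager_in_openin:
  assumes "completely_metrizable_space X" "openin X U" "U \<noteq> {}" shows "\<not> meager_in X U"
proof
  assume "meager_in X U"
  then obtain \<G> where \<G>: "countable \<G>" "\<And>C. C \<in> \<G> \<Longrightarrow> closedin X C \<and> X interior_of C = {}" "U \<subseteq> \<Union>\<G>"
    unfolding meager_in_def by blast
  then have "X interior_of \<Union>\<G> = {}"
    using assms(1) by (intro Baire_category_alt) auto
  moreover have "U \<subseteq> X interior_of \<Union>\<G>"
    using \<G>(3) assms(2) by (simp add: interior_of_maximal)
  ultimately show False using assms(3) by simp
qed

lemma meager_in_homeomorphic_map:
  assumes "homeomorphic_map X X h" "meager_in X M" shows "meager_in X (h ` M)"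
proof -
  obtain \<G> where \<G>: "countable \<G>" "\<And>C. C \<in> \<G> \<Longrightarrow> closedin X C \<and> X interior_of C = {}" "M \<subseteq> \<Union>\<G>"
    using assms(2) unfolding meager_in_def by blast
  have "closedin X (h ` C) \<and> X interior_of (h ` C) = {}" if "C \<in> \<G>" for C
    using \<G>(2)[OF that] homeomorphic_map_closedness_eq[OF assms(1)]
      homeomorphic_map_interior_of[OF assms(1), of C] closedin_subset by (metis image_empty)
  with \<G>(1,3) show ?thesis
    unfolding meager_in_def by (intro exI[of _ "(`) h ` \<G>"]) (auto, metis UnionE image_eqI subsetD)
qed

text \<open>A form of the Banach category theorem. The basic open sets on which B is meager are
  countably many, and their union is dense in U; the rest of U lies in the boundary of that union,
  which is nowhere dense.\<close>

lemma meager_in_locally: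
  assumes "second_countable X" "openin X U"
    and local: "\<And>V. openin X V \<Longrightarrow> V \<noteq> {} \<Longrightarrow> V \<subseteq> U \<Longrightarrow>
      \<exists>W. openin X W \<and> W \<noteq> {} \<and> W \<subseteq> V \<and> meager_in X (W \<inter> B)"
  shows "meager_in X (U \<inter> B)"
proof -
  obtain \<B> where \<B>: "countable \<B>" "\<And>V. V \<in> \<B> \<Longrightarrow> openin X V"
      "\<And>U x. openin X U \<Longrightarrow> x \<in> U \<Longrightarrow> \<exists>V\<in>\<B>. x \<in> V \<and> V \<subseteq> U"
    using assms(1) unfolding second_countable_def by metis
  define \<W> where "\<W> = {W\<in>\<B>. meager_in X (W \<inter> B)}"
  have "meager_in X (\<Union>W\<in>\<W>. W \<inter> B)"
    using \<B>(1) by (intro meager_in_UN) (auto simp: \<W>_def)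
  moreover have "openin X (\<Union>\<W>)"
    using \<B>(2) by (auto simp: \<W>_def)
  then have "meager_in X (X closure_of \<Union>\<W> - \<Union>\<W>)"
    by (rule meager_in_closure_diff)
  moreover have "U \<subseteq> X closure_of \<Union>\<W>"
  proof
    fix x assume "x \<in> U"
    show "x \<in> X closure_of \<Union>\<W>"
      unfolding in_closure_of
    proof (intro conjI allI impI)
      show "x \<in> topspace X" using \<open>x \<in> U\<close> assms(2) openin_subset by blast
      fix T assume T: "x \<in> T \<and> openin X T"
      then obtain W where W: "openin X W" "W \<noteq> {}" "W \<subseteq> T \<inter> U" "meager_in X (W \<inter> B)"
        using local[of "T \<inter> U"] assms(2) \<open>x \<in> U\<close> by auto
      then obtain y where "y \<in> W" by blast
      then obtain V where V: "V \<in> \<B>" "y \<in> V" "V \<subseteq> W"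
        using \<B>(3) W(1) by blast
      then have "V \<in> \<W>"
        using W(4) by (auto simp: \<W>_def intro: meager_in_subset)
      then show "\<exists>y. y \<in> \<Union>\<W> \<and> y \<in> T"
        using V W(3) by blast
    qed
  qed
  ultimately show ?thesis
    using meager_in_subset[OF meager_in_Un, of X "\<Union>W\<in>\<W>. W \<inter> B" "X closure_of \<Union>\<W> - \<Union>\<W>" "U \<inter> B"]
    by blast
qed

text \<open>
  A residual set of points of the interior of the closure of \<open>f ` V\<close> follows a sequence of open
  sets \<open>W n\<close> shrinking to some \<open>x \<in> V\<close>, all of whose images cluster at the point; the closed graph
  identifies the point with \<open>f x\<close>.
\<close>

lemma almost_open_residual_image:
  assumes X: "completely_metrizable_space X" "second_countable X"
    and graph: "\<And>x y. x \<in> topspace X \<Longrightarrow> y \<in> topspace Y \<Longrightarrow> f x \<noteq> y \<Longrightarrow>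
      \<exists>U V. openin X U \<and> x \<in> U \<and> openin Y V \<and> y \<in> V \<and> f ` U \<inter> V = {}"
    and almost: "\<And>W. openin X W \<Longrightarrow> f ` W \<subseteq> Y interior_of (Y closure_of (f ` W))"
    and V: "openin X V"
  shows "meager_in Y (Y interior_of (Y closure_of (f ` V)) - f ` V)"
proof -
  obtain M d where "Metric_space M d" and mc: "Metric_space.mcomplete M d"
    and X_eq: "X = Metric_space.mtopology M d"
    using X(1) unfolding completely_metrizable_space_def by blast
  interpret Metric_space M d by fact
  obtain \<B> where \<B>: "countable \<B>" "\<And>V. V \<in> \<B> \<Longrightarrow> openin X V"
      "\<And>U x. openin X U \<Longrightarrow> x \<in> U \<Longrightarrow> \<exists>V\<in>\<B>. x \<in> V \<and> V \<subseteq> U"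
    using X(2) unfolding second_countable_def by metis
  define J where "J W = Y interior_of (Y closure_of (f ` W))" for W
  \<comment> \<open>\<open>sub W n\<close> lists the admissible successors of W in a shrinking
    sequence: closure inside W, and contained in a ball of radius 1 / (n + 1).\<close>
  define sub where "sub W n = {W'\<in>\<B>. X closure_of W' \<subseteq> W \<and>
      (\<exists>x\<in>M. W' \<subseteq> mball x (inverse (real (Suc n))))}" for W n
  \<comment> \<open>\<open>E W n\<close> holds the points of \<open>J W\<close> from which the
    sequence cannot be continued. The sets \<open>J W'\<close> of the successors cover the image of
    W, so their union is dense in \<open>J W\<close> and \<open>E W n\<close> lies in its
    boundary.\<close>
  define E where "E W n = J W - (\<Union>W'\<in>sub W n. J W')" for W n
  have sub_cover: "W \<subseteq> \<Union>(sub W n)" if W: "openin X W" for W n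
  proof
    fix x assume "x \<in> W"
    then have "x \<in> M" using openin_subset[OF W] by (auto simp: X_eq)
    have "openin X (W \<inter> mball x (inverse (real (Suc n))))" "x \<in> W \<inter> mball x (inverse (real (Suc n)))"
      using W \<open>x \<in> W\<close> \<open>x \<in> M\<close> by (auto simp: X_eq)
    then obtain U C where UC: "openin X U" "closedin X C" "x \<in> U" "U \<subseteq> C"
        "C \<subseteq> W \<inter> mball x (inverse (real (Suc n)))"
      using regular_space_mtopology unfolding neighbourhood_base_of_closedin[symmetric]
        neighbourhood_base_of X_eq by meson
    obtain W' where W': "W' \<in> \<B>" "x \<in> W'" "W' \<subseteq> U"
      using \<B>(3) UC(1,3) by blast
    then have "X closure_of W' \<subseteq> C"
      using UC by (meson closure_of_minimal order_trans)
    then have "W' \<in> sub W n"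
      using W' UC \<open>x \<in> M\<close> unfolding sub_def by blast
    then show "x \<in> \<Union>(sub W n)" using W' by blast
  qed
  have E_meager: "meager_in Y (E W n)" if W: "openin X W" for W n
  proof -
    let ?O = "\<Union>W'\<in>sub W n. J W'"
    have "openin Y ?O" by (auto simp: J_def)
    moreover have "J W \<subseteq> Y closure_of ?O"
    proof -
      have "f ` W \<subseteq> ?O"
      proof
        fix y assume "y \<in> f ` W"
        then obtain x where "x \<in> W" "y = f x" by blast
        then obtain W' where W': "W' \<in> sub W n" "x \<in> W'"
          using sub_cover[OF W, of n] by blast
        then have "f x \<in> J W'"
          using almost[of W'] \<B>(2) unfolding J_def sub_def by blast
        with W' \<open>y = f x\<close> show "y \<in> ?O" by blast
      qed
      then have "Y closure_of (f ` W) \<subseteq> Y closure_of ?O"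
        by (rule closure_of_mono)
      then show ?thesis unfolding J_def using interior_of_subset by (metis order_trans)
    qed
    ultimately show ?thesis
      unfolding E_def using meager_in_closure_diff meager_in_subset by (metis Diff_mono order_refl)
  qed
  define M0 where "M0 = (\<Union>W\<in>insert V \<B>. \<Union>n. E W n)"
  have "meager_in Y M0"
    unfolding M0_def using \<B>(1,2) V E_meager by (intro meager_in_UN) auto
  moreover have "J V - f ` V \<subseteq> M0"
  proof (rule subsetI, rule ccontr)
    fix y assume y: "y \<in> J V - f ` V" and "y \<notin> M0"
    have y_top: "y \<in> topspace Y"
      using y interior_of_subset_topspace unfolding J_def by fastforce
    let ?P = "\<lambda>n W. (W = V \<or> W \<in> \<B>) \<and> y \<in> J W"
    have step: "\<exists>W'. ?P (Suc n) W' \<and> W' \<in> sub W n" if W: "?P n W" for n W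
    proof -
      have "y \<notin> E W n" using W \<open>y \<notin> M0\<close> unfolding M0_def by blast
      then obtain W' where "W' \<in> sub W n" "y \<in> J W'"
        using W unfolding E_def by blast
      then show ?thesis unfolding sub_def by blast
    qed
    obtain W where W: "\<And>n. ?P n (W n)" "\<And>n. W (Suc n) \<in> sub (W n) n" "W 0 = V"
      using dependent_nat_choice[of "\<lambda>n w. ?P n w \<and> (n = 0 \<longrightarrow> w = V)" "\<lambda>n w w'. w' \<in> sub w n"]
        step y by (metis DiffD1 nat.distinct(1))
    have W_open: "openin X (W n)" for n
      using W(1)[of n] V \<B>(2) by blast
    have W_ne: "W n \<noteq> {}" for n
    proof
      assume "W n = {}"
      then have "J (W n) = {}" unfolding J_def by simp
      with W(1)[of n] show False by blast
    qed
    define C where "C n = X closure_of (W (Suc n))" for n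
    have CW: "C n \<subseteq> W n" for n
      using W(2)[of n] unfolding sub_def C_def by blast
    have WC: "W (Suc n) \<subseteq> C n" for n
      unfolding C_def using W_open by (simp add: closure_of_subset openin_subset)
    have small: "\<exists>a\<in>M. W (Suc n) \<subseteq> mball a (inverse (real (Suc n)))" for n
      using W(2)[of n] unfolding sub_def by blast
    have "\<exists>n a. C n \<subseteq> mcball a e" if e: "e > 0" for e
    proof -
      obtain n where n: "inverse (real (Suc n)) < e"
        using e reals_Archimedean by blast
      obtain a where a: "a \<in> M" "W (Suc n) \<subseteq> mball a (inverse (real (Suc n)))"
        using small by blast
      have "W (Suc n) \<subseteq> mcball a e"
        using a(2) n by (auto simp: mball_def mcball_def)
      then have "C n \<subseteq> mcball a e"
        unfolding C_def X_eq by (rule closure_of_minimal) auto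
      then show ?thesis by blast
    qed
    moreover have "decseq C"
      using CW WC by (intro decseq_SucI) blast
    moreover have "C n \<noteq> {}" for n using WC W_ne by blast
    moreover have "closedin mtopology (C n)" for n by (simp add: C_def X_eq)
    ultimately have "\<Inter>(range C) \<noteq> {}"
      using mc[unfolded mcomplete_nest, rule_format, of C] by simp
    then obtain x where x: "\<And>n. x \<in> C n" by blast
    have xW: "x \<in> W n" for n using x CW by blast
    then have "x \<in> V" using W(3) by metis
    then have "f x \<noteq> y" and x_top: "x \<in> topspace X"
      using y V openin_subset by auto
    then obtain U V' where UV: "openin X U" "x \<in> U" "openin Y V'" "y \<in> V'" "f ` U \<inter> V' = {}"
      using graph[OF x_top y_top] by meson
    obtain r where r: "r > 0" "mball x r \<subseteq> U"
      using UV(1,2) unfolding X_eq openin_mtopology by meson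
    obtain n where n: "inverse (real (Suc n)) < r / 2"
      using r(1) reals_Archimedean[of "r / 2"] by auto
    obtain a where a: "a \<in> M" "W (Suc n) \<subseteq> mball a (inverse (real (Suc n)))"
      using small by blast
    have "mball a (inverse (real (Suc n))) \<subseteq> mball x r"
      using a xW[of "Suc n"] n by (intro mball_subset) (auto simp: subset_iff)
    then have "f ` W (Suc n) \<inter> V' = {}"
      using a(2) r(2) UV(5) by blast
    moreover have "y \<in> Y closure_of (f ` W (Suc n))"
      using W(1)[of "Suc n"] interior_of_subset unfolding J_def by fastforce
    ultimately show False
      using UV(3,4) unfolding in_closure_of by (metis disjoint_iff)
  qed
  ultimately show ?thesis
    unfolding J_def using meager_in_subset by blast
qed

section \<open>Topological groups and the open mapping theorem\<close>

locale top_group = fixes G :: "('a, 'b) monoid_scheme" (structure) and T :: "'a topology"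
  assumes topological_group: "topological_group G T"

sublocale top_group \<subseteq> group G
  using topological_group by (simp add: topological_group_def)

context top_group
begin

lemma topspace_eq [simp]: "topspace T = carrier G"
  using topological_group by (simp add: topological_group_def)

lemma openin_carrier: "openin T U \<Longrightarrow> x \<in> U \<Longrightarrow> x \<in> carrier G"
  using openin_subset by fastforce

lemma continuous_map_mult:
  assumes "continuous_map X T f" "continuous_map X T g" shows "continuous_map X T (\<lambda>x. f x \<otimes> g x)"
proof -
  have "continuous_map (prod_topology T T) T (\<lambda>(x, y). x \<otimes> y)"
    using topological_group by (simp add: topological_group_def)
  moreover have "continuous_map X (prod_topology T T) (\<lambda>x. (f x, g x))"
    using assms by (simp add: continuous_map_paired)
  ultimately have "continuous_map X T ((\<lambda>(x, y). x \<otimes> y) \<circ> (\<lambda>x. (f x, g x)))"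
    by (rule continuous_map_compose[rotated])
  then show ?thesis by (simp add: comp_def)
qed

lemma continuous_map_inv:
  assumes "continuous_map X T f" shows "continuous_map X T (\<lambda>x. inv (f x))"
proof -
  have "continuous_map T T (m_inv G)"
    using topological_group by (simp add: topological_group_def)
  from continuous_map_compose[OF assms this] show ?thesis by (simp add: comp_def)
qed

lemma homeomorphic_map_left:
  assumes g: "g \<in> carrier G" shows "homeomorphic_map T T (\<lambda>x. g \<otimes> x)"
proof -
  have "continuous_map T T (\<lambda>x. h \<otimes> x)" if "h \<in> carrier G" for h
    using that by (intro continuous_map_mult) auto
  then have "homeomorphic_maps T T (\<lambda>x. g \<otimes> x) (\<lambda>x. inv g \<otimes> x)"
    using g by (simp add: homeomorphic_maps_def m_assoc[symmetric])
  then show ?thesis by (rule homeomorphic_maps_imp_map)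
qed

lemma homeomorphic_map_conj:
  assumes g: "g \<in> carrier G" shows "homeomorphic_map T T (\<lambda>x. g \<otimes> x \<otimes> inv g)"
proof -
  have "continuous_map T T (\<lambda>x. h \<otimes> x \<otimes> inv h)" if "h \<in> carrier G" for h
    using that by (intro continuous_map_mult) auto
  from this[OF g] this[of "inv g"]
  have "homeomorphic_maps T T (\<lambda>x. g \<otimes> x \<otimes> inv g) (\<lambda>x. inv g \<otimes> x \<otimes> g)"
    using g by (simp add: homeomorphic_maps_def m_assoc) (simp add: m_assoc[symmetric])
  then show ?thesis by (rule homeomorphic_maps_imp_map)
qed

lemma openin_left_image: "g \<in> carrier G \<Longrightarrow> openin T U \<Longrightarrow> openin T ((\<lambda>x. g \<otimes> x) ` U)"
  using homeomorphic_map_openness_eq[OF homeomorphic_map_left] by blast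

lemma closure_of_left_image:
  "g \<in> carrier G \<Longrightarrow> A \<subseteq> carrier G \<Longrightarrow> T closure_of ((\<lambda>x. g \<otimes> x) ` A) = (\<lambda>x. g \<otimes> x) ` (T closure_of A)"
  by (simp add: homeomorphic_map_closure_of[OF homeomorphic_map_left])

lemma interior_of_left_image:
  "g \<in> carrier G \<Longrightarrow> A \<subseteq> carrier G \<Longrightarrow> T interior_of ((\<lambda>x. g \<otimes> x) ` A) = (\<lambda>x. g \<otimes> x) ` (T interior_of A)"
  by (simp add: homeomorphic_map_interior_of[OF homeomorphic_map_left])

lemma left_image_cancel:
  "g \<in> carrier G \<Longrightarrow> A \<subseteq> carrier G \<Longrightarrow> (\<lambda>x. g \<otimes> x) ` (\<lambda>x. inv g \<otimes> x) ` A = A"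
  "g \<in> carrier G \<Longrightarrow> A \<subseteq> carrier G \<Longrightarrow> (\<lambda>x. inv g \<otimes> x) ` (\<lambda>x. g \<otimes> x) ` A = A"
  by (auto simp: image_image m_assoc[symmetric] subset_iff image_iff)

lemma mult_nbhds:
  assumes "openin T U" "x \<in> carrier G" "y \<in> carrier G" "x \<otimes> y \<in> U"
  obtains V W where "openin T V" "openin T W" "x \<in> V" "y \<in> W" "\<And>a b. a \<in> V \<Longrightarrow> b \<in> W \<Longrightarrow> a \<otimes> b \<in> U"
proof -
  have "openin (prod_topology T T) {z \<in> topspace (prod_topology T T). (case z of (x, y) \<Rightarrow> x \<otimes> y) \<in> U}"
    using topological_group assms(1)
    by (intro openin_continuous_map_preimage) (auto simp: topological_group_def)
  moreover have "(x, y) \<in> {z \<in> topspace (prod_topology T T). (case z of (x, y) \<Rightarrow> x \<otimes> y) \<in> U}"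
    using assms by simp
  ultimately obtain V W where "openin T V" "openin T W" "x \<in> V" "y \<in> W"
      and sub: "V \<times> W \<subseteq> {z \<in> topspace (prod_topology T T). (case z of (x, y) \<Rightarrow> x \<otimes> y) \<in> U}"
    unfolding openin_prod_topology_alt by meson
  moreover have "a \<otimes> b \<in> U" if "a \<in> V" "b \<in> W" for a b
    using sub that by auto
  ultimately show thesis using that by meson
qed

lemma openin_inv_preimage:
  assumes "openin T U" shows "openin T {x \<in> carrier G. inv x \<in> U}"
  using openin_continuous_map_preimage[of T T "\<lambda>x. inv x" U] assms continuous_map_inv[of T "\<lambda>x. x"]
  by simp

lemma openin_one_nbhd:
  assumes "openin T U" "\<one> \<in> U"
  obtains V where "openin T V" "\<one> \<in> V" "V \<subseteq> U" "\<And>a b. a \<in> V \<Longrightarrow> b \<in> V \<Longrightarrow> a \<otimes> b \<in> U"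
    "\<And>a b. a \<in> V \<Longrightarrow> b \<in> V \<Longrightarrow> inv a \<otimes> b \<in> U" "\<And>a b. a \<in> V \<Longrightarrow> b \<in> V \<Longrightarrow> a \<otimes> inv b \<in> U"
proof -
  obtain A B where AB: "openin T A" "openin T B" "\<one> \<in> A" "\<one> \<in> B"
      "\<And>a b. a \<in> A \<Longrightarrow> b \<in> B \<Longrightarrow> a \<otimes> b \<in> U"
    using mult_nbhds[of U \<one> \<one>] assms by (metis one_closed r_one)
  define V where "V = U \<inter> ((A \<inter> B) \<inter> {x \<in> carrier G. inv x \<in> A \<inter> B})"
  have "openin T V"
    unfolding V_def using assms(1) AB(1,2) by (intro openin_Int openin_inv_preimage)
  then show ?thesis
    by (rule that) (use assms AB in \<open>auto simp: V_def\<close>)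
qed

text \<open>If x is in the closure of V, the neighbourhood x V of x meets V, so x is a quotient of
  two elements of V.\<close>

lemma closure_of_one_nbhd:
  assumes "openin T U" "\<one> \<in> U"
  obtains V where "openin T V" "\<one> \<in> V" "T closure_of V \<subseteq> U"
proof -
  obtain V where V: "openin T V" "\<one> \<in> V" "\<And>a b. a \<in> V \<Longrightarrow> b \<in> V \<Longrightarrow> a \<otimes> inv b \<in> U"
    using openin_one_nbhd[OF assms] by metis
  have "x \<in> U" if x: "x \<in> T closure_of V" for x
  proof -
    have xG: "x \<in> carrier G" using x by (simp add: in_closure_of)
    have "openin T ((\<lambda>y. x \<otimes> y) ` V)" "x \<in> (\<lambda>y. x \<otimes> y) ` V"
      using V(1,2) xG by (auto intro: openin_left_image simp: image_iff intro!: bexI[of _ \<one>])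
    then obtain v where v: "v \<in> V" "x \<otimes> v \<in> V"
      using x unfolding in_closure_of by blast
    then have "x = (x \<otimes> v) \<otimes> inv v"
      using xG V(1) openin_carrier by (metis inv_solve_right m_closed)
    then show ?thesis using V(3)[of "x \<otimes> v" v] v by simp
  qed
  with V(1,2) show ?thesis by (intro that) auto
qed

end

text \<open>Pettis' argument. Both U and x U contain x, so their intersection is a nonempty open set
  and by Baire is not covered by the two meager sets U - A and x (U - A). A remaining point y = x b
  has both y and b in A.\<close>

lemma residual_subset_divides:
  assumes "top_group G T" "completely_metrizable_space T"
    and U: "openin T U" "meager_in T (U - A)" and A: "A \<subseteq> carrier G" and x: "x \<in> U" "\<one>\<^bsub>G\<^esub> \<in> U"
  shows "\<exists>a\<in>A. \<exists>b\<in>A. x = a \<otimes>\<^bsub>G\<^esub> inv\<^bsub>G\<^esub> b"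
proof -
  interpret top_group G T by fact
  have xG: "x \<in> carrier G" using x U(1) openin_carrier by blast
  have UG: "U \<subseteq> carrier G" using U(1) openin_carrier by blast
  let ?x = "\<lambda>y. x \<otimes>\<^bsub>G\<^esub> y"
  have "meager_in T ((U - A) \<union> ?x ` (U - A))"
    using U(2) meager_in_homeomorphic_map[OF homeomorphic_map_left[OF xG]] by (intro meager_in_Un) auto
  moreover have "openin T (U \<inter> ?x ` U)" using U(1) xG by (intro openin_Int openin_left_image)
  moreover have "x \<in> U \<inter> ?x ` U" using x xG by (auto intro!: image_eqI[of _ _ "\<one>\<^bsub>G\<^esub>"])
  ultimately obtain y where y: "y \<in> U \<inter> ?x ` U" "y \<notin> (U - A) \<union> ?x ` (U - A)"
    using not_meager_in_openin[OF assms(2)] meager_in_subset by (metis empty_iff subsetI)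
  then obtain b where b: "b \<in> U" "y = x \<otimes>\<^bsub>G\<^esub> b" by blast
  with y have "b \<in> A" "y \<in> A" by auto
  moreover have "x = y \<otimes>\<^bsub>G\<^esub> inv\<^bsub>G\<^esub> b"
    using b xG UG by (metis inv_solve_right m_closed subsetD)
  ultimately show ?thesis by blast
qed

text \<open>Instead of continuity the homomorphism has a closed graph, expressed by separating
  neighbourhoods. This covers the identity between two Polish group topologies, whose continuity is
  the point to be proved in \<open>polish_group_topology_unique\<close>.\<close>

locale top_group_hom = H: top_group H X + G: top_group G Y
  for H :: "('a, 'b) monoid_scheme" and X and G :: "('c, 'd) monoid_scheme" and Y +
  fixes f
  assumes hom: "f \<in> hom H G"
    and complete_domain: "completely_metrizable_space X" and separable_domain: "second_countable X"
    and complete_range: "completely_metrizable_space Y"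
    and graph: "\<And>x y. x \<in> carrier H \<Longrightarrow> y \<in> carrier G \<Longrightarrow> f x \<noteq> y \<Longrightarrow>
      \<exists>U V. openin X U \<and> x \<in> U \<and> openin Y V \<and> y \<in> V \<and> f ` U \<inter> V = {}"

sublocale top_group_hom \<subseteq> group_hom H G f
  using hom by unfold_locales

context top_group_hom
begin

lemma image_left:
  "h \<in> carrier H \<Longrightarrow> A \<subseteq> carrier H \<Longrightarrow> f ` (\<lambda>x. h \<otimes>\<^bsub>H\<^esub> x) ` A = (\<lambda>x. f h \<otimes>\<^bsub>G\<^esub> x) ` f ` A"
  by (auto simp: image_image subset_iff intro!: image_cong)

lemma image_carrier: "A \<subseteq> carrier H \<Longrightarrow> f ` A \<subseteq> carrier G"
  by auto

text \<open>Translations spread the hypothesis from the identity to every point, so that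
  \<open>almost_open_residual_image\<close> applies. The image of a smaller V' is then residual in
  the interior of its closure, and quotients of elements of V' fill this interior while staying in
  V.\<close>

theorem open_mapping_almost_open:
  assumes almost: "\<And>V. openin X V \<Longrightarrow> \<one>\<^bsub>H\<^esub> \<in> V \<Longrightarrow> \<one>\<^bsub>G\<^esub> \<in> Y interior_of (Y closure_of (f ` V))"
    and V: "openin X V" "\<one>\<^bsub>H\<^esub> \<in> V"
  shows "\<exists>U. openin Y U \<and> \<one>\<^bsub>G\<^esub> \<in> U \<and> U \<subseteq> f ` V"
proof -
  have almost': "f ` W \<subseteq> Y interior_of (Y closure_of (f ` W))" if W: "openin X W" for W
  proof (rule image_subsetI)
    fix w assume w: "w \<in> W"
    have WH: "W \<subseteq> carrier H" and wH: "w \<in> carrier H" using W w H.openin_carrier by auto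
    let ?W = "(\<lambda>x. inv\<^bsub>H\<^esub> w \<otimes>\<^bsub>H\<^esub> x) ` W"
    let ?t = "\<lambda>x. inv\<^bsub>G\<^esub> (f w) \<otimes>\<^bsub>G\<^esub> x"
    have "\<one>\<^bsub>H\<^esub> \<in> ?W" using w wH by (auto intro!: image_eqI[of _ _ w])
    moreover have "openin X ?W" using W wH by (simp add: H.openin_left_image)
    ultimately have "\<one>\<^bsub>G\<^esub> \<in> Y interior_of (Y closure_of (f ` ?W))"
      using almost by blast
    also have "f ` ?W = ?t ` f ` W"
      using image_left[of "inv\<^bsub>H\<^esub> w" W] wH WH by simp
    also have "Y interior_of (Y closure_of (?t ` f ` W)) = ?t ` (Y interior_of (Y closure_of (f ` W)))"
      using wH image_carrier[OF WH] closure_of_subset_topspace[of Y]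
      by (simp add: G.closure_of_left_image G.interior_of_left_image)
    finally obtain z where z: "z \<in> Y interior_of (Y closure_of (f ` W))" "\<one>\<^bsub>G\<^esub> = inv\<^bsub>G\<^esub> (f w) \<otimes>\<^bsub>G\<^esub> z"
      by blast
    have "z \<in> carrier G" using z(1) interior_of_subset_topspace by fastforce
    then have "z = f w" using z(2) wH by (metis G.inv_solve_left G.one_closed G.r_one hom_closed)
    with z(1) show "f w \<in> Y interior_of (Y closure_of (f ` W))" by simp
  qed
  obtain V' where V': "openin X V'" "\<one>\<^bsub>H\<^esub> \<in> V'" "\<And>a b. a \<in> V' \<Longrightarrow> b \<in> V' \<Longrightarrow> a \<otimes>\<^bsub>H\<^esub> inv\<^bsub>H\<^esub> b \<in> V"
    using H.openin_one_nbhd[OF V] by metis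
  let ?U = "Y interior_of (Y closure_of (f ` V'))"
  have V'H: "V' \<subseteq> carrier H" using V'(1) H.openin_carrier by blast
  have meager: "meager_in Y (?U - f ` V')"
    using complete_domain separable_domain graph almost' V'(1) by (intro almost_open_residual_image) auto
  have one: "\<one>\<^bsub>G\<^esub> \<in> ?U" using almost V' by blast
  have "?U \<subseteq> f ` V"
  proof
    fix y assume "y \<in> ?U"
    then obtain a b where ab: "a \<in> V'" "b \<in> V'" "y = f a \<otimes>\<^bsub>G\<^esub> inv\<^bsub>G\<^esub> (f b)"
      using residual_subset_divides[OF G.top_group_axioms complete_range _ meager image_carrier[OF V'H], of y] one
      by (auto simp: openin_interior_of)
    then have "y = f (a \<otimes>\<^bsub>H\<^esub> inv\<^bsub>H\<^esub> b)" using V'H by (simp add: subset_iff)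
    with ab V'(3) show "y \<in> f ` V" by blast
  qed
  with one show ?thesis by (intro exI[of _ ?U]) auto
qed

theorem open_mapping_surj:
  assumes surj: "f ` carrier H = carrier G" and V: "openin X V" "\<one>\<^bsub>H\<^esub> \<in> V"
  shows "\<exists>U. openin Y U \<and> \<one>\<^bsub>G\<^esub> \<in> U \<and> U \<subseteq> f ` V"
proof (rule open_mapping_almost_open[OF _ V])
  fix V assume V: "openin X V" "\<one>\<^bsub>H\<^esub> \<in> V"
  obtain V' where V': "openin X V'" "\<one>\<^bsub>H\<^esub> \<in> V'" "\<And>a b. a \<in> V' \<Longrightarrow> b \<in> V' \<Longrightarrow> inv\<^bsub>H\<^esub> a \<otimes>\<^bsub>H\<^esub> b \<in> V"
    using H.openin_one_nbhd[OF V] by metis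
  have V'H: "V' \<subseteq> carrier H" using V'(1) H.openin_carrier by blast
  obtain D where D: "countable D" "D \<subseteq> carrier H" "X closure_of D = carrier H"
    using second_countable_imp_separable_space[OF separable_domain] by (auto simp: separable_space_def)
  define F where "F d = Y closure_of ((\<lambda>x. f d \<otimes>\<^bsub>G\<^esub> x) ` f ` V')" for d
  have cover: "carrier G \<subseteq> (\<Union>d\<in>D. F d)"
  proof
    fix y assume "y \<in> carrier G"
    then obtain x where x: "x \<in> carrier H" "y = f x" using surj by blast
    have "openin X {d \<in> carrier H. inv\<^bsub>H\<^esub> d \<otimes>\<^bsub>H\<^esub> x \<in> V'}"
      using openin_continuous_map_preimage[of X X "\<lambda>d. inv\<^bsub>H\<^esub> d \<otimes>\<^bsub>H\<^esub> x" V'] V'(1) x(1)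
        H.continuous_map_mult[OF H.continuous_map_inv, of X "\<lambda>d. d" "\<lambda>_. x"] by simp
    moreover have "x \<in> X closure_of D" using D(3) x(1) by simp
    moreover have "x \<in> {d \<in> carrier H. inv\<^bsub>H\<^esub> d \<otimes>\<^bsub>H\<^esub> x \<in> V'}"
      using V'(2) x(1) by simp
    ultimately obtain d where d: "d \<in> D" "inv\<^bsub>H\<^esub> d \<otimes>\<^bsub>H\<^esub> x \<in> V'"
      unfolding in_closure_of by (metis (mono_tags, lifting) mem_Collect_eq)
    then have "y = f d \<otimes>\<^bsub>G\<^esub> f (inv\<^bsub>H\<^esub> d \<otimes>\<^bsub>H\<^esub> x)"
      using D(2) x by (simp add: subset_iff G.m_assoc[symmetric])
    then have "y \<in> (\<lambda>x. f d \<otimes>\<^bsub>G\<^esub> x) ` f ` V'" using d by blast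
    moreover have "(\<lambda>x. f d \<otimes>\<^bsub>G\<^esub> x) ` f ` V' \<subseteq> F d"
      unfolding F_def using V'H d(1) D(2) by (intro closure_of_subset) (auto simp: subset_iff)
    ultimately show "y \<in> (\<Union>d\<in>D. F d)" using d(1) by blast
  qed
  have "\<exists>d\<in>D. Y interior_of (F d) \<noteq> {}"
  proof (rule ccontr)
    assume "\<not> ?thesis"
    then have "meager_in Y (\<Union>d\<in>D. F d)"
      using D(1) by (intro meager_in_UN meager_in_closed) (auto simp: F_def)
    then have "meager_in Y (carrier G)" using cover by (rule meager_in_subset)
    then show False
      using not_meager_in_openin[OF complete_range, of "carrier G"] G.one_closed G.topspace_eq
      by (metis empty_iff openin_topspace)
  qed
  then obtain d where d: "d \<in> D" "Y interior_of (F d) \<noteq> {}" by blast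
  have fV': "f ` V' \<subseteq> carrier G" "Y closure_of (f ` V') \<subseteq> carrier G"
    using image_carrier[OF V'H] closure_of_subset_topspace[of Y] by auto
  let ?I = "Y interior_of (Y closure_of (f ` V'))"
  have "?I \<noteq> {}"
    using d D(2) fV' by (auto simp: F_def G.closure_of_left_image G.interior_of_left_image subset_iff)
  then obtain y where y: "y \<in> ?I" by blast
  then have "y \<in> Y closure_of (f ` V')" using interior_of_subset by fastforce
  then obtain v where v: "v \<in> V'" "f v \<in> ?I"
    using y unfolding in_closure_of by (metis imageE openin_interior_of)
  have vH: "v \<in> carrier H" using v V'H by blast
  let ?t = "\<lambda>x. inv\<^bsub>G\<^esub> (f v) \<otimes>\<^bsub>G\<^esub> x"
  have "\<one>\<^bsub>G\<^esub> \<in> ?t ` ?I" using v vH by (auto intro!: image_eqI[of _ _ "f v"])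
  also have "?t ` ?I = Y interior_of (Y closure_of (?t ` f ` V'))"
    using vH fV' by (simp add: G.closure_of_left_image G.interior_of_left_image)
  also have "\<dots> \<subseteq> Y interior_of (Y closure_of (f ` V))"
  proof (intro interior_of_mono closure_of_mono)
    have "?t ` f ` V' = f ` (\<lambda>x. inv\<^bsub>H\<^esub> v \<otimes>\<^bsub>H\<^esub> x) ` V'"
      using image_left[of "inv\<^bsub>H\<^esub> v" V'] vH V'H by simp
    also have "\<dots> \<subseteq> f ` V" using V'(3) v by blast
    finally show "?t ` f ` V' \<subseteq> f ` V" .
  qed
  finally show "\<one>\<^bsub>G\<^esub> \<in> Y interior_of (Y closure_of (f ` V))" .
qed

end

text \<open>
  Two Polish group topologies on \<open>H\<close> refining a common Hausdorff topology: the identity between them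
  has closed graph, hence is open in both directions.
\<close>

lemma polish_group_topology_unique:
  assumes "polish_group H S" "polish_group H S'" "Hausdorff_space T"
    and "continuous_map S T (\<lambda>x. x)" "continuous_map S' T (\<lambda>x. x)"
  shows "S = S'"
proof -
  have *: "openin S' V" if S: "polish_group H S" and S': "polish_group H S'"
    and c: "continuous_map S T (\<lambda>x. x)" and c': "continuous_map S' T (\<lambda>x. x)" and V: "openin S V"
    for S S' V
  proof -
    interpret S: top_group H S using S by unfold_locales (simp add: polish_group_def)
    interpret S': top_group H S' using S' by unfold_locales (simp add: polish_group_def)
    have hom: "top_group_hom H S H S' (\<lambda>x. x)"
    proof unfold_locales
      show "completely_metrizable_space S" "completely_metrizable_space S'"
        using S S' by (auto simp: polish_group_def polish_space_topology_def)
      then show "second_countable S"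
        using S by (auto simp: polish_group_def polish_space_topology_def
            intro: separable_metrizable_imp_second_countable completely_metrizable_imp_metrizable_space)
      show "(\<lambda>x. x) \<in> hom H H" by (simp add: hom_def)
      fix x y assume xy: "x \<in> carrier H" "y \<in> carrier H" "x \<noteq> y"
      then obtain A B where AB: "openin T A" "openin T B" "x \<in> A" "y \<in> B" "A \<inter> B = {}"
        using assms(3)[unfolded Hausdorff_space_def, rule_format, of x y]
          continuous_map_image_subset_topspace[OF c] unfolding disjnt_def by auto
      have open_AB: "openin S {z \<in> carrier H. z \<in> A}" "openin S' {z \<in> carrier H. z \<in> B}"
        using openin_continuous_map_preimage[OF c AB(1)] openin_continuous_map_preimage[OF c' AB(2)] by auto
      then show "\<exists>U V. openin S U \<and> x \<in> U \<and> openin S' V \<and> y \<in> V \<and> (\<lambda>x. x) ` U \<inter> V = {}"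
      proof (intro exI conjI)
        show "openin S {z \<in> carrier H. z \<in> A}" "openin S' {z \<in> carrier H. z \<in> B}"
          by (fact open_AB)+
      qed (use AB xy in auto)
    qed
    show ?thesis
    proof (subst openin_subopen, intro ballI)
      fix x assume x: "x \<in> V"
      have xH: "x \<in> carrier H" and VH: "V \<subseteq> carrier H" using x V S.openin_carrier by auto
      let ?V = "(\<lambda>y. inv\<^bsub>H\<^esub> x \<otimes>\<^bsub>H\<^esub> y) ` V"
      have "openin S ?V" using V xH by (simp add: S.openin_left_image)
      moreover have "\<one>\<^bsub>H\<^esub> \<in> ?V" by (rule image_eqI[of _ _ x]) (use xH x in simp_all)
      ultimately
      obtain U where U: "openin S' U" "\<one>\<^bsub>H\<^esub> \<in> U" "U \<subseteq> ?V"
        using top_group_hom.open_mapping_surj[OF hom, of ?V] by auto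
      have "(\<lambda>y. x \<otimes>\<^bsub>H\<^esub> y) ` U \<subseteq> (\<lambda>y. x \<otimes>\<^bsub>H\<^esub> y) ` ?V" using U(3) by blast
      also have "\<dots> = V" using xH VH by (rule S.left_image_cancel)
      finally have "(\<lambda>y. x \<otimes>\<^bsub>H\<^esub> y) ` U \<subseteq> V" .
      moreover have "openin S' ((\<lambda>y. x \<otimes>\<^bsub>H\<^esub> y) ` U)"
        using U(1) xH by (rule S'.openin_left_image[rotated])
      moreover have "x \<in> (\<lambda>y. x \<otimes>\<^bsub>H\<^esub> y) ` U"
        by (rule image_eqI[OF _ U(2)]) (use xH in simp)
      ultimately show "\<exists>W. openin S' W \<and> x \<in> W \<and> W \<subseteq> V" by blast
    qed
  qed
  show ?thesis
    using *[of S S'] *[of S' S] assms by (auto simp: topology_eq)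
qed

section \<open>The phantom subgroups\<close>

lemma continuous_map_nbhdsI:
  assumes "\<And>x. x \<in> topspace X \<Longrightarrow> f x \<in> topspace Y"
    and "\<And>x U. x \<in> topspace X \<Longrightarrow> openin Y U \<Longrightarrow> f x \<in> U \<Longrightarrow>
      \<exists>V. openin X V \<and> x \<in> V \<and> (\<forall>v\<in>V. f v \<in> U)"
  shows "continuous_map X Y f"
  unfolding continuous_map_def
proof (intro conjI allI impI)
  show "f \<in> topspace X \<rightarrow> topspace Y" using assms(1) by blast
  fix U assume U: "openin Y U"
  show "openin X {x \<in> topspace X. f x \<in> U}"
  proof (subst openin_subopen, intro ballI)
    fix x assume "x \<in> {x \<in> topspace X. f x \<in> U}"
    then obtain V where V: "openin X V" "x \<in> V" "\<forall>v\<in>V. f v \<in> U"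
      using assms(2)[OF _ U] by blast
    then show "\<exists>V. openin X V \<and> x \<in> V \<and> V \<subseteq> {x \<in> topspace X. f x \<in> U}"
      using openin_subset by (intro exI[of _ V]) blast
  qed
qed

lemma continuous_map_prod_nbhdsI:
  assumes "\<And>x y. x \<in> topspace X \<Longrightarrow> y \<in> topspace Y \<Longrightarrow> f x y \<in> topspace Z"
    and "\<And>x y U. x \<in> topspace X \<Longrightarrow> y \<in> topspace Y \<Longrightarrow> openin Z U \<Longrightarrow> f x y \<in> U \<Longrightarrow>
      \<exists>V W. openin X V \<and> openin Y W \<and> x \<in> V \<and> y \<in> W \<and> (\<forall>v\<in>V. \<forall>w\<in>W. f v w \<in> U)"
  shows "continuous_map (prod_topology X Y) Z (\<lambda>(x, y). f x y)"
proof (rule continuous_map_nbhdsI)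
  fix z U assume z: "z \<in> topspace (prod_topology X Y)" and U: "openin Z U" "(case z of (x, y) \<Rightarrow> f x y) \<in> U"
  obtain x y where [simp]: "z = (x, y)" by (cases z)
  obtain V W where VW: "openin X V" "openin Y W" "x \<in> V" "y \<in> W" "\<forall>v\<in>V. \<forall>w\<in>W. f v w \<in> U"
    using assms(2)[of x y U] z U by auto
  then show "\<exists>V. openin (prod_topology X Y) V \<and> z \<in> V \<and> (\<forall>v\<in>V. (case v of (x, y) \<Rightarrow> f x y) \<in> U)"
    by (intro exI[of _ "V \<times> W"]) (auto simp: openin_prod_Times_iff)
qed (use assms(1) in auto)

text \<open>The map p may have a kernel, which consists of central elements in both applications.
  \<open>conj_invariant\<close> makes the image of every ball around the identity invariant under
  all of G; this keeps the closures of these images normal enough to define group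
  topologies.\<close>

locale polish_cover = top_group G T for G :: "('a, 'b) monoid_scheme" (structure) and T +
  fixes K :: "('k :: complete_space, 'c) monoid_scheme" and p :: "'k \<Rightarrow> 'a"
  assumes complete_T: "completely_metrizable_space T"
    and group_K: "group K"
    and closed_K: "closed (carrier K)"
    and separable_K: "separable_space (top_of_set (carrier K))"
    and dist_left: "k \<in> carrier K \<Longrightarrow> x \<in> carrier K \<Longrightarrow> y \<in> carrier K \<Longrightarrow>
      dist (k \<otimes>\<^bsub>K\<^esub> x) (k \<otimes>\<^bsub>K\<^esub> y) = dist x y"
    and dist_right: "k \<in> carrier K \<Longrightarrow> x \<in> carrier K \<Longrightarrow> y \<in> carrier K \<Longrightarrow>
      dist (x \<otimes>\<^bsub>K\<^esub> k) (y \<otimes>\<^bsub>K\<^esub> k) = dist x y"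
    and p_hom: "p \<in> hom K G"
    and p_continuous: "continuous_map (top_of_set (carrier K)) T p"
    and conj_invariant: "g \<in> carrier G \<Longrightarrow> k \<in> carrier K \<Longrightarrow>
      \<exists>k'\<in>carrier K. dist \<one>\<^bsub>K\<^esub> k' \<le> dist \<one>\<^bsub>K\<^esub> k \<and> p k' = g \<otimes> p k \<otimes> inv g"

sublocale polish_cover \<subseteq> K: group K by (rule group_K)
sublocale polish_cover \<subseteq> p: group_hom K G p using p_hom by unfold_locales

section \<open>The transfinite construction of the stages\<close>

context polish_cover
begin

definition N :: "'a set" where "N = p ` carrier K"

definition P :: "real \<Rightarrow> 'a set" where "P r = p ` {k \<in> carrier K. dist \<one>\<^bsub>K\<^esub> k < r}"

text \<open>
  The recursion produces the sets \<open>core b r\<close>; from those with \<open>b < a\<close> one reads off the group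
  \<open>S a\<close> and its topology \<open>tau a\<close>, and \<open>core a r\<close> is the \<open>tau a\<close>-closure of \<open>P r\<close>.  An index
  \<open>(V, r, F)\<close> at \<open>x\<close> stands for the neighbourhood of \<open>x\<close> cut out by the open set \<open>V\<close> and by the
  translates of \<open>core b r\<close> for the finitely many \<open>b \<in> F\<close>.
\<close>

definition stage_carrier :: "(countable_ordinal \<Rightarrow> real \<Rightarrow> 'a set) \<Rightarrow> countable_ordinal \<Rightarrow> 'a set" where
  "stage_carrier c a = {x \<in> T closure_of N. \<forall>b<a. \<forall>r>0. \<exists>n\<in>N. inv n \<otimes> x \<in> c b r}"

definition stage_nbhd :: "(countable_ordinal \<Rightarrow> real \<Rightarrow> 'a set) \<Rightarrow> countable_ordinal \<Rightarrow> 'a \<Rightarrow>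
    'a set \<times> real \<times> countable_ordinal set \<Rightarrow> 'a set" where
  "stage_nbhd c a x = (\<lambda>(V, r, F). {y \<in> stage_carrier c a. y \<in> V \<and> (\<forall>b\<in>F. inv x \<otimes> y \<in> c b r)})"

definition index :: "countable_ordinal \<Rightarrow> 'a \<Rightarrow> ('a set \<times> real \<times> countable_ordinal set) set" where
  "index a x = {(V, r, F). openin T V \<and> x \<in> V \<and> 0 < r \<and> finite F \<and> F \<subseteq> {..<a}}"

definition stage_topology :: "(countable_ordinal \<Rightarrow> real \<Rightarrow> 'a set) \<Rightarrow> countable_ordinal \<Rightarrow> 'a topology" where
  "stage_topology c a = topology (\<lambda>U. U \<subseteq> stage_carrier c a \<and>
     (\<forall>x\<in>U. \<exists>i\<in>index a x. stage_nbhd c a x i \<subseteq> U))"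

function core :: "countable_ordinal \<Rightarrow> real \<Rightarrow> 'a set" where
  "core a = (\<lambda>r. stage_topology (\<lambda>b. if b < a then core b else (\<lambda>_. {})) a closure_of P r)"
  by pat_completeness auto
termination
  by (relation "{(x, y). x < y}") (auto intro: wf)

declare core.simps [simp del]

definition S :: "countable_ordinal \<Rightarrow> 'a set" where "S = stage_carrier core"
definition tau :: "countable_ordinal \<Rightarrow> 'a topology" where "tau = stage_topology core"
definition nb where "nb = stage_nbhd core"

lemma S_iff: "x \<in> S a \<longleftrightarrow> x \<in> T closure_of N \<and> (\<forall>b<a. \<forall>r>0. \<exists>n\<in>N. inv n \<otimes> x \<in> core b r)"
  by (simp add: S_def stage_carrier_def)

lemma nb_iff: "y \<in> nb a x (V, r, F) \<longleftrightarrow> y \<in> S a \<and> y \<in> V \<and> (\<forall>b\<in>F. inv x \<otimes> y \<in> core b r)"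
  by (simp add: nb_def stage_nbhd_def S_def)

lemma index_iff: "(V, r, F) \<in> index a x \<longleftrightarrow> openin T V \<and> x \<in> V \<and> 0 < r \<and> finite F \<and> F \<subseteq> {..<a}"
  by (simp add: index_def)

lemma core_eq: "core a r = tau a closure_of P r"
proof -
  let ?c = "\<lambda>b. if b < a then core b else (\<lambda>_. {})"
  have 1: "stage_carrier ?c a = stage_carrier core a"
    by (simp add: stage_carrier_def)
  have "stage_nbhd ?c a x i = stage_nbhd core a x i" if "i \<in> index a x" for x i
    using that unfolding stage_nbhd_def 1 by (cases i) (auto simp: index_iff subset_iff split: if_splits)
  then have "stage_topology ?c a = stage_topology core a"
    unfolding stage_topology_def 1 by (intro arg_cong[of _ _ topology] ext) (metis (no_types, lifting))
  then show ?thesis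
    by (simp add: core.simps[of a] tau_def)
qed

lemma P_mono: "r \<le> s \<Longrightarrow> P r \<subseteq> P s"
  by (auto simp: P_def)

lemma P_subset_N: "P r \<subseteq> N"
  by (auto simp: P_def N_def)

lemma N_carrier: "N \<subseteq> carrier G"
  by (auto simp: N_def)

lemma one_P: "0 < r \<Longrightarrow> \<one> \<in> P r"
  unfolding P_def by (rule image_eqI[of _ _ "\<one>\<^bsub>K\<^esub>"]) auto

lemma P_mult: "x \<in> P r \<Longrightarrow> y \<in> P s \<Longrightarrow> x \<otimes> y \<in> P (r + s)"
proof -
  assume "x \<in> P r" "y \<in> P s"
  then obtain k h where kh: "k \<in> carrier K" "h \<in> carrier K" "x = p k" "y = p h"
      "dist \<one>\<^bsub>K\<^esub> k < r" "dist \<one>\<^bsub>K\<^esub> h < s"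
    unfolding P_def by auto
  have "dist \<one>\<^bsub>K\<^esub> (k \<otimes>\<^bsub>K\<^esub> h) \<le> dist \<one>\<^bsub>K\<^esub> k + dist k (k \<otimes>\<^bsub>K\<^esub> h)"
    by (rule dist_triangle)
  also have "dist k (k \<otimes>\<^bsub>K\<^esub> h) = dist \<one>\<^bsub>K\<^esub> h"
    using dist_left[of k "\<one>\<^bsub>K\<^esub>" h] kh by simp
  finally show ?thesis
    unfolding P_def using kh by (intro image_eqI[of _ _ "k \<otimes>\<^bsub>K\<^esub> h"]) auto
qed

lemma P_inv: "x \<in> P r \<Longrightarrow> inv x \<in> P r"
proof -
  assume "x \<in> P r"
  then obtain k where k: "k \<in> carrier K" "x = p k" "dist \<one>\<^bsub>K\<^esub> k < r"
    unfolding P_def by auto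
  have "dist \<one>\<^bsub>K\<^esub> (inv\<^bsub>K\<^esub> k) = dist k \<one>\<^bsub>K\<^esub>"
    using dist_left[of k "\<one>\<^bsub>K\<^esub>" "inv\<^bsub>K\<^esub> k"] k by simp
  then show ?thesis
    unfolding P_def using k by (intro image_eqI[of _ _ "inv\<^bsub>K\<^esub> k"]) (auto simp: dist_commute)
qed

lemma P_conj: "x \<in> P r \<Longrightarrow> g \<in> carrier G \<Longrightarrow> g \<otimes> x \<otimes> inv g \<in> P r"
proof -
  assume "x \<in> P r" and g: "g \<in> carrier G"
  then obtain k where k: "k \<in> carrier K" "x = p k" "dist \<one>\<^bsub>K\<^esub> k < r"
    unfolding P_def by auto
  from conj_invariant[OF g k(1)] obtain k' where
    "k' \<in> carrier K" "dist \<one>\<^bsub>K\<^esub> k' \<le> dist \<one>\<^bsub>K\<^esub> k" "p k' = g \<otimes> p k \<otimes> inv g" by blast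
  with k show ?thesis
    unfolding P_def by (intro image_eqI[of _ _ k']) auto
qed

lemma subgroup_N: "subgroup N G"
  unfolding N_def using p.subgroup_img_is_subgroup[OF K.subgroup_self] .

lemma N_mult: "x \<in> N \<Longrightarrow> y \<in> N \<Longrightarrow> x \<otimes> y \<in> N"
  and N_inv: "x \<in> N \<Longrightarrow> inv x \<in> N" and one_N: "\<one> \<in> N"
  using subgroup_N by (auto simp: subgroup.m_closed subgroup.m_inv_closed subgroup.one_closed)

lemma core_mono: "r \<le> s \<Longrightarrow> core a r \<subseteq> core a s"
  unfolding core_eq by (intro closure_of_mono P_mono)

lemma S_carrier: "S a \<subseteq> carrier G"
  using closure_of_subset_topspace[of T N] by (auto simp: S_iff)

lemma index_Int:
  assumes "i \<in> index a x" "j \<in> index a x"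
  shows "\<exists>k\<in>index a x. nb a x k \<subseteq> nb a x i \<inter> nb a x j"
proof -
  obtain V r F where i: "i = (V, r, F)" by (cases i)
  obtain W s H where j: "j = (W, s, H)" by (cases j)
  have "(V \<inter> W, min r s, F \<union> H) \<in> index a x"
    using assms by (auto simp: i j index_iff)
  moreover have "nb a x (V \<inter> W, min r s, F \<union> H) \<subseteq> nb a x i \<inter> nb a x j"
    using core_mono[of "min r s" r] core_mono[of "min r s" s] by (auto simp: i j nb_iff subset_iff)
  ultimately show ?thesis by blast
qed

text \<open>This needs only that indices at a point can be intersected. That each
  \<open>nb a x i\<close> contains an open set around x uses the group structure of the earlier
  stages and comes in \<open>nb_openin\<close>.\<close>

lemma openin_tau: "openin (tau a) U \<longleftrightarrow> U \<subseteq> S a \<and> (\<forall>x\<in>U. \<exists>i\<in>index a x. nb a x i \<subseteq> U)"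
proof -
  let ?L = "\<lambda>U. U \<subseteq> S a \<and> (\<forall>x\<in>U. \<exists>i\<in>index a x. nb a x i \<subseteq> U)"
  have "istopology ?L"
    unfolding istopology_def
  proof (intro conjI allI impI)
    fix U V assume UV: "?L U" "?L V"
    show "U \<inter> V \<subseteq> S a" using UV by blast
    show "\<forall>x\<in>U \<inter> V. \<exists>i\<in>index a x. nb a x i \<subseteq> U \<inter> V"
    proof
      fix x assume x: "x \<in> U \<inter> V"
      then obtain i j where "i \<in> index a x" "nb a x i \<subseteq> U" "j \<in> index a x" "nb a x j \<subseteq> V"
        using UV by blast
      with index_Int[of i a x j] show "\<exists>i\<in>index a x. nb a x i \<subseteq> U \<inter> V" by blast
    qed
  next
    fix \<K> assume \<K>: "\<forall>K\<in>\<K>. ?L K"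
    show "\<Union>\<K> \<subseteq> S a" using \<K> by blast
    show "\<forall>x\<in>\<Union>\<K>. \<exists>i\<in>index a x. nb a x i \<subseteq> \<Union>\<K>"
    proof
      fix x assume "x \<in> \<Union>\<K>"
      then obtain K where K: "K \<in> \<K>" "x \<in> K" by blast
      with \<K> obtain i where "i \<in> index a x" "nb a x i \<subseteq> K" by blast
      with K show "\<exists>i\<in>index a x. nb a x i \<subseteq> \<Union>\<K>" by blast
    qed
  qed
  then have "openin (topology ?L) = ?L" by (rule topology_inverse')
  then show ?thesis
    unfolding tau_def stage_topology_def S_def nb_def by simp
qed

lemma topspace_tau [simp]: "topspace (tau a) = S a"
proof
  show "topspace (tau a) \<subseteq> S a" using openin_topspace[of "tau a"] openin_tau by blast
  have "(carrier G, 1, {}) \<in> index a x" if "x \<in> S a" for x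
    using that S_carrier openin_topspace[of T] by (auto simp: index_iff)
  moreover have "nb a x i \<subseteq> S a" for x i by (cases i) (auto simp: nb_iff)
  ultimately have "openin (tau a) (S a)" unfolding openin_tau by blast
  then show "S a \<subseteq> topspace (tau a)" by (rule openin_subset)
qed

lemma S_antimono: "b \<le> a \<Longrightarrow> S a \<subseteq> S b"
  by (auto simp: S_iff)

lemma continuous_map_tau_T: "continuous_map (tau a) T (\<lambda>x. x)"
proof (rule continuous_map_nbhdsI)
  fix x U assume x: "x \<in> topspace (tau a)" and U: "openin T U" "x \<in> U"
  have "openin (tau a) (S a \<inter> U)"
    unfolding openin_tau
  proof (intro conjI ballI)
    fix y assume "y \<in> S a \<inter> U"
    then show "\<exists>i\<in>index a y. nb a y i \<subseteq> S a \<inter> U"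
      using U by (intro bexI[of _ "(U, 1, {})"]) (auto simp: nb_iff index_iff)
  qed blast
  then show "\<exists>V. openin (tau a) V \<and> x \<in> V \<and> (\<forall>v\<in>V. v \<in> U)"
    using x U by (intro exI[of _ "S a \<inter> U"]) auto
qed (use S_carrier in auto)

lemma continuous_map_tau_tau: "b \<le> a \<Longrightarrow> continuous_map (tau a) (tau b) (\<lambda>x. x)"
proof (rule continuous_map_nbhdsI)
  assume ba: "b \<le> a"
  fix x U assume x: "x \<in> topspace (tau a)" and U: "openin (tau b) U" "x \<in> U"
  have "openin (tau a) (S a \<inter> U)"
    unfolding openin_tau
  proof (intro conjI ballI)
    fix y assume y: "y \<in> S a \<inter> U"
    with U obtain i where i: "i \<in> index b y" "nb b y i \<subseteq> U" unfolding openin_tau by blast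
    obtain V r F where [simp]: "i = (V, r, F)" by (cases i)
    have "i \<in> index a y" using i(1) ba by (auto simp: index_iff)
    moreover have "nb a y i \<subseteq> S a \<inter> nb b y i" using S_antimono[OF ba] by (auto simp: nb_iff)
    ultimately show "\<exists>i\<in>index a y. nb a y i \<subseteq> S a \<inter> U" using i(2) by blast
  qed blast
  then show "\<exists>V. openin (tau a) V \<and> x \<in> V \<and> (\<forall>v\<in>V. v \<in> U)"
    using x U by (intro exI[of _ "S a \<inter> U"]) auto
qed (use S_antimono in auto)

lemma core_subset_S: "core a r \<subseteq> S a"
  unfolding core_eq using closure_of_subset_topspace[of "tau a"] by simp

lemma core_carrier: "core a r \<subseteq> carrier G"
  using core_subset_S S_carrier by blast

lemma core_antimono: "b \<le> a \<Longrightarrow> core a r \<subseteq> core b r"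
  using continuous_map_image_closure_subset[OF continuous_map_tau_tau, of b a "P r"]
  unfolding core_eq by simp

lemma core_subset_closure: "core a r \<subseteq> T closure_of P r"
  using continuous_map_image_closure_subset[OF continuous_map_tau_T, of a "P r"]
  unfolding core_eq by simp

lemma P_small:
  assumes "openin T V" "\<one> \<in> V" obtains r where "0 < r" "P r \<subseteq> V"
proof -
  have "openin (top_of_set (carrier K)) {k \<in> carrier K. p k \<in> V}"
    using openin_continuous_map_preimage[OF p_continuous assms(1)] by simp
  moreover have "\<one>\<^bsub>K\<^esub> \<in> {k \<in> carrier K. p k \<in> V}" using assms(2) by simp
  ultimately obtain r where "0 < r" "\<forall>k\<in>carrier K. dist k \<one>\<^bsub>K\<^esub> < r \<longrightarrow> k \<in> {k \<in> carrier K. p k \<in> V}"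
    unfolding openin_euclidean_subtopology_iff by meson
  then show ?thesis by (intro that[of r]) (auto simp: P_def dist_commute)
qed

text \<open>The radius works for all stages at once, because every \<open>core a r\<close> lies in
  the T-closure of \<open>P r\<close>. This lets the T-open component of an index be absorbed into a
  core.\<close>

lemma core_small:
  assumes "openin T V" "\<one> \<in> V" obtains r where "0 < r" "\<And>a. core a r \<subseteq> V"
proof -
  obtain W where W: "openin T W" "\<one> \<in> W" "T closure_of W \<subseteq> V"
    using closure_of_one_nbhd[OF assms] by blast
  obtain r where r: "0 < r" "P r \<subseteq> W" using P_small[OF W(1,2)] by blast
  have "core a r \<subseteq> V" for a
    using core_subset_closure[of a r] closure_of_mono[OF r(2), of T] W(3) by blast
  with r(1) show ?thesis by (rule that)
qed

section \<open>Every stage is a topological group with N dense\<close>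

lemma closure_N_mult: "x \<in> T closure_of N \<Longrightarrow> y \<in> T closure_of N \<Longrightarrow> x \<otimes> y \<in> T closure_of N"
proof -
  assume x: "x \<in> T closure_of N" and y: "y \<in> T closure_of N"
  have xy: "x \<in> carrier G" "y \<in> carrier G" using x y by (auto simp: in_closure_of)
  show ?thesis
    unfolding in_closure_of
  proof (intro conjI allI impI)
    fix U assume U: "x \<otimes> y \<in> U \<and> openin T U"
    obtain V W where VW: "openin T V" "openin T W" "x \<in> V" "y \<in> W" "\<And>a b. a \<in> V \<Longrightarrow> b \<in> W \<Longrightarrow> a \<otimes> b \<in> U"
      using mult_nbhds[of U x y] U xy by metis
    obtain m n where "m \<in> N" "m \<in> V" "n \<in> N" "n \<in> W"
      using x y VW unfolding in_closure_of by metis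
    then show "\<exists>y. y \<in> N \<and> y \<in> U"
      using VW(5) N_mult by metis
  qed (use xy in simp)
qed

lemma closure_N_inv: "x \<in> T closure_of N \<Longrightarrow> inv x \<in> T closure_of N"
proof -
  assume x: "x \<in> T closure_of N"
  have "m_inv G ` (T closure_of N) \<subseteq> T closure_of (m_inv G ` N)"
    using continuous_map_inv[of T "\<lambda>x. x"] by (intro continuous_map_image_closure_subset) simp
  also have "\<dots> \<subseteq> T closure_of N" using N_inv by (intro closure_of_mono) blast
  finally show ?thesis using x by blast
qed

text \<open>The induction hypothesis of the construction. At the stages below a it makes the cores
  behave like balls around the identity: they multiply with added radii and are invariant under
  inversion and under conjugation by their stage.\<close>

definition good :: "countable_ordinal \<Rightarrow> bool" where
  "good a \<longleftrightarrow> subgroup (S a) G \<and> N \<subseteq> S a \<and> topological_group (G\<lparr>carrier := S a\<rparr>) (tau a) \<and>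
     continuous_map (top_of_set (carrier K)) (tau a) p \<and> tau a closure_of N = S a"

lemma good_top_group: "good a \<Longrightarrow> top_group (G\<lparr>carrier := S a\<rparr>) (tau a)"
  by unfold_locales (simp add: good_def)

lemma good_inv: "good a \<Longrightarrow> x \<in> S a \<Longrightarrow> inv\<^bsub>G\<lparr>carrier := S a\<rparr>\<^esub> x = inv x"
  by (simp add: good_def m_inv_consistent)

context
  fixes a assumes good: "good a"
begin

interpretation Sa: top_group "G\<lparr>carrier := S a\<rparr>" "tau a"
  by (rule good_top_group[OF good])

lemma good_P_subset: "P r \<subseteq> S a"
  using good P_subset_N by (auto simp: good_def)

lemma good_P_core: "P r \<subseteq> core a r"
  unfolding core_eq using good_P_subset by (simp add: closure_of_subset)

lemma good_S_closed: "x \<in> S a \<Longrightarrow> y \<in> S a \<Longrightarrow> x \<otimes> y \<in> S a" "x \<in> S a \<Longrightarrow> inv x \<in> S a" "\<one> \<in> S a"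
  using good by (auto simp: good_def subgroup.m_closed subgroup.m_inv_closed subgroup.one_closed)

lemma good_core_one: "0 < r \<Longrightarrow> \<one> \<in> core a r"
  using one_P good_P_core by blast

lemma good_core_mult: "x \<in> core a r \<Longrightarrow> y \<in> core a s \<Longrightarrow> x \<otimes> y \<in> core a (r + s)"
proof -
  assume x: "x \<in> core a r" and y: "y \<in> core a s"
  have xy: "x \<in> S a" "y \<in> S a" using x y core_subset_S by auto
  show ?thesis
    unfolding core_eq in_closure_of
  proof (intro conjI allI impI)
    fix U assume U: "x \<otimes> y \<in> U \<and> openin (tau a) U"
    obtain V W where VW: "openin (tau a) V" "openin (tau a) W" "x \<in> V" "y \<in> W" "\<And>a b. a \<in> V \<Longrightarrow> b \<in> W \<Longrightarrow> a \<otimes> b \<in> U"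
      using Sa.mult_nbhds[of U x y] U xy by auto
    obtain m n where "m \<in> P r" "m \<in> V" "n \<in> P s" "n \<in> W"
      using x y VW unfolding core_eq in_closure_of by metis
    then show "\<exists>y. y \<in> P (r + s) \<and> y \<in> U"
      using VW(5) P_mult by metis
  qed (use xy good_S_closed in simp)
qed

lemma good_core_inv: "x \<in> core a r \<Longrightarrow> inv x \<in> core a r"
proof -
  assume x: "x \<in> core a r"
  have "continuous_map (tau a) (tau a) (\<lambda>x. inv\<^bsub>G\<lparr>carrier := S a\<rparr>\<^esub> x)"
    using Sa.continuous_map_inv[of "tau a" "\<lambda>x. x"] by simp
  then have "continuous_map (tau a) (tau a) (\<lambda>x. inv x)"
    by (rule continuous_map_eq) (simp add: good_inv[OF good])
  then have "m_inv G ` core a r \<subseteq> tau a closure_of (m_inv G ` P r)"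
    unfolding core_eq by (intro continuous_map_image_closure_subset) simp
  also have "\<dots> \<subseteq> core a r" unfolding core_eq using P_inv by (intro closure_of_mono) blast
  finally show ?thesis using x by blast
qed

lemma good_core_conj: "x \<in> core a r \<Longrightarrow> g \<in> S a \<Longrightarrow> g \<otimes> x \<otimes> inv g \<in> core a r"
proof -
  assume x: "x \<in> core a r" and g: "g \<in> S a"
  have "continuous_map (tau a) (tau a) (\<lambda>x. g \<otimes> x \<otimes> inv g)"
    using homeomorphic_imp_continuous_map[OF Sa.homeomorphic_map_conj[of g]] g
    by (simp add: good_inv[OF good])
  then have "(\<lambda>x. g \<otimes> x \<otimes> inv g) ` core a r \<subseteq> tau a closure_of ((\<lambda>x. g \<otimes> x \<otimes> inv g) ` P r)"
    unfolding core_eq by (rule continuous_map_image_closure_subset)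
  also have "\<dots> \<subseteq> core a r" unfolding core_eq using P_conj g S_carrier by (intro closure_of_mono) blast
  finally show ?thesis using x by blast
qed

lemma good_core_left: "g \<in> S a \<Longrightarrow> A \<subseteq> S a \<Longrightarrow> tau a closure_of ((\<lambda>x. g \<otimes> x) ` A) = (\<lambda>x. g \<otimes> x) ` (tau a closure_of A)"
  using Sa.closure_of_left_image[of g A] by simp

end

lemma cancel_left:
  "x \<in> carrier G \<Longrightarrow> y \<in> carrier G \<Longrightarrow> x \<otimes> (inv x \<otimes> y) = y"
  "x \<in> carrier G \<Longrightarrow> y \<in> carrier G \<Longrightarrow> inv x \<otimes> (x \<otimes> y) = y"
  by (simp_all add: m_assoc[symmetric])

lemma index_self: "x \<in> S a \<Longrightarrow> (\<And>b. b < a \<Longrightarrow> good b) \<Longrightarrow> i \<in> index a x \<Longrightarrow> x \<in> nb a x i"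
  using S_carrier by (cases i) (auto simp: nb_iff index_iff subset_iff intro: good_core_one)

text \<open>Halving the radius: \<open>core b (r / 2)\<close> times itself lies in
  \<open>core b r\<close>, so the points having some basic neighbourhood inside
  \<open>nb a x i\<close> form an open set.\<close>

lemma nb_openin:
  assumes good: "\<And>b. b < a \<Longrightarrow> good b" and x: "x \<in> S a" "i \<in> index a x"
  obtains U where "openin (tau a) U" "x \<in> U" "U \<subseteq> nb a x i"
proof -
  define U where "U = {y \<in> S a. \<exists>j\<in>index a y. nb a y j \<subseteq> nb a x i}"
  have "x \<in> U" using x unfolding U_def by blast
  moreover have "U \<subseteq> nb a x i" unfolding U_def using index_self[OF _ good] by blast
  moreover have "openin (tau a) U"
    unfolding openin_tau
  proof (intro conjI ballI)
    show "U \<subseteq> S a" unfolding U_def by blast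
    fix y assume "y \<in> U"
    then obtain V r F where y: "y \<in> S a" "(V, r, F) \<in> index a y" "nb a y (V, r, F) \<subseteq> nb a x i"
      unfolding U_def by auto
    have half: "(V, r / 2, F) \<in> index a y" using y(2) by (simp add: index_iff)
    have "z \<in> U" if z: "z \<in> nb a y (V, r / 2, F)" for z
    proof -
      have "(V, r / 2, F) \<in> index a z" using z y(2) by (auto simp: nb_iff index_iff)
      moreover have "nb a z (V, r / 2, F) \<subseteq> nb a y (V, r, F)"
      proof
        fix w assume w: "w \<in> nb a z (V, r / 2, F)"
        have G: "y \<in> carrier G" "z \<in> carrier G" "w \<in> carrier G"
          using y(1) z w S_carrier by (auto simp: nb_iff)
        have "inv y \<otimes> w \<in> core b r" if b: "b \<in> F" for b
        proof -
          have "good b" using b y(2) good by (auto simp: index_iff)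
          moreover have "inv y \<otimes> z \<in> core b (r / 2)" "inv z \<otimes> w \<in> core b (r / 2)"
            using z w b by (auto simp: nb_iff)
          ultimately have "(inv y \<otimes> z) \<otimes> (inv z \<otimes> w) \<in> core b (r / 2 + r / 2)"
            by (rule good_core_mult)
          then show ?thesis using G by (simp add: m_assoc cancel_left)
        qed
        then show "w \<in> nb a y (V, r, F)" using w by (auto simp: nb_iff)
      qed
      moreover have "z \<in> S a" using z by (simp add: nb_iff)
      ultimately show ?thesis unfolding U_def using y(3) by blast
    qed
    then show "\<exists>i\<in>index a y. nb a y i \<subseteq> U" using half by blast
  qed
  ultimately show thesis using that by blast
qed

text \<open>Everything rests on (n m)^-1 (x y) = (m^-1 (n^-1 x) m) (m^-1 y). Conjugation by m in N,
  which is contained in S b, preserves the core, so the two errors add and x y is approximated by n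
  m. Continuity of multiplication is the same computation with x and y in place of n and m, since S
  a is contained in S b for b < a.\<close>

lemma good_step:
  assumes good: "\<And>b. b < a \<Longrightarrow> good b" shows "good a"
proof -
  have NS: "N \<subseteq> S a"
  proof
    fix n assume n: "n \<in> N"
    have nG: "n \<in> carrier G" using n N_carrier by blast
    have "n \<in> T closure_of N" using n closure_of_subset[of N T] N_carrier by auto
    moreover have "\<exists>m\<in>N. inv m \<otimes> n \<in> core b r" if "b < a" "0 < r" for b r
      using n nG good_core_one[OF good] that by (intro bexI[of _ n]) auto
    ultimately show "n \<in> S a" by (simp add: S_iff)
  qed
  have mult: "x \<otimes> y \<in> S a" if x: "x \<in> S a" and y: "y \<in> S a" for x y
    unfolding S_iff
  proof (intro conjI allI impI)
    show "x \<otimes> y \<in> T closure_of N" using x y by (auto simp: S_iff intro: closure_N_mult)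
    fix b :: countable_ordinal and r :: real assume b: "b < a" and r: "0 < r"
    obtain n where n: "n \<in> N" "inv n \<otimes> x \<in> core b (r / 2)"
      using x b r unfolding S_iff by (metis half_gt_zero)
    obtain m where m: "m \<in> N" "inv m \<otimes> y \<in> core b (r / 2)"
      using y b r unfolding S_iff by (metis half_gt_zero)
    have G: "x \<in> carrier G" "y \<in> carrier G" "n \<in> carrier G" "m \<in> carrier G"
      using x y n m N_carrier S_carrier by auto
    have "inv m \<in> S b" using N_inv[OF m(1)] NS S_antimono[OF less_imp_le[OF b]] by auto
    from good_core_conj[OF good[OF b] n(2) this]
    have "inv m \<otimes> (inv n \<otimes> x) \<otimes> m \<in> core b (r / 2)" using G by simp
    from good_core_mult[OF good[OF b] this m(2)]
    have "inv (n \<otimes> m) \<otimes> (x \<otimes> y) \<in> core b r"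
      using G by (simp add: m_assoc cancel_left inv_mult_group)
    then show "\<exists>n\<in>N. inv n \<otimes> (x \<otimes> y) \<in> core b r" using N_mult[OF n(1) m(1)] by blast
  qed
  have inv: "inv x \<in> S a" if x: "x \<in> S a" for x
    unfolding S_iff
  proof (intro conjI allI impI)
    show "inv x \<in> T closure_of N" using x by (auto simp: S_iff intro: closure_N_inv)
    fix b :: countable_ordinal and r :: real assume b: "b < a" and r: "0 < r"
    obtain n where n: "n \<in> N" "inv n \<otimes> x \<in> core b r"
      using x b r unfolding S_iff by blast
    have G: "x \<in> carrier G" "n \<in> carrier G" using x n N_carrier S_carrier by auto
    have "inv x \<otimes> n \<in> core b r"
      using good_core_inv[OF good[OF b] n(2)] G by (simp add: inv_mult_group)
    moreover have "n \<in> S b" using n(1) NS S_antimono[OF less_imp_le[OF b]] by auto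
    ultimately have "n \<otimes> (inv x \<otimes> n) \<otimes> inv n \<in> core b r" by (rule good_core_conj[OF good[OF b]])
    then have "inv (inv n) \<otimes> inv x \<in> core b r" using G by (simp add: m_assoc)
    then show "\<exists>m\<in>N. inv m \<otimes> inv x \<in> core b r" using N_inv[OF n(1)] by blast
  qed
  have sub: "subgroup (S a) G"
    using NS one_N mult inv S_carrier by (intro subgroupI) auto
  have cont_mult: "continuous_map (prod_topology (tau a) (tau a)) (tau a) (\<lambda>(x, y). x \<otimes> y)"
  proof (rule continuous_map_prod_nbhdsI)
    fix x y U assume "x \<in> topspace (tau a)" "y \<in> topspace (tau a)" and U: "openin (tau a) U" "x \<otimes> y \<in> U"
    then have xy: "x \<in> S a" "y \<in> S a" by auto
    have G: "x \<in> carrier G" "y \<in> carrier G" using xy S_carrier by auto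
    obtain V r F where i: "(V, r, F) \<in> index a (x \<otimes> y)" "nb a (x \<otimes> y) (V, r, F) \<subseteq> U"
      using U unfolding openin_tau by (metis prod_cases3)
    obtain A B where AB: "openin T A" "openin T B" "x \<in> A" "y \<in> B" "\<And>u v. u \<in> A \<Longrightarrow> v \<in> B \<Longrightarrow> u \<otimes> v \<in> V"
      using mult_nbhds[of V x y] i(1) G by (metis index_iff)
    have "(A, r / 2, F) \<in> index a x" and y_index: "(B, r / 2, F) \<in> index a y"
      using AB i(1) by (auto simp: index_iff)
    from nb_openin[OF good xy(1) this(1)] nb_openin[OF good xy(2) y_index]
    obtain X Y where XY: "openin (tau a) X" "x \<in> X" "X \<subseteq> nb a x (A, r / 2, F)"
        "openin (tau a) Y" "y \<in> Y" "Y \<subseteq> nb a y (B, r / 2, F)"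
      by metis
    have "u \<otimes> v \<in> U" if u: "u \<in> X" and v: "v \<in> Y" for u v
    proof -
      have u': "u \<in> S a" "u \<in> A" "\<And>b. b \<in> F \<Longrightarrow> inv x \<otimes> u \<in> core b (r / 2)"
        and v': "v \<in> S a" "v \<in> B" "\<And>b. b \<in> F \<Longrightarrow> inv y \<otimes> v \<in> core b (r / 2)"
        using u v XY by (auto simp: nb_iff)
      have G': "u \<in> carrier G" "v \<in> carrier G" using u' v' S_carrier by auto
      have "inv (x \<otimes> y) \<otimes> (u \<otimes> v) \<in> core b r" if b: "b \<in> F" for b
      proof -
        have ba: "b < a" using b i(1) by (auto simp: index_iff)
        have "inv y \<in> S b" using inv[OF xy(2)] S_antimono[OF less_imp_le[OF ba]] by auto
        from good_core_conj[OF good[OF ba] u'(3)[OF b] this]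
        have "inv y \<otimes> (inv x \<otimes> u) \<otimes> y \<in> core b (r / 2)" using G by simp
        from good_core_mult[OF good[OF ba] this v'(3)[OF b]]
        show ?thesis using G G' by (simp add: m_assoc cancel_left inv_mult_group)
      qed
      then have "u \<otimes> v \<in> nb a (x \<otimes> y) (V, r, F)"
        using mult u'(1,2) v'(1,2) AB(5) by (auto simp: nb_iff)
      then show ?thesis using i(2) by blast
    qed
    then show "\<exists>V W. openin (tau a) V \<and> openin (tau a) W \<and> x \<in> V \<and> y \<in> W \<and> (\<forall>v\<in>V. \<forall>w\<in>W. v \<otimes> w \<in> U)"
      using XY(1,2,4,5) by (intro exI[of _ X] exI[of _ Y]) simp
  qed (use mult in auto)
  have cont_inv: "continuous_map (tau a) (tau a) (\<lambda>x. inv x)"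
  proof (rule continuous_map_nbhdsI)
    fix x U assume "x \<in> topspace (tau a)" and U: "openin (tau a) U" "inv x \<in> U"
    then have x: "x \<in> S a" by simp
    have G: "x \<in> carrier G" using x S_carrier by auto
    obtain V r F where i: "(V, r, F) \<in> index a (inv x)" "nb a (inv x) (V, r, F) \<subseteq> U"
      using U unfolding openin_tau by (metis prod_cases3)
    have "openin T {z \<in> carrier G. inv z \<in> V}"
      using i(1) by (intro openin_inv_preimage) (simp add: index_iff)
    then have "({z \<in> carrier G. inv z \<in> V}, r, F) \<in> index a x"
      using i(1) G by (simp add: index_iff)
    from nb_openin[OF good x this]
    obtain X where X: "openin (tau a) X" "x \<in> X" "X \<subseteq> nb a x ({z \<in> carrier G. inv z \<in> V}, r, F)"
      by blast
    have "inv u \<in> U" if u: "u \<in> X" for u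
    proof -
      have u': "u \<in> S a" "inv u \<in> V" "\<And>b. b \<in> F \<Longrightarrow> inv x \<otimes> u \<in> core b r"
        using u X by (auto simp: nb_iff)
      have G': "u \<in> carrier G" using u' S_carrier by auto
      have "inv (inv x) \<otimes> inv u \<in> core b r" if b: "b \<in> F" for b
      proof -
        have ba: "b < a" using b i(1) by (auto simp: index_iff)
        have "x \<in> S b" using x S_antimono[OF less_imp_le[OF ba]] by auto
        from good_core_conj[OF good[OF ba] good_core_inv[OF good[OF ba] u'(3)[OF b]] this]
        show ?thesis using G G' by (simp add: m_assoc inv_mult_group)
      qed
      then have "inv u \<in> nb a (inv x) (V, r, F)" using inv u' by (simp add: nb_iff)
      then show ?thesis using i(2) by blast
    qed
    then show "\<exists>V. openin (tau a) V \<and> x \<in> V \<and> (\<forall>v\<in>V. inv v \<in> U)"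
      using X(1,2) by (intro exI[of _ X]) simp
  qed (use inv in auto)
  have "continuous_map (tau a) (tau a) (m_inv (G\<lparr>carrier := S a\<rparr>))"
    using cont_inv by (rule continuous_map_eq) (simp add: m_inv_consistent[OF sub])
  then have top: "topological_group (G\<lparr>carrier := S a\<rparr>) (tau a)"
    using sub cont_mult by (simp add: topological_group_def subgroup_imp_group)
  have cont_p: "continuous_map (top_of_set (carrier K)) (tau a) p"
  proof (rule continuous_map_nbhdsI)
    fix k U assume "k \<in> topspace (top_of_set (carrier K))" and U: "openin (tau a) U" "p k \<in> U"
    then have k: "k \<in> carrier K" by simp
    obtain V r F where i: "(V, r, F) \<in> index a (p k)" "nb a (p k) (V, r, F) \<subseteq> U"
      using U unfolding openin_tau by (metis prod_cases3)
    let ?W = "{h \<in> topspace (top_of_set (carrier K)). p h \<in> V} \<inter> (carrier K \<inter> ball k r)"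
    have "openin (top_of_set (carrier K)) (carrier K \<inter> ball k r)"
      by (simp add: openin_open_Int)
    moreover have "openin (top_of_set (carrier K)) {h \<in> topspace (top_of_set (carrier K)). p h \<in> V}"
      using i(1) openin_continuous_map_preimage[OF p_continuous, of V] by (simp add: index_iff)
    ultimately have "openin (top_of_set (carrier K)) ?W" by (rule openin_Int[rotated])
    moreover have "k \<in> ?W" using k i(1) by (simp add: index_iff)
    moreover have "p h \<in> U" if h: "h \<in> ?W" for h
    proof -
      have hK: "h \<in> carrier K" "p h \<in> V" "dist k h < r" using h by auto
      have "dist \<one>\<^bsub>K\<^esub> (inv\<^bsub>K\<^esub> k \<otimes>\<^bsub>K\<^esub> h) = dist k h"
        using dist_left[of "inv\<^bsub>K\<^esub> k" k h] k hK by simp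
      then have "p (inv\<^bsub>K\<^esub> k \<otimes>\<^bsub>K\<^esub> h) \<in> P r"
        unfolding P_def using k hK by (intro imageI) simp
      then have "inv (p k) \<otimes> p h \<in> P r" using k hK by simp
      then have "\<forall>b\<in>F. inv (p k) \<otimes> p h \<in> core b r"
        using good_P_core[OF good] i(1) unfolding index_iff by blast
      moreover have "p h \<in> S a" using NS hK unfolding N_def by blast
      ultimately show ?thesis using hK i(2) by (auto simp: nb_iff)
    qed
    ultimately show "\<exists>V. openin (top_of_set (carrier K)) V \<and> k \<in> V \<and> (\<forall>v\<in>V. p v \<in> U)" by blast
  qed (use NS in \<open>auto simp: N_def\<close>)
  have dense: "x \<in> tau a closure_of N" if x: "x \<in> S a" for x
    unfolding in_closure_of
  proof (intro conjI allI impI)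
    show "x \<in> topspace (tau a)" using x by simp
    fix U assume U: "x \<in> U \<and> openin (tau a) U"
    then obtain V r F where i: "(V, r, F) \<in> index a x" "nb a x (V, r, F) \<subseteq> U"
      unfolding openin_tau by (metis prod_cases3)
    have xG: "x \<in> carrier G" using x S_carrier by auto
    show "\<exists>y. y \<in> N \<and> y \<in> U"
    proof (cases "F = {}")
      case True
      have "x \<in> T closure_of N" using x by (simp add: S_iff)
      then obtain n where "n \<in> N" "n \<in> V" using i(1) unfolding in_closure_of index_iff by blast
      then have "n \<in> nb a x (V, r, F)" using True NS by (auto simp: nb_iff)
      then show ?thesis using \<open>n \<in> N\<close> i(2) by blast
    next
      case False
      \<comment> \<open>Cores decrease with the stage, so an approximation at the largest index of F
        serves all of F.\<close>
      define b where "b = Max F"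
      have F: "finite F" "F \<subseteq> {..<a}" "0 < r" "openin T V" "x \<in> V" using i(1) by (auto simp: index_iff)
      have b: "b \<in> F" "\<And>c. c \<in> F \<Longrightarrow> c \<le> b" using F False by (auto simp: b_def)
      then have ba: "b < a" using F by blast
      have x1: "x \<otimes> \<one> \<in> V" using F(5) xG by simp
      obtain A B where
        AB: "openin T A" "openin T B" "x \<in> A" "\<one> \<in> B" "\<And>u v. u \<in> A \<Longrightarrow> v \<in> B \<Longrightarrow> u \<otimes> v \<in> V"
        by (rule mult_nbhds[OF F(4) xG one_closed x1]) (rule that)
      \<comment> \<open>Shrinking the radius to s forces n = x (x^-1 n) into V, so one n meets both
        kinds of requirement.\<close>
      obtain s where s: "0 < s" "core b s \<subseteq> B" by (rule core_small[OF AB(2,4)]) (rule that)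
      have "0 < min r s" using s F by simp
      then obtain n where n: "n \<in> N" "inv n \<otimes> x \<in> core b (min r s)"
        using x ba unfolding S_iff by blast
      have nG: "n \<in> carrier G" using n N_carrier by blast
      have xn: "inv x \<otimes> n \<in> core b (min r s)"
        using good_core_inv[OF good[OF ba] n(2)] xG nG by (simp add: inv_mult_group)
      have "n \<in> V"
        using AB(5)[OF AB(3), of "inv x \<otimes> n"] xn s(2) core_mono[of "min r s" s b] xG nG
        by (simp add: cancel_left subset_iff)
      moreover have "inv x \<otimes> n \<in> core c r" if "c \<in> F" for c
        using xn core_antimono[OF b(2)[OF that]] core_mono[of "min r s" r b] by (auto simp: subset_iff)
      ultimately have "n \<in> nb a x (V, r, F)" using n NS by (auto simp: nb_iff)
      then show ?thesis using n i(2) by blast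
    qed
  qed
  have "tau a closure_of N = S a"
    using dense closure_of_subset_topspace[of "tau a" N] by auto
  with sub NS top cont_p show ?thesis by (simp add: good_def)
qed

lemma good_stage: "good a"
  by (induction a rule: less_induct) (rule good_step)

lemma N_subset_S: "N \<subseteq> S a" and subgroup_S: "subgroup (S a) G"
  and continuous_map_p_tau: "continuous_map (top_of_set (carrier K)) (tau a) p"
  and dense_N: "tau a closure_of N = S a"
  using good_stage by (simp_all add: good_def)

lemmas core_one = good_core_one[OF good_stage]
lemmas core_mult = good_core_mult[OF good_stage]
lemmas core_inv = good_core_inv[OF good_stage]
lemmas P_core = good_P_core[OF good_stage]
lemmas S_closed = good_S_closed[OF good_stage]
lemmas core_left = good_core_left[OF good_stage]
lemmas nb_open = nb_openin[OF good_stage]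

lemma top_group_S: "top_group (G\<lparr>carrier := S a\<rparr>) (tau a)"
  by (rule good_top_group[OF good_stage])

section \<open>Complete metrizability of a stage\<close>

context
  fixes a :: countable_ordinal
begin

text \<open>
  The left-invariant \<open>rho\<close> alone metrizes \<open>tau a\<close> for \<open>a > 0\<close>; adding a complete metric of \<open>T\<close>
  makes the metric complete.
\<close>

definition wt :: "countable_ordinal \<Rightarrow> real" where
  "wt b = inverse (real (Suc (to_nat_on {..<a} b)))"

text \<open>Radius r is demanded only at the stages of weight above r. These are finitely many, so
  \<open>E r\<close> contains a \<open>tau a\<close> neighbourhood of the identity even when a has
  infinitely many predecessors. Radii add in products because r + s < wt b implies both r < wt b and
  s < wt b; since weights are at most 1, \<open>E 1\<close> is all of S a.\<close>

definition E :: "real \<Rightarrow> 'a set" where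
  "E r = {x \<in> S a. \<forall>b<a. r < wt b \<longrightarrow> x \<in> core b r}"

definition rho :: "'a \<Rightarrow> real" where
  "rho x = Inf {r. 0 < r \<and> x \<in> E r}"

lemma wt_pos: "0 < wt b" and wt_le: "wt b \<le> 1"
  by (simp_all add: wt_def field_simps)

lemma finite_wt_large:
  assumes "0 < r" shows "finite {b. b < a \<and> r < wt b}"
proof -
  have cnt: "countable {..<a}" by (rule countable_lessThan_ordinal)
  obtain m where m: "inverse (real (Suc m)) < r" using assms reals_Archimedean by blast
  have "to_nat_on {..<a} b \<le> m" if "r < wt b" for b
  proof (rule ccontr)
    assume "\<not> to_nat_on {..<a} b \<le> m"
    then have "wt b \<le> inverse (real (Suc m))" by (simp add: wt_def field_simps)
    with m that show False by simp
  qed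
  then have "to_nat_on {..<a} ` {b. b < a \<and> r < wt b} \<subseteq> {..m}" by auto
  then have "finite (to_nat_on {..<a} ` {b. b < a \<and> r < wt b})" by (rule finite_subset) simp
  moreover have "inj_on (to_nat_on {..<a}) {b. b < a \<and> r < wt b}"
    by (rule inj_on_subset[OF inj_on_to_nat_on[OF cnt]]) auto
  ultimately show ?thesis by (rule finite_imageD)
qed

lemma E_one: "x \<in> S a \<Longrightarrow> x \<in> E 1"
  using wt_le by (auto simp: E_def not_less[symmetric])

lemma E_subset: "E r \<subseteq> S a"
  by (auto simp: E_def)

lemma E_mult: "0 < r \<Longrightarrow> 0 < s \<Longrightarrow> x \<in> E r \<Longrightarrow> y \<in> E s \<Longrightarrow> x \<otimes> y \<in> E (r + s)"
  unfolding E_def using S_closed core_mult by auto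

lemma E_inv: "x \<in> E r \<Longrightarrow> inv x \<in> E r"
  unfolding E_def using S_closed core_inv by auto

lemma E_id: "0 < r \<Longrightarrow> \<one> \<in> E r"
  unfolding E_def using S_closed core_one by auto

lemma rho_less_iff: "x \<in> S a \<Longrightarrow> rho x < r \<longleftrightarrow> (\<exists>s. 0 < s \<and> s < r \<and> x \<in> E s)"
proof -
  assume "x \<in> S a"
  then have "{r. 0 < r \<and> x \<in> E r} \<noteq> {}" using E_one[of x] zero_less_one by blast
  moreover have "bdd_below {r. 0 < r \<and> x \<in> E r}" by (rule bdd_belowI[of _ 0]) simp
  ultimately show ?thesis unfolding rho_def by (subst cInf_less_iff) auto
qed

lemma rho_nonneg: "x \<in> S a \<Longrightarrow> 0 \<le> rho x"
  using rho_less_iff[of x 0] by (meson less_trans not_less less_irrefl)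

lemma rho_le: "0 < r \<Longrightarrow> x \<in> E r \<Longrightarrow> rho x \<le> r"
  by (rule ccontr) (use rho_less_iff[of x] E_subset[of r] in \<open>auto simp: rho_def intro!: cInf_lower bdd_belowI[of _ 0]\<close>)

lemma rho_one: "rho \<one> = 0"
proof (rule antisym)
  show "rho \<one> \<le> 0"
    by (rule field_le_epsilon) (simp add: rho_le E_id)
qed (simp add: rho_nonneg S_closed)

lemma rho_inv: "x \<in> S a \<Longrightarrow> rho (inv x) = rho x"
  unfolding rho_def using E_inv[of x] E_inv[of "inv x"] S_carrier by (metis inv_inv subsetD)

lemma rho_mult: "x \<in> S a \<Longrightarrow> y \<in> S a \<Longrightarrow> rho (x \<otimes> y) \<le> rho x + rho y"
proof (rule field_le_epsilon)
  fix e :: real assume xy: "x \<in> S a" "y \<in> S a" and "0 < e"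
  then obtain r s where "0 < r" "r < rho x + e / 2" "x \<in> E r" "0 < s" "s < rho y + e / 2" "y \<in> E s"
    using rho_less_iff[of x "rho x + e / 2"] rho_less_iff[of y "rho y + e / 2"] by auto
  then show "rho (x \<otimes> y) \<le> rho x + rho y + e"
    using rho_le[OF _ E_mult[of r s x y]] by simp
qed

text \<open>Completeness of T provides the candidate x; induction on the stage shows that it is the
  right limit. Convergence in \<open>tau c\<close> and closedness of \<open>core c r\<close> carry
  the Cauchy estimate over to x for each c < b. This yields both that x belongs to S b and that the
  convergence holds in \<open>tau b\<close>.\<close>

lemma limit_in_stages:
  assumes sigma: "range \<sigma> \<subseteq> S a" and lim: "limitin T \<sigma> x sequentially"
    and cauchy: "\<And>b r. b < a \<Longrightarrow> 0 < r \<Longrightarrow> \<exists>m0. \<forall>m\<ge>m0. \<forall>k\<ge>m0. inv (\<sigma> m) \<otimes> \<sigma> k \<in> core b r"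
    and "b \<le> a"
  shows "x \<in> S b \<and> limitin (tau b) \<sigma> x sequentially"
  using \<open>b \<le> a\<close>
proof (induction b rule: less_induct)
  case (less b)
  have sS: "\<sigma> k \<in> S a" for k using sigma by blast
  have sG: "\<sigma> k \<in> carrier G" for k using sS S_carrier by blast
  have xG: "x \<in> carrier G" using limitin_topspace[OF lim] by simp
  have close: "\<exists>m0. \<forall>m\<ge>m0. inv (\<sigma> m) \<otimes> x \<in> core c r" if c: "c < b" and r: "0 < r" for c r
  proof -
    have ca: "c < a" using c less.prems by (rule less_le_trans)
    from less.IH[OF c] ca have x: "x \<in> S c" "limitin (tau c) \<sigma> x sequentially"
      by (auto simp: less_imp_le)
    obtain m0 where m0: "\<forall>m\<ge>m0. \<forall>k\<ge>m0. inv (\<sigma> m) \<otimes> \<sigma> k \<in> core c r"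
      using cauchy[OF ca r] by blast
    interpret Sc: top_group "G\<lparr>carrier := S c\<rparr>" "tau c" by (rule top_group_S)
    have "inv (\<sigma> m) \<otimes> x \<in> core c r" if m: "m \<ge> m0" for m
    proof (rule limitin_closedin)
      have "inv (\<sigma> m) \<in> S c" using S_closed(2)[OF sS] S_antimono[OF less_imp_le[OF ca]] by blast
      then have "continuous_map (tau c) (tau c) (\<lambda>y. inv (\<sigma> m) \<otimes> y)"
        using homeomorphic_imp_continuous_map[OF Sc.homeomorphic_map_left[of "inv (\<sigma> m)"]] by simp
      from continuous_map_limit[OF this x(2)]
      show "limitin (tau c) (\<lambda>k. inv (\<sigma> m) \<otimes> \<sigma> k) (inv (\<sigma> m) \<otimes> x) sequentially"
        by (simp add: comp_def)
      show "closedin (tau c) (core c r)" unfolding core_eq by simp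
      show "\<forall>\<^sub>F k in sequentially. inv (\<sigma> m) \<otimes> \<sigma> k \<in> core c r"
        using m0 m unfolding eventually_sequentially by blast
    qed simp
    then show ?thesis by blast
  qed
  have xS: "x \<in> S b"
    unfolding S_iff
  proof (intro conjI allI impI)
    show "x \<in> T closure_of N"
    proof (rule limitin_closedin[OF lim])
      show "\<forall>\<^sub>F k in sequentially. \<sigma> k \<in> T closure_of N" using sS by (auto simp: S_iff)
    qed auto
    fix c :: countable_ordinal and r :: real assume c: "c < b" and r: "0 < r"
    have ca: "c < a" using c less.prems by (rule less_le_trans)
    obtain m where m: "inv (\<sigma> m) \<otimes> x \<in> core c (r / 2)" using close[OF c, of "r / 2"] r by auto
    obtain n where n: "n \<in> N" "inv n \<otimes> \<sigma> m \<in> core c (r / 2)"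
      using sS[of m] ca r unfolding S_iff by (metis half_gt_zero)
    have "n \<in> carrier G" using n N_carrier by blast
    then have "inv n \<otimes> x \<in> core c r"
      using core_mult[OF n(2) m] sG xG by (simp add: m_assoc cancel_left)
    with n show "\<exists>n\<in>N. inv n \<otimes> x \<in> core c r" by blast
  qed
  moreover have "limitin (tau b) \<sigma> x sequentially"
    unfolding limitin_def
  proof (intro conjI allI impI)
    show "x \<in> topspace (tau b)" using xS by simp
    fix U assume U: "openin (tau b) U \<and> x \<in> U"
    then obtain V r F where i: "(V, r, F) \<in> index b x" "nb b x (V, r, F) \<subseteq> U"
      unfolding openin_tau by (metis prod_cases3)
    have "\<forall>\<^sub>F m in sequentially. \<sigma> m \<in> V"
      using lim i(1) unfolding limitin_def index_iff by blast
    moreover have "\<forall>\<^sub>F m in sequentially. \<forall>c\<in>F. inv x \<otimes> \<sigma> m \<in> core c r"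
    proof (rule eventually_ball_finite)
      show "finite F" using i(1) by (simp add: index_iff)
      show "\<forall>c\<in>F. \<forall>\<^sub>F m in sequentially. inv x \<otimes> \<sigma> m \<in> core c r"
      proof
        fix c assume "c \<in> F"
        then have c: "c < b" and r: "0 < r" using i(1) by (auto simp: index_iff)
        from close[OF c r] obtain m0 where m0: "\<And>m. m \<ge> m0 \<Longrightarrow> inv (\<sigma> m) \<otimes> x \<in> core c r" by blast
        have "inv x \<otimes> \<sigma> m \<in> core c r" if "m \<ge> m0" for m
          using core_inv[OF m0[OF that]] sG xG by (simp add: inv_mult_group)
        then show "\<forall>\<^sub>F m in sequentially. inv x \<otimes> \<sigma> m \<in> core c r"
          unfolding eventually_sequentially by blast
      qed
    qed
    ultimately show "\<forall>\<^sub>F m in sequentially. \<sigma> m \<in> U"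
    proof eventually_elim
      case (elim m)
      moreover have "\<sigma> m \<in> S b" using sS S_antimono[OF less.prems] by blast
      ultimately have "\<sigma> m \<in> nb b x (V, r, F)" by (simp add: nb_iff)
      with i(2) show ?case by blast
    qed
  qed
  ultimately show ?case by blast
qed

text \<open>For the sum metric a Cauchy sequence converges in T by the first summand, and the second
  summand is exactly the Cauchy condition of \<open>limit_in_stages\<close>.\<close>

lemma completely_metrizable_tau: "completely_metrizable_space (tau a)"
proof -
  obtain M0 d0 where "Metric_space M0 d0" and mc: "Metric_space.mcomplete M0 d0"
    and T_eq: "T = Metric_space.mtopology M0 d0"
    using complete_T unfolding completely_metrizable_space_def by blast
  interpret D: Metric_space M0 d0 by fact
  have M0: "M0 = carrier G" using topspace_eq unfolding T_eq by simp
  have SM: "x \<in> M0" if "x \<in> S a" for x using that S_carrier M0 by blast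
  \<comment> \<open>The value 0 off S a keeps d nonnegative and symmetric on the whole type, as
    \<open>Metric_space\<close> demands.\<close>
  define d where "d x y = (if x \<in> S a \<and> y \<in> S a then d0 x y + rho (inv x \<otimes> y) else 0)" for x y
  have d_eq: "d x y = d0 x y + rho (inv x \<otimes> y)" if "x \<in> S a" "y \<in> S a" for x y
    using that by (simp add: d_def)
  have quot: "inv x \<otimes> y \<in> S a" if "x \<in> S a" "y \<in> S a" for x y
    using that S_closed by blast
  have G: "x \<in> carrier G" if "x \<in> S a" for x using that S_carrier by blast
  interpret L: Metric_space "S a" d
  proof
    show "0 \<le> d x y" for x y
      using rho_nonneg quot by (simp add: d_def)
    show "d x y = d y x" for x y
    proof (cases "x \<in> S a \<and> y \<in> S a")
      case True
      then have "rho (inv x \<otimes> y) = rho (inv y \<otimes> x)"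
        using rho_inv[OF quot[of y x]] G by (simp add: inv_mult_group)
      then show ?thesis using True by (simp add: d_eq D.commute)
    qed (auto simp: d_def)
    fix x y assume xy: "x \<in> S a" "y \<in> S a"
    show "d x y = 0 \<longleftrightarrow> x = y"
    proof
      assume "d x y = 0"
      then have "d0 x y = 0"
        using rho_nonneg[OF quot[OF xy]] D.nonneg[of x y] unfolding d_eq[OF xy] by linarith
      then show "x = y" using xy SM by simp
    next
      assume "x = y"
      then show "d x y = 0" using xy SM G by (simp add: d_eq rho_one)
    qed
    fix z assume z: "z \<in> S a"
    have "rho (inv x \<otimes> z) = rho ((inv x \<otimes> y) \<otimes> (inv y \<otimes> z))"
      using G xy z by (simp add: m_assoc cancel_left)
    also have "\<dots> \<le> rho (inv x \<otimes> y) + rho (inv y \<otimes> z)"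
      using quot xy z by (intro rho_mult) auto
    finally show "d x z \<le> d x y + d y z"
      using D.triangle[of x y z] SM xy z by (simp add: d_eq)
  qed
  have topo: "L.mtopology = tau a"
    unfolding topology_eq
  proof
    fix U
    show "openin L.mtopology U \<longleftrightarrow> openin (tau a) U"
    proof
      assume U: "openin L.mtopology U"
      show "openin (tau a) U"
        unfolding openin_tau
      proof (intro conjI ballI)
        show US: "U \<subseteq> S a" using openin_subset[OF U] by simp
        fix x assume x: "x \<in> U"
        then obtain r where r: "r > 0" "L.mball x r \<subseteq> U" using U unfolding L.openin_mtopology by meson
        have xS: "x \<in> S a" using x US by blast
        define F where "F = {b. b < a \<and> r / 3 < wt b}"
        have "openin T (D.mball x (r / 3))" by (simp add: T_eq)
        moreover have "x \<in> D.mball x (r / 3)" using r(1) SM[OF xS] by simp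
        moreover have "finite F" unfolding F_def using r(1) by (intro finite_wt_large) simp
        ultimately have "(D.mball x (r / 3), r / 3, F) \<in> index a x"
          using r(1) by (auto simp: index_iff F_def)
        moreover have "nb a x (D.mball x (r / 3), r / 3, F) \<subseteq> L.mball x r"
        proof
          fix y assume y: "y \<in> nb a x (D.mball x (r / 3), r / 3, F)"
          then have yS: "y \<in> S a" by (simp add: nb_iff)
          have "inv x \<otimes> y \<in> E (r / 3)"
            using y quot[OF xS yS] by (auto simp: nb_iff E_def F_def)
          then have "rho (inv x \<otimes> y) \<le> r / 3" using r(1) by (intro rho_le) auto
          moreover have "d0 x y < r / 3" using y by (simp add: nb_iff)
          ultimately show "y \<in> L.mball x r" using xS yS r(1) by (simp add: d_eq)
        qed
        ultimately show "\<exists>i\<in>index a x. nb a x i \<subseteq> U" using r(2) by blast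
      qed
    next
      assume U: "openin (tau a) U"
      show "openin L.mtopology U"
        unfolding L.openin_mtopology
      proof (intro conjI allI impI)
        show US: "U \<subseteq> S a" using openin_subset[OF U] by simp
        fix x assume x: "x \<in> U"
        then have xS: "x \<in> S a" using US by blast
        obtain V r F where i: "(V, r, F) \<in> index a x" "nb a x (V, r, F) \<subseteq> U"
          using U x unfolding openin_tau by (metis prod_cases3)
        have F: "finite F" "F \<subseteq> {..<a}" "0 < r" "openin T V" "x \<in> V" using i(1) by (auto simp: index_iff)
        obtain e where e: "e > 0" "D.mball x e \<subseteq> V"
          using F(4,5) unfolding T_eq D.openin_mtopology by meson
        \<comment> \<open>With q at most every weight of F, membership in \<open>E s\<close> for s <
          q constrains all the stages in F.\<close>
        define q where "q = Min (insert e (insert r (wt ` F)))"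
        have "finite (insert e (insert r (wt ` F)))" using F(1) by simp
        then have q: "0 < q" "q \<le> e" "q \<le> r" "\<And>b. b \<in> F \<Longrightarrow> q \<le> wt b"
          unfolding q_def using F(3) e(1) wt_pos by (auto simp del: Min_insert intro: Min_le)
        have "L.mball x q \<subseteq> nb a x (V, r, F)"
        proof
          fix y assume "y \<in> L.mball x q"
          then have yS: "y \<in> S a" and dq: "d0 x y + rho (inv x \<otimes> y) < q" using xS by (auto simp: d_eq)
          have "d0 x y < e" using dq rho_nonneg[OF quot[OF xS yS]] q(2) by simp
          then have "y \<in> V" using e(2) xS yS SM by (auto simp: subset_iff)
          have "rho (inv x \<otimes> y) < q" using dq D.nonneg[of x y] by linarith
          then obtain s where s: "0 < s" "s < q" "inv x \<otimes> y \<in> E s"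
            using rho_less_iff[OF quot[OF xS yS]] by blast
          have "inv x \<otimes> y \<in> core b r" if b: "b \<in> F" for b
          proof -
            have "b < a" "s < wt b" using b F(2) q(4)[OF b] s(2) by auto
            then have "inv x \<otimes> y \<in> core b s" using s(3) by (simp add: E_def)
            moreover have "s \<le> r" using s(2) q(3) by simp
            ultimately show ?thesis using core_mono by blast
          qed
          then show "y \<in> nb a x (V, r, F)" using yS \<open>y \<in> V\<close> by (simp add: nb_iff)
        qed
        then show "\<exists>r>0. L.mball x r \<subseteq> U" using i(2) q(1) by blast
      qed
    qed
  qed
  have "L.mcomplete"
    unfolding L.mcomplete_def
  proof (intro allI impI)
    fix \<sigma> assume \<sigma>: "L.MCauchy \<sigma>"
    then have range: "range \<sigma> \<subseteq> S a" by (simp add: L.MCauchy_def)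
    have sS: "\<sigma> k \<in> S a" for k using range by blast
    have d_cauchy: "\<exists>m0. \<forall>m k. m0 \<le> m \<longrightarrow> m0 \<le> k \<longrightarrow> d0 (\<sigma> m) (\<sigma> k) + rho (inv (\<sigma> m) \<otimes> \<sigma> k) < e"
      if "e > 0" for e
      using \<sigma> that sS unfolding L.MCauchy_def by (simp add: d_eq)
    have "D.MCauchy \<sigma>"
      unfolding D.MCauchy_def
    proof (intro conjI allI impI)
      show "range \<sigma> \<subseteq> M0" using range SM by blast
      fix e :: real assume "e > 0"
      from d_cauchy[OF this] obtain m0 where
        m0: "\<forall>m k. m0 \<le> m \<longrightarrow> m0 \<le> k \<longrightarrow> d0 (\<sigma> m) (\<sigma> k) + rho (inv (\<sigma> m) \<otimes> \<sigma> k) < e" by blast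
      have "d0 (\<sigma> m) (\<sigma> k) < e" if "m0 \<le> m" "m0 \<le> k" for m k
        using m0[rule_format, OF that] rho_nonneg[OF quot[OF sS sS, of m k]] by simp
      then show "\<exists>m0. \<forall>m k. m0 \<le> m \<longrightarrow> m0 \<le> k \<longrightarrow> d0 (\<sigma> m) (\<sigma> k) < e" by blast
    qed
    then obtain x where x: "limitin T \<sigma> x sequentially"
      using mc unfolding D.mcomplete_def T_eq by blast
    have "\<exists>m0. \<forall>m\<ge>m0. \<forall>k\<ge>m0. inv (\<sigma> m) \<otimes> \<sigma> k \<in> core b r" if b: "b < a" and r: "0 < r" for b r
    proof -
      have "0 < min r (wt b)" using r wt_pos by simp
      from d_cauchy[OF this] obtain m0 where
        m0: "\<forall>m k. m0 \<le> m \<longrightarrow> m0 \<le> k \<longrightarrow> d0 (\<sigma> m) (\<sigma> k) + rho (inv (\<sigma> m) \<otimes> \<sigma> k) < min r (wt b)" by blast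
      have "inv (\<sigma> m) \<otimes> \<sigma> k \<in> core b r" if mk: "m0 \<le> m" "m0 \<le> k" for m k
      proof -
        have "rho (inv (\<sigma> m) \<otimes> \<sigma> k) < min r (wt b)"
          using m0[rule_format, OF mk] D.nonneg[of "\<sigma> m" "\<sigma> k"] by linarith
        then obtain s where s: "0 < s" "s < min r (wt b)" "inv (\<sigma> m) \<otimes> \<sigma> k \<in> E s"
          using rho_less_iff[OF quot[OF sS sS]] by blast
        then have "inv (\<sigma> m) \<otimes> \<sigma> k \<in> core b s" using b by (simp add: E_def)
        then show ?thesis using core_mono[of s r] s(2) by auto
      qed
      then show ?thesis by blast
    qed
    from limit_in_stages[OF range x this order_refl]
    show "\<exists>x. limitin L.mtopology \<sigma> x sequentially" unfolding topo by blast
  qed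
  then show ?thesis
    unfolding completely_metrizable_space_def using L.Metric_space_axioms topo by metis
qed

end

lemma polish_group_tau: "polish_group (G\<lparr>carrier := S a\<rparr>) (tau a)"
proof -
  have "separable_space (subtopology (tau a) (p ` topspace (top_of_set (carrier K))))"
    by (rule separable_space_continuous_map_image[OF separable_K])
       (use continuous_map_p_tau[of a] N_subset_S[of a] in
         \<open>auto simp: continuous_map_in_subtopology N_def\<close>)
  then obtain D where D: "countable D" "D \<subseteq> S a \<inter> N" "subtopology (tau a) N closure_of D = S a \<inter> N"
    unfolding separable_space_def by (auto simp: N_def)
  have "N \<subseteq> tau a closure_of D"
    using D(3) N_subset_S closure_of_subtopology_subset[of "tau a" N D] by blast
  then have "tau a closure_of N \<subseteq> tau a closure_of D"
    by (simp add: closure_of_minimal)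
  then have "tau a closure_of D = S a"
    using dense_N[of a] closure_of_subset_topspace[of "tau a" D] by auto
  then have "separable_space (tau a)"
    unfolding separable_space_def using D by auto
  with completely_metrizable_tau[of a] top_group_S[of a] show ?thesis
    by (simp add: polish_group_def polish_space_topology_def top_group_def)
qed

lemma polish_subgroup_S:
  "polish_subgroup_topology G T (S a) (tau a)" "polish_subgroup G T (S a)"
  using polish_group_tau continuous_map_tau_T subgroup_S
  by (auto simp: polish_subgroup_def polish_subgroup_topology_def)

lemma polish_topology_of_S: "polish_topology_of G T (S a) = tau a"
  unfolding polish_topology_of_def
proof (rule the_equality)
  show "polish_subgroup_topology G T (S a) (tau a)" by (rule polish_subgroup_S)
  fix S' assume "polish_subgroup_topology G T (S a) S'"
  then show "S' = tau a"
    using polish_group_topology_unique[of "G\<lparr>carrier := S a\<rparr>" S' "tau a" T] polish_subgroup_S(1)[of a]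
      completely_metrizable_imp_metrizable_space[OF complete_T]
    by (simp add: polish_subgroup_topology_def metrizable_imp_Hausdorff_space)
qed

subsection \<open>Category on \<open>K\<close>\<close>

abbreviation X :: "'k topology" where "X \<equiv> top_of_set (carrier K)"

lemma complete_X: "completely_metrizable_space X"
  using completely_metrizable_space_closedin[OF completely_metrizable_space_euclidean, of "carrier K"] closed_K
  by simp

lemma second_countable_X: "second_countable X"
  using separable_K completely_metrizable_imp_metrizable_space[OF complete_X]
  by (rule separable_metrizable_imp_second_countable)

lemma openin_X_ball: "openin X {k \<in> carrier K. dist w k < r}"
proof -
  have "{k \<in> carrier K. dist w k < r} = carrier K \<inter> ball w r" by auto
  then show ?thesis by (simp add: openin_open_Int)
qed

lemma openin_X_iff: "openin X U \<longleftrightarrow> U \<subseteq> carrier K \<and>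
    (\<forall>x\<in>U. \<exists>r>0. {k \<in> carrier K. dist x k < r} \<subseteq> U)"
  unfolding openin_euclidean_subtopology_iff
  by (simp add: dist_commute subset_iff Ball_def conj_commute imp_conjL)

lemma top_group_K: "top_group K X"
proof
  have "continuous_map (prod_topology X X) X (\<lambda>(x, y). x \<otimes>\<^bsub>K\<^esub> y)"
  proof (rule continuous_map_prod_nbhdsI)
    fix x y U assume "x \<in> topspace X" "y \<in> topspace X" and U: "openin X U" "x \<otimes>\<^bsub>K\<^esub> y \<in> U"
    then have xy: "x \<in> carrier K" "y \<in> carrier K" by auto
    obtain e where e: "e > 0" "{k \<in> carrier K. dist (x \<otimes>\<^bsub>K\<^esub> y) k < e} \<subseteq> U"
      using U unfolding openin_X_iff by meson
    have "v \<otimes>\<^bsub>K\<^esub> w \<in> U" if v: "v \<in> carrier K" "dist x v < e / 2" and w: "w \<in> carrier K" "dist y w < e / 2" for v w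
    proof -
      have "dist (x \<otimes>\<^bsub>K\<^esub> y) (v \<otimes>\<^bsub>K\<^esub> w) \<le> dist (x \<otimes>\<^bsub>K\<^esub> y) (v \<otimes>\<^bsub>K\<^esub> y) + dist (v \<otimes>\<^bsub>K\<^esub> y) (v \<otimes>\<^bsub>K\<^esub> w)"
        by (rule dist_triangle)
      also have "\<dots> = dist x v + dist y w" using xy v w by (simp add: dist_left dist_right)
      finally show ?thesis using e(2) v w by auto
    qed
    then show "\<exists>V W. openin X V \<and> openin X W \<and> x \<in> V \<and> y \<in> W \<and> (\<forall>v\<in>V. \<forall>w\<in>W. v \<otimes>\<^bsub>K\<^esub> w \<in> U)"
      using xy e(1) openin_X_ball[of x "e / 2"] openin_X_ball[of y "e / 2"]
      by (intro exI[of _ "{k \<in> carrier K. dist x k < e / 2}"]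
          exI[of _ "{k \<in> carrier K. dist y k < e / 2}"]) auto
  qed auto
  moreover have "continuous_map X X (m_inv K)"
  proof (rule continuous_map_nbhdsI)
    fix x U assume "x \<in> topspace X" and U: "openin X U" "inv\<^bsub>K\<^esub> x \<in> U"
    then have x: "x \<in> carrier K" by auto
    obtain e where e: "e > 0" "{k \<in> carrier K. dist (inv\<^bsub>K\<^esub> x) k < e} \<subseteq> U"
      using U unfolding openin_X_iff by meson
    have "inv\<^bsub>K\<^esub> v \<in> U" if v: "v \<in> carrier K" "dist x v < e" for v
    proof -
      have "dist (inv\<^bsub>K\<^esub> x) (inv\<^bsub>K\<^esub> v) = dist (x \<otimes>\<^bsub>K\<^esub> inv\<^bsub>K\<^esub> x) (x \<otimes>\<^bsub>K\<^esub> inv\<^bsub>K\<^esub> v)"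
        using x v by (subst dist_left) auto
      also have "\<dots> = dist (v \<otimes>\<^bsub>K\<^esub> inv\<^bsub>K\<^esub> v) (x \<otimes>\<^bsub>K\<^esub> inv\<^bsub>K\<^esub> v)" using x v by simp
      also have "\<dots> = dist v x" using x v by (subst dist_right) auto
      finally show ?thesis using e(2) v by (auto simp: dist_commute)
    qed
    then show "\<exists>V. openin X V \<and> x \<in> V \<and> (\<forall>v\<in>V. inv\<^bsub>K\<^esub> v \<in> U)"
      using x e(1) by (intro exI[of _ "{k \<in> carrier K. dist x k < e}"]) (simp add: openin_X_ball)
  qed auto
  ultimately show "topological_group K X" by (simp add: topological_group_def group_K)
qed

text \<open>In Vaught's notation with K acting by x p(k), "\<open>V \<inter> section_at A x\<close>
  is not meager" is the existential transform of A over V at x, and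
  "\<open>W - section_at A x\<close> is meager" is the universal transform over W.\<close>

definition section_at :: "'a set \<Rightarrow> 'a \<Rightarrow> 'k set" where
  "section_at A x = {k \<in> carrier K. x \<otimes> p k \<in> A}"

text \<open>A form of the Baire property that is inherited by complements and countable unions.\<close>

definition approx :: "'k set \<Rightarrow> bool" where
  "approx M \<longleftrightarrow> (\<forall>V. openin X V \<longrightarrow> V \<noteq> {} \<longrightarrow>
     (\<exists>W. openin X W \<and> W \<noteq> {} \<and> W \<subseteq> V \<and> (meager_in X (W \<inter> M) \<or> meager_in X (W - M))))"

lemma approx_open: "openin X M \<Longrightarrow> approx M"
  unfolding approx_def
proof (intro allI impI)
  fix V assume M: "openin X M" and V: "openin X V" "V \<noteq> {}"
  show "\<exists>W. openin X W \<and> W \<noteq> {} \<and> W \<subseteq> V \<and> (meager_in X (W \<inter> M) \<or> meager_in X (W - M))"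
  proof (cases "V \<inter> M = {}")
    case True
    then show ?thesis using V by (intro exI[of _ V]) (simp add: meager_in_empty)
  next
    case False
    moreover have "V \<inter> M - M = {}" by blast
    moreover have "openin X (V \<inter> M)" using V M by (intro openin_Int)
    ultimately show ?thesis using meager_in_empty[of X] by (intro exI[of _ "V \<inter> M"]) (metis inf_le1)
  qed
qed

lemma approx_complement: assumes "approx M" shows "approx (carrier K - M)"
  unfolding approx_def
proof (intro allI impI)
  fix V assume V: "openin X V" "V \<noteq> {}"
  then obtain W where W: "openin X W" "W \<noteq> {}" "W \<subseteq> V" "meager_in X (W \<inter> M) \<or> meager_in X (W - M)"
    using assms unfolding approx_def by meson
  have "W \<inter> (carrier K - M) = W - M" "W - (carrier K - M) = W \<inter> M"
    using openin_subset[OF W(1)] by auto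
  then show "\<exists>W. openin X W \<and> W \<noteq> {} \<and> W \<subseteq> V \<and>
      (meager_in X (W \<inter> (carrier K - M)) \<or> meager_in X (W - (carrier K - M)))"
    using W by (intro exI[of _ W]) auto
qed

text \<open>Either some M n is comeager in an open part of V, or by \<open>meager_in_locally\<close>
  every M n is meager in V and then so is the union.\<close>

lemma approx_UN: assumes "\<And>n :: nat. approx (M n)" shows "approx (\<Union>n. M n)"
  unfolding approx_def
proof (intro allI impI)
  fix V assume V: "openin X V" "V \<noteq> {}"
  show "\<exists>W. openin X W \<and> W \<noteq> {} \<and> W \<subseteq> V \<and> (meager_in X (W \<inter> (\<Union>n. M n)) \<or> meager_in X (W - (\<Union>n. M n)))"
  proof (cases "\<exists>n W. openin X W \<and> W \<noteq> {} \<and> W \<subseteq> V \<and> meager_in X (W - M n)")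
    case True
    then obtain n W where W: "openin X W" "W \<noteq> {}" "W \<subseteq> V" "meager_in X (W - M n)" by blast
    then have "meager_in X (W - (\<Union>n. M n))" by (intro meager_in_subset[OF W(4)]) blast
    with W show ?thesis by (intro exI[of _ W]) simp
  next
    case False
    have "meager_in X (V \<inter> M n)" for n
    proof (rule meager_in_locally[OF second_countable_X V(1)])
      fix V' assume V': "openin X V'" "V' \<noteq> {}" "V' \<subseteq> V"
      then obtain W where W: "openin X W" "W \<noteq> {}" "W \<subseteq> V'" "meager_in X (W \<inter> M n) \<or> meager_in X (W - M n)"
        using assms[of n] unfolding approx_def by meson
      with False V' have "meager_in X (W \<inter> M n)" by (meson order_trans)
      with W show "\<exists>W. openin X W \<and> W \<noteq> {} \<and> W \<subseteq> V' \<and> meager_in X (W \<inter> M n)"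
        by (intro exI[of _ W]) simp
    qed
    then have "meager_in X (\<Union>n. V \<inter> M n)" by (intro meager_in_UN) auto
    then have "meager_in X (V \<inter> (\<Union>n. M n))" by simp
    with V show ?thesis by (intro exI[of _ V]) simp
  qed
qed

lemma section_at_open:
  assumes "openin T A" "x \<in> carrier G" shows "openin X (section_at A x)"
proof -
  have "continuous_map X T (\<lambda>k. x \<otimes> p k)"
    using assms(2) p_continuous by (intro continuous_map_mult) auto
  from openin_continuous_map_preimage[OF this assms(1)]
  show ?thesis by (simp add: section_at_def)
qed

lemma approx_section:
  assumes "x \<in> carrier G"
  shows "sigma0 T a A \<Longrightarrow> approx (section_at A x)" and "pi0 T a A \<Longrightarrow> approx (section_at A x)"
proof (induction rule: sigma0_pi0.inducts)
  case (sigma0_open U)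
  then show ?case using assms by (intro approx_open section_at_open)
next
  case (sigma0_Union a A)
  then have "approx (\<Union>n. section_at (A n) x)" by (intro approx_UN) blast
  moreover have "section_at (\<Union>n. A n) x = (\<Union>n. section_at (A n) x)"
    by (auto simp: section_at_def)
  ultimately show ?case by simp
next
  case (pi0_complement a A)
  have "section_at (topspace T - A) x = carrier K - section_at A x"
    using assms by (auto simp: section_at_def)
  with pi0_complement show ?case using approx_complement by simp
qed

lemma nonmeager_imp_comeager_somewhere:
  assumes "approx M" "openin X V" "\<not> meager_in X (V \<inter> M)"
  shows "\<exists>W. openin X W \<and> W \<noteq> {} \<and> W \<subseteq> V \<and> meager_in X (W - M)"
proof (rule ccontr)
  assume none: "\<not> ?thesis"
  have "meager_in X (V \<inter> M)"
  proof (rule meager_in_locally[OF second_countable_X assms(2)])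
    fix V' assume V': "openin X V'" "V' \<noteq> {}" "V' \<subseteq> V"
    then obtain W where W: "openin X W" "W \<noteq> {}" "W \<subseteq> V'" "meager_in X (W \<inter> M) \<or> meager_in X (W - M)"
      using assms(1) unfolding approx_def by meson
    with none V' have "meager_in X (W \<inter> M)" by (meson order_trans)
    with W show "\<exists>W. openin X W \<and> W \<noteq> {} \<and> W \<subseteq> V' \<and> meager_in X (W \<inter> M)"
      by (intro exI[of _ W]) simp
  qed
  with assms(3) show False by blast
qed

lemma comeager_imp_nonmeager:
  assumes "openin X W" "W \<noteq> {}" "meager_in X (W - M)" shows "\<not> meager_in X (W \<inter> M)"
proof
  assume "meager_in X (W \<inter> M)"
  with assms(3) have "meager_in X ((W \<inter> M) \<union> (W - M))" by (intro meager_in_Un)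
  also have "(W \<inter> M) \<union> (W - M) = W" by blast
  finally show False using not_meager_in_openin[OF complete_X assms(1,2)] by blast
qed

subsection \<open>Vaught transforms lower the Borel class\<close>

text \<open>
  If \<open>x p(k) \<in> A\<close> for generic \<open>k\<close> in a ball of radius \<open>2 r\<close>, then for every \<open>b\<close> in the ball of radius
  \<open>r\<close> around the identity \<open>x p(b) p(k) \<in> A\<close> for generic \<open>k\<close> in the concentric ball of radius \<open>r\<close>.
  When this is a closed condition it passes from \<open>x P r\<close> to \<open>x core g r\<close>, a neighbourhood in the
  next topology.
\<close>

lemma transform_open:
  assumes "sigma0 T (1 + a) A" "openin X V"
  shows "openin (tau a) {x \<in> S a. \<not> meager_in X (V \<inter> section_at A x)}"
  using assms
proof (induction a arbitrary: A V rule: less_induct)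
  case (less a)
  let ?Z = "{x \<in> S a. \<not> meager_in X (V \<inter> section_at A x)}"
  have "\<exists>U. openin (tau a) U \<and> x \<in> U \<and> U \<subseteq> ?Z" if x: "x \<in> ?Z" for x
  proof (cases "a = 0")
    case True
    then have A: "openin T A" using less.prems(1) by (simp add: ordinal_plus_zero sigma0_one)
    have xS: "x \<in> S a" and "V \<inter> section_at A x \<noteq> {}" using x meager_in_empty[of X] by auto
    then obtain k where k: "k \<in> V" "k \<in> carrier K" "x \<otimes> p k \<in> A" by (auto simp: section_at_def)
    have "continuous_map (tau a) T (\<lambda>y. y \<otimes> p k)"
      using continuous_map_tau_T k(2) by (intro continuous_map_mult) auto
    from openin_continuous_map_preimage[OF this A]
    have "openin (tau a) {y \<in> S a. y \<otimes> p k \<in> A}" by simp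
    moreover have "{y \<in> S a. y \<otimes> p k \<in> A} \<subseteq> ?Z"
    proof safe
      fix y assume y: "y \<in> S a" "y \<otimes> p k \<in> A" and m: "meager_in X (V \<inter> section_at A y)"
      have "openin X (V \<inter> section_at A y)"
        using y S_carrier A less.prems(2) by (intro openin_Int section_at_open) auto
      moreover have "k \<in> V \<inter> section_at A y" using k y by (simp add: section_at_def)
      ultimately show False using m not_meager_in_openin[OF complete_X] by blast
    qed
    ultimately show ?thesis using xS k(3) by (intro exI[of _ "{y \<in> S a. y \<otimes> p k \<in> A}"]) simp
  next
    case False
    then have one_less: "1 < 1 + a" by (rule ordinal_one_less_one_plus)
    obtain B where B: "A = (\<Union>n :: nat. B n)" "\<And>n. \<exists>b. 1 \<le> b \<and> b < 1 + a \<and> pi0 T b (B n)"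
      using sigma0_cases_Union[OF less.prems(1) one_less] by metis
    have xS: "x \<in> S a" and xG: "x \<in> carrier G" using x S_carrier by auto
    have "V \<inter> section_at A x = (\<Union>n. V \<inter> section_at (B n) x)"
      unfolding B(1) by (auto simp: section_at_def)
    then have "\<exists>n. \<not> meager_in X (V \<inter> section_at (B n) x)"
      using x meager_in_UN[of UNIV X "\<lambda>n. V \<inter> section_at (B n) x"] by auto
    then obtain n where n: "\<not> meager_in X (V \<inter> section_at (B n) x)" by blast
    obtain b where b: "1 \<le> b" "b < 1 + a" "pi0 T b (B n)" using B(2) by blast
    obtain g where g: "b = 1 + g" using ordinal_one_plus_cases[OF b(1)] by blast
    have ga: "g < a" using b(2) unfolding g by (simp add: ordinal_plus_less_iff)
    have Bn: "sigma0 T (1 + g) (topspace T - B n)" using b(3) unfolding g by (simp add: pi0_iff)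
    obtain W where W: "openin X W" "W \<noteq> {}" "W \<subseteq> V" "meager_in X (W - section_at (B n) x)"
      using nonmeager_imp_comeager_somewhere[OF approx_section(2)[OF xG b(3)] less.prems(2) n] by blast
    obtain w where w: "w \<in> W" using W(2) by blast
    have wK: "w \<in> carrier K" using w openin_subset[OF W(1)] by auto
    obtain e where e: "e > 0" "{k \<in> carrier K. dist w k < e} \<subseteq> W"
      using W(1) w unfolding openin_X_iff by meson
    define r where "r = e / 2"
    have r: "0 < r" using e by (simp add: r_def)
    define W' where "W' = {k \<in> carrier K. dist w k < r}"
    have W': "openin X W'" "W' \<noteq> {}" "W' \<subseteq> V"
    proof -
      show "openin X W'" unfolding W'_def by (rule openin_X_ball)
      have "w \<in> W'" using wK r by (simp add: W'_def)
      then show "W' \<noteq> {}" by blast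
      have "W' \<subseteq> {k \<in> carrier K. dist w k < e}" using e(1) by (auto simp: W'_def r_def)
      then show "W' \<subseteq> V" using e(2) W(3) by blast
    qed
    \<comment> \<open>The complement of F in S g is the existential transform of the complement of
      \<open>B n\<close>, so the induction hypothesis at g makes F closed in
      \<open>tau g\<close>.\<close>
    define F where "F = {y \<in> S g. meager_in X (W' - section_at (B n) y)}"
    have "W' \<inter> section_at (topspace T - B n) y = W' - section_at (B n) y" if "y \<in> S g" for y
      using that S_carrier by (auto simp: section_at_def W'_def subset_iff)
    then have "{y \<in> S g. \<not> meager_in X (W' \<inter> section_at (topspace T - B n) y)} = S g - F"
      by (auto simp: F_def)
    then have F_closed: "closedin (tau g) F"
      using less.IH[OF ga Bn W'(1)] by (auto simp: closedin_def F_def)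
    have xSg: "x \<in> S g" using xS S_antimono[OF less_imp_le[OF ga]] by blast
    \<comment> \<open>For y = p k the section at x y is the section at x translated by k^-1. By
      right invariance h and k h are at distance less than r, so k maps the ball W' into the ball of
      radius e = 2 r, hence into W.\<close>
    have "(\<lambda>y. x \<otimes> y) ` P r \<subseteq> F"
    proof (rule image_subsetI)
      fix y assume "y \<in> P r"
      then obtain k where k: "k \<in> carrier K" "y = p k" "dist \<one>\<^bsub>K\<^esub> k < r" by (auto simp: P_def)
      have "y \<in> S g" using k(1,2) N_subset_S[of g] by (auto simp: N_def)
      then have "x \<otimes> y \<in> S g" using S_closed(1)[OF xSg] by blast
      moreover have "meager_in X (W' - section_at (B n) (x \<otimes> y))"
      proof -
        interpret KX: top_group K X by (rule top_group_K)
        have ik: "inv\<^bsub>K\<^esub> k \<in> carrier K" using k by simp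
        have "meager_in X ((\<lambda>h. inv\<^bsub>K\<^esub> k \<otimes>\<^bsub>K\<^esub> h) ` (W - section_at (B n) x))"
          by (rule meager_in_homeomorphic_map[OF KX.homeomorphic_map_left[OF ik] W(4)])
        moreover have "W' - section_at (B n) (x \<otimes> y) \<subseteq>
            (\<lambda>h. inv\<^bsub>K\<^esub> k \<otimes>\<^bsub>K\<^esub> h) ` (W - section_at (B n) x)"
        proof
          fix h assume h: "h \<in> W' - section_at (B n) (x \<otimes> y)"
          then have hK: "h \<in> carrier K" "dist w h < r" by (auto simp: W'_def)
          have "dist w (k \<otimes>\<^bsub>K\<^esub> h) \<le> dist w h + dist h (k \<otimes>\<^bsub>K\<^esub> h)" by (rule dist_triangle)
          also have "dist h (k \<otimes>\<^bsub>K\<^esub> h) = dist \<one>\<^bsub>K\<^esub> k"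
            using dist_right[of h "\<one>\<^bsub>K\<^esub>" k] k hK by simp
          finally have "dist w (k \<otimes>\<^bsub>K\<^esub> h) < e" using k hK by (simp add: r_def)
          then have "k \<otimes>\<^bsub>K\<^esub> h \<in> W" using e(2) k hK by auto
          moreover have "k \<otimes>\<^bsub>K\<^esub> h \<notin> section_at (B n) x"
            using h hK k xG by (auto simp: section_at_def m_assoc)
          ultimately show "h \<in> (\<lambda>h. inv\<^bsub>K\<^esub> k \<otimes>\<^bsub>K\<^esub> h) ` (W - section_at (B n) x)"
            using k hK by (intro image_eqI[of _ _ "k \<otimes>\<^bsub>K\<^esub> h"]) (simp_all add: K.m_assoc[symmetric])
        qed
        ultimately show ?thesis by (rule meager_in_subset)
      qed
      ultimately show "x \<otimes> y \<in> F" by (simp add: F_def)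
    qed
    then have "tau g closure_of ((\<lambda>y. x \<otimes> y) ` P r) \<subseteq> F"
      using F_closed by (rule closure_of_minimal)
    then have core_F: "(\<lambda>y. x \<otimes> y) ` core g r \<subseteq> F"
      using core_left[OF xSg, of "P r"] P_subset_N N_subset_S unfolding core_eq by (metis order_trans)
    \<comment> \<open>As g < a, the translate x \<open>core g r\<close> contains a
      \<open>tau a\<close> neighbourhood of x; one step in Borel class is paid for by one step in
      the stages.\<close>
    have "(carrier G, r, {g}) \<in> index a x"
      using xG r ga openin_topspace[of T] by (simp add: index_iff)
    from nb_open[OF xS this] obtain U where U: "openin (tau a) U" "x \<in> U" "U \<subseteq> nb a x (carrier G, r, {g})"
      by blast
    have "y \<in> ?Z" if "y \<in> U" for y
    proof -
      have y: "y \<in> S a" "inv x \<otimes> y \<in> core g r" using U(3) that by (auto simp: nb_iff)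
      have yG: "y \<in> carrier G" using y S_carrier by blast
      have "y = x \<otimes> (inv x \<otimes> y)" using xG yG by (simp add: cancel_left)
      then have "y \<in> F" using core_F y(2) by blast
      then have "\<not> meager_in X (W' \<inter> section_at (B n) y)"
        using comeager_imp_nonmeager[OF W'(1,2)] by (simp add: F_def)
      moreover have "W' \<inter> section_at (B n) y \<subseteq> V \<inter> section_at A y"
        using W'(3) unfolding B(1) by (auto simp: section_at_def)
      ultimately show ?thesis using y(1) meager_in_subset by blast
    qed
    with U(1,2) show ?thesis by blast
  qed
  then show ?case by (subst openin_subopen) blast
qed

lemma transform_closed:
  assumes "pi0 T (1 + a) A" "openin X W"
  shows "closedin (tau a) {x \<in> S a. meager_in X (W - section_at A x)}"
proof -
  have "W \<inter> section_at (topspace T - A) x = W - section_at A x" if "x \<in> S a" for x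
    using that S_carrier openin_subset[OF assms(2)] by (auto simp: section_at_def subset_iff)
  then have "S a - {x \<in> S a. meager_in X (W - section_at A x)} =
      {x \<in> S a. \<not> meager_in X (W \<inter> section_at (topspace T - A) x)}"
    by auto
  then show ?thesis
    using transform_open[of a "topspace T - A" W] assms by (auto simp: closedin_def pi0_iff)
qed

text \<open>The complement of H is a countable union of sets \<open>B n\<close> of class
  \<open>pi0\<close> at 1 + a. If x in S a is outside H, the whole coset x N is, so some
  \<open>B n\<close> contains x p(k) for comeager many k in some basic W. This covers S a - H by
  countably many sets \<open>F n W\<close>, closed in \<open>tau a\<close> by
  \<open>transform_closed\<close>. They are disjoint from H, hence from the dense N, hence nowhere
  dense. So S a - H is meager; but together with its translate by the inverse of a point x0 outside
  H it covers S a, contrary to Baire.\<close>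

theorem S_least:
  assumes H: "subgroup H G" "N \<subseteq> H" "pi0 T (1 + a + 1) H"
  shows "S a \<subseteq> H"
proof (rule ccontr)
  assume "\<not> S a \<subseteq> H"
  then obtain x0 where x0: "x0 \<in> S a" "x0 \<notin> H" by blast
  have met: "metrizable_space T" using complete_T by (rule completely_metrizable_imp_metrizable_space)
  have "1 < 1 + a + 1" using ordinal_one_plus_ge[of a] ordinal_less_plus_one_iff by metis
  then obtain B where B: "topspace T - H = (\<Union>n :: nat. B n)" "\<And>n. \<exists>b. 1 \<le> b \<and> b < 1 + a + 1 \<and> pi0 T b (B n)"
    using sigma0_cases_Union[of T "1 + a + 1" "topspace T - H"] H(3) unfolding pi0_iff[of T _ H] by metis
  have Bn: "pi0 T (1 + a) (B n)" for n
    using B(2)[of n] pi0_mono[OF met] by (auto simp: ordinal_less_plus_one_iff)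
  obtain \<B> where \<B>: "countable \<B>" "\<And>V. V \<in> \<B> \<Longrightarrow> openin X V"
      "\<And>U x. openin X U \<Longrightarrow> x \<in> U \<Longrightarrow> \<exists>V\<in>\<B>. x \<in> V \<and> V \<subseteq> U"
    using second_countable_X unfolding second_countable_def by metis
  define F where "F n W = {x \<in> S a. meager_in X (W - section_at (B n) x)}" for n W
  have F_closed: "closedin (tau a) (F n W)" if "W \<in> \<B>" for n W
    unfolding F_def using Bn \<B>(2)[OF that] by (rule transform_closed)
  have F_disj: "F n W \<inter> H = {}" if W: "W \<in> \<B>" "W \<noteq> {}" for n W
  proof (rule equals0I)
    fix x assume x: "x \<in> F n W \<inter> H"
    then have "\<not> meager_in X (W \<inter> section_at (B n) x)"
      using comeager_imp_nonmeager[OF \<B>(2)[OF W(1)] W(2)] by (simp add: F_def)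
    then have "W \<inter> section_at (B n) x \<noteq> {}" using meager_in_empty by metis
    then obtain k where k: "k \<in> carrier K" "x \<otimes> p k \<in> B n" by (auto simp: section_at_def)
    then have "x \<otimes> p k \<notin> H" using B(1) by blast
    moreover have "x \<otimes> p k \<in> H"
      using x k(1) H(1,2) by (auto simp: N_def intro!: subgroup.m_closed[OF H(1)])
    ultimately show False by blast
  qed
  have F_nowhere: "tau a interior_of F n W = {}" if W: "W \<in> \<B>" "W \<noteq> {}" for n W
  proof (rule equals0I)
    fix x assume "x \<in> tau a interior_of F n W"
    then obtain U where U: "openin (tau a) U" "x \<in> U" "U \<subseteq> F n W" unfolding interior_of_def by blast
    have "x \<in> tau a closure_of N" using U(1,2) openin_subset[OF U(1)] dense_N by auto
    then obtain m where "m \<in> N" "m \<in> U" using U(1,2) unfolding in_closure_of by meson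
    then show False using U(3) F_disj[OF W] H(2) by blast
  qed
  have cover: "S a - H \<subseteq> (\<Union>i\<in>UNIV \<times> {W\<in>\<B>. W \<noteq> {}}. F (fst i) (snd i))"
  proof
    fix x assume x: "x \<in> S a - H"
    then have xG: "x \<in> carrier G" using S_carrier by blast
    have "carrier K \<subseteq> (\<Union>n. carrier K \<inter> section_at (B n) x)"
    proof
      fix k assume k: "k \<in> carrier K"
      have pk: "p k \<in> H" using H(2) k by (auto simp: N_def)
      have "x \<otimes> p k \<notin> H"
      proof
        assume "x \<otimes> p k \<in> H"
        then have "x \<otimes> p k \<otimes> inv (p k) \<in> H"
          using pk H(1) by (auto intro: subgroup.m_closed subgroup.m_inv_closed)
        then show False using x xG k by (simp add: m_assoc)
      qed
      then have "x \<otimes> p k \<in> (\<Union>n. B n)" using B(1) xG k by auto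
      then show "k \<in> (\<Union>n. carrier K \<inter> section_at (B n) x)" using k by (auto simp: section_at_def)
    qed
    moreover have "\<not> meager_in X (carrier K)"
      using not_meager_in_openin[OF complete_X, of "carrier K"] K.one_closed by auto
    ultimately have "\<not> meager_in X (\<Union>n. carrier K \<inter> section_at (B n) x)"
      using meager_in_subset by blast
    then obtain n where "\<not> meager_in X (carrier K \<inter> section_at (B n) x)"
      using meager_in_UN[of UNIV X "\<lambda>n. carrier K \<inter> section_at (B n) x"] by blast
    then obtain W where W: "openin X W" "W \<noteq> {}" "meager_in X (W - section_at (B n) x)"
      using nonmeager_imp_comeager_somewhere[OF approx_section(2)[OF xG Bn[of n]], of "carrier K"] by auto
    then obtain W' where W': "W' \<in> \<B>" "W' \<noteq> {}" "W' \<subseteq> W" using \<B>(3) by blast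
    then have "x \<in> F n W'"
      using x W(3) by (auto simp: F_def intro: meager_in_subset)
    with W' show "x \<in> (\<Union>i\<in>UNIV \<times> {W\<in>\<B>. W \<noteq> {}}. F (fst i) (snd i))" by (auto intro!: bexI[of _ "(n, W')"])
  qed
  have "countable {W\<in>\<B>. W \<noteq> {}}" using \<B>(1) by (rule countable_subset[rotated]) blast
  then have "meager_in (tau a) (\<Union>i\<in>UNIV \<times> {W\<in>\<B>. W \<noteq> {}}. F (fst i) (snd i))"
    using F_closed F_nowhere by (intro meager_in_UN meager_in_closed countable_SIGMA) (simp_all add: mem_Times_iff)
  then have meager: "meager_in (tau a) (S a - H)" using cover by (rule meager_in_subset)
  interpret Sa: top_group "G\<lparr>carrier := S a\<rparr>" "tau a" by (rule top_group_S)
  have ix: "inv x0 \<in> S a" using S_closed x0 by blast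
  have "meager_in (tau a) ((\<lambda>y. inv x0 \<otimes> y) ` (S a - H))"
    using meager_in_homeomorphic_map[OF Sa.homeomorphic_map_left[of "inv x0"] meager] ix by simp
  with meager have "meager_in (tau a) ((S a - H) \<union> (\<lambda>y. inv x0 \<otimes> y) ` (S a - H))"
    by (rule meager_in_Un)
  moreover have "S a \<subseteq> (S a - H) \<union> (\<lambda>y. inv x0 \<otimes> y) ` (S a - H)"
  proof
    fix y assume y: "y \<in> S a"
    have G: "y \<in> carrier G" "x0 \<in> carrier G" using y x0 S_carrier by auto
    show "y \<in> (S a - H) \<union> (\<lambda>y. inv x0 \<otimes> y) ` (S a - H)"
    proof (cases "y \<in> H")
      case True
      have "x0 \<otimes> y \<notin> H"
      proof
        assume "x0 \<otimes> y \<in> H"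
        then have "x0 \<otimes> y \<otimes> inv y \<in> H"
          using True H(1) by (auto intro: subgroup.m_closed subgroup.m_inv_closed)
        then show False using x0 G by (simp add: m_assoc)
      qed
      moreover have "x0 \<otimes> y \<in> S a" using S_closed x0 y by blast
      moreover have "y = inv x0 \<otimes> (x0 \<otimes> y)" using G by (simp add: cancel_left)
      ultimately show ?thesis by blast
    qed (use y in blast)
  qed
  ultimately have "meager_in (tau a) (S a)" by (rule meager_in_subset)
  then show False
    using not_meager_in_openin[OF completely_metrizable_tau, of a "S a"] x0(1) openin_topspace[of "tau a"] by auto
qed

subsection \<open>Borel class of the phantom subgroups\<close>

lemma metrizable_T: "metrizable_space T"
  using complete_T by (rule completely_metrizable_imp_metrizable_space)

text \<open>With D in place of N, the unions over approximating elements become countable and stay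
  within the Borel classes.\<close>

lemma dense_sequence:
  obtains D where "countable D" "D \<subseteq> N" "\<And>n r. n \<in> N \<Longrightarrow> 0 < r \<Longrightarrow> \<exists>z\<in>D. inv z \<otimes> n \<in> P r"
proof -
  obtain D0 where D0: "countable D0" "D0 \<subseteq> carrier K" "X closure_of D0 = carrier K"
    using separable_K by (auto simp: separable_space_def)
  have "\<exists>z\<in>p ` D0. inv z \<otimes> n \<in> P r" if n: "n \<in> N" and r: "0 < r" for n r
  proof -
    obtain k where k: "k \<in> carrier K" "n = p k" using n by (auto simp: N_def)
    have "k \<in> X closure_of D0" using D0(3) k by simp
    moreover have "openin X {h \<in> carrier K. dist k h < r}" by (rule openin_X_ball)
    moreover have "k \<in> {h \<in> carrier K. dist k h < r}" using k r by simp
    ultimately obtain d where d: "d \<in> D0" "d \<in> carrier K" "dist k d < r"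
      unfolding in_closure_of by (metis (mono_tags, lifting) mem_Collect_eq)
    have "dist \<one>\<^bsub>K\<^esub> (inv\<^bsub>K\<^esub> d \<otimes>\<^bsub>K\<^esub> k) = dist d k"
      using dist_left[of "inv\<^bsub>K\<^esub> d" d k] d k by simp
    then have "p (inv\<^bsub>K\<^esub> d \<otimes>\<^bsub>K\<^esub> k) \<in> P r"
      unfolding P_def using d k by (intro imageI) (simp add: dist_commute)
    then have "inv (p d) \<otimes> n \<in> P r" using d k by simp
    with d show ?thesis by blast
  qed
  then show thesis using D0 by (intro that[of "p ` D0"]) (auto simp: N_def)
qed

lemma near_dense:
  assumes D: "D \<subseteq> N" "\<And>n r. n \<in> N \<Longrightarrow> 0 < r \<Longrightarrow> \<exists>z\<in>D. inv z \<otimes> n \<in> P r"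
    and x: "x \<in> S a" "g < a" "0 < r"
  shows "\<exists>z\<in>D. inv z \<otimes> x \<in> core g r"
proof -
  obtain n where n: "n \<in> N" "inv n \<otimes> x \<in> core g (r / 2)"
    using x unfolding S_iff by (metis half_gt_zero)
  obtain z where z: "z \<in> D" "inv z \<otimes> n \<in> P (r / 2)" using D(2)[OF n(1), of "r / 2"] x(3) by auto
  have "n \<in> carrier G" "z \<in> carrier G" "x \<in> carrier G" using n z D(1) N_carrier x S_carrier by auto
  then have "inv z \<otimes> x \<in> core g r"
    using core_mult[OF _ n(2), of "inv z \<otimes> n" "r / 2"] P_core z(2) by (auto simp: m_assoc cancel_left subset_iff)
  with z show ?thesis by blast
qed

lemma closedin_core_left: "z \<in> S a \<Longrightarrow> closedin (tau a) ((\<lambda>y. z \<otimes> y) ` core a r)"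
  using core_left[of z a "P r"] P_subset_N N_subset_S[of a] unfolding core_eq
  by (metis closedin_closure_of order_trans)

text \<open>At stage 0 the topology is the subspace topology of T. Later, an open set is the trace
  on S a of countably many translates z \<open>core g q\<close> with z in D and g < a. Each is
  closed in \<open>tau g\<close>, so by induction it is S g intersected with a set of class
  \<open>pi0\<close> at 1 + g, and 1 + g < 1 + a.\<close>

lemma tau_open_borel:
  assumes "openin (tau a) U" shows "\<exists>V. sigma0 T (1 + a) V \<and> U = S a \<inter> V"
  using assms
proof (induction a arbitrary: U rule: less_induct)
  case (less a)
  have US: "U \<subseteq> S a" using openin_subset[OF less.prems] by simp
  show ?case
  proof (cases "a = 0")
    case True
    define V where "V = \<Union>{V. openin T V \<and> S a \<inter> V \<subseteq> U}"
    have "openin T V" unfolding V_def by (rule openin_Union) blast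
    moreover have "U \<subseteq> V"
    proof
      fix x assume x: "x \<in> U"
      then obtain W r F where i: "(W, r, F) \<in> index a x" "nb a x (W, r, F) \<subseteq> U"
        using less.prems unfolding openin_tau by (metis prod_cases3)
      have "F = {}" using i(1) True zero_le_ordinal by (auto simp: index_iff not_le[symmetric])
      then have "S a \<inter> W \<subseteq> U" using i(2) by (auto simp: nb_iff)
      then show "x \<in> V" using i(1) unfolding V_def index_iff by blast
    qed
    moreover have "S a \<inter> V \<subseteq> U" unfolding V_def by blast
    ultimately show ?thesis
      using US True by (intro exI[of _ V]) (auto simp: ordinal_plus_zero sigma0_one)
  next
    case False
    obtain D where D: "countable D" "D \<subseteq> N" "\<And>n r. n \<in> N \<Longrightarrow> 0 < r \<Longrightarrow> \<exists>z\<in>D. inv z \<otimes> n \<in> P r"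
      by (rule dense_sequence) (rule that)
    define I where "I = {(z, g, m). z \<in> D \<and> g < a \<and>
      S a \<inter> (\<lambda>y. z \<otimes> y) ` core g (inverse (real (Suc m))) \<subseteq> U}"
    have "I \<subseteq> D \<times> {..<a} \<times> UNIV" by (auto simp: I_def)
    moreover have "countable (D \<times> {..<a} \<times> (UNIV :: nat set))"
      using D(1) countable_lessThan_ordinal by (intro countable_SIGMA) auto
    ultimately have cI: "countable I" by (rule countable_subset)
    have "\<exists>Q. pi0 T (1 + g) Q \<and> (\<lambda>y. z \<otimes> y) ` core g q = S g \<inter> Q" if zg: "z \<in> D" "g < a" for z g q
    proof -
      have "z \<in> S g" using zg D(2) N_subset_S by blast
      then have closed: "closedin (tau g) ((\<lambda>y. z \<otimes> y) ` core g q)" by (rule closedin_core_left)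
      then obtain V where V: "sigma0 T (1 + g) V" "S g - (\<lambda>y. z \<otimes> y) ` core g q = S g \<inter> V"
        using less.IH[OF zg(2), of "S g - (\<lambda>y. z \<otimes> y) ` core g q"] unfolding closedin_def
        by (metis topspace_tau)
      have "(\<lambda>y. z \<otimes> y) ` core g q = S g \<inter> (topspace T - V)"
        using V(2) closedin_subset[OF closed] S_carrier by auto
      with V(1) show ?thesis by (blast intro: pi0_complement)
    qed
    then obtain Q where Q: "\<And>z g q. z \<in> D \<Longrightarrow> g < a \<Longrightarrow> pi0 T (1 + g) (Q z g q)"
        "\<And>z g q. z \<in> D \<Longrightarrow> g < a \<Longrightarrow> (\<lambda>y. z \<otimes> y) ` core g q = S g \<inter> Q z g q"
      by metis
    define V where "V = (\<Union>i\<in>I. case i of (z, g, m) \<Rightarrow> Q z g (inverse (real (Suc m))))"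
    have "sigma0 T (1 + a) V"
      unfolding V_def
    proof (rule sigma0_UN_pi0[OF cI ordinal_one_less_one_plus[OF False]])
      fix i assume "i \<in> I"
      then obtain z g m where "i = (z, g, m)" "z \<in> D" "g < a" by (auto simp: I_def)
      then show "\<exists>b<1 + a. pi0 T b (case i of (z, g, m) \<Rightarrow> Q z g (inverse (real (Suc m))))"
        using Q(1) by (intro exI[of _ "1 + g"]) (simp add: ordinal_plus_less_iff)
    qed
    moreover have "S a \<inter> V \<subseteq> U"
    proof
      fix x assume x: "x \<in> S a \<inter> V"
      then obtain z g m where i: "(z, g, m) \<in> I" "x \<in> Q z g (inverse (real (Suc m)))"
        unfolding V_def by auto
      have zg: "z \<in> D" "g < a" using i(1) by (auto simp: I_def)
      have "x \<in> S g" using x S_antimono[OF less_imp_le[OF zg(2)]] by blast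
      then have "x \<in> (\<lambda>y. z \<otimes> y) ` core g (inverse (real (Suc m)))" using Q(2)[OF zg] i(2) by blast
      then show "x \<in> U" using x i(1) by (auto simp: I_def)
    qed
    moreover have "U \<subseteq> V"
    proof
      fix x assume xU: "x \<in> U"
      then have xS: "x \<in> S a" using US by blast
      have xG: "x \<in> carrier G" using xS S_carrier by blast
      obtain W r F where i: "(W, r, F) \<in> index a x" "nb a x (W, r, F) \<subseteq> U"
        using less.prems xU unfolding openin_tau by (metis prod_cases3)
      have F: "finite F" "F \<subseteq> {..<a}" "0 < r" "openin T W" "x \<in> W" using i(1) by (auto simp: index_iff)
      \<comment> \<open>The inserted 0 provides a stage below a when F is empty; the T-open
        condition W must still be absorbed into some core.\<close>
      define g where "g = Max (insert 0 F)"
      have "0 < a" using False zero_le_ordinal[of a] by simp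
      moreover have "g \<in> insert 0 F" unfolding g_def using F(1) by (intro Max_in) auto
      ultimately have ga: "g < a" using F(2) by auto
      have gF: "c \<le> g" if "c \<in> F" for c using that F(1) by (auto simp: g_def)
      have x1: "x \<otimes> \<one> \<in> W" using F(5) xG by simp
      obtain A B where AB: "openin T A" "openin T B" "x \<in> A" "\<one> \<in> B" "\<And>u v. u \<in> A \<Longrightarrow> v \<in> B \<Longrightarrow> u \<otimes> v \<in> W"
        by (rule mult_nbhds[OF F(4) xG one_closed x1]) (rule that)
      obtain s where s: "0 < s" "\<And>b. core b s \<subseteq> B" by (rule core_small[OF AB(2,4)]) (rule that)
      have "0 < min r s / 2" using s F by simp
      then obtain m where m: "inverse (real (Suc m)) < min r s / 2" using reals_Archimedean by blast
      define q where "q = inverse (real (Suc m))"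
      \<comment> \<open>Two points of z \<open>core g q\<close> differ by an element of
        \<open>core g (q + q)\<close>, since the detour through z costs q twice.\<close>
      have q: "0 < q" "q + q \<le> r" "q + q \<le> s" using m by (auto simp: q_def)
      obtain z where z: "z \<in> D" "inv z \<otimes> x \<in> core g q" using near_dense[OF D(2,3) xS ga q(1)] by blast
      have zG: "z \<in> carrier G" using z D(2) N_carrier by blast
      have "S a \<inter> (\<lambda>y. z \<otimes> y) ` core g q \<subseteq> nb a x (W, r, F)"
      proof
        fix y assume y: "y \<in> S a \<inter> (\<lambda>y. z \<otimes> y) ` core g q"
        then obtain c where c: "c \<in> core g q" "y = z \<otimes> c" by blast
        have cG: "c \<in> carrier G" using c core_carrier by blast
        have "inv (inv z \<otimes> x) \<otimes> c \<in> core g (q + q)"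
          by (rule core_mult[OF core_inv[OF z(2)] c(1)])
        then have xy: "inv x \<otimes> y \<in> core g (q + q)"
          using xG zG cG c(2) by (simp add: inv_mult_group m_assoc)
        have "inv x \<otimes> y \<in> core b r" if "b \<in> F" for b
          using xy core_antimono[OF gF[OF that]] core_mono[OF q(2)] by blast
        moreover have "x \<otimes> (inv x \<otimes> y) \<in> W"
          using AB(5)[OF AB(3)] xy core_mono[OF q(3)] s(2) by blast
        then have "y \<in> W" using xG zG cG c(2) by (simp add: cancel_left)
        ultimately show "y \<in> nb a x (W, r, F)" using y by (simp add: nb_iff)
      qed
      then have "(z, g, m) \<in> I" using z(1) ga i(2) by (auto simp: I_def q_def)
      moreover have "x \<in> (\<lambda>y. z \<otimes> y) ` core g q"
        by (rule image_eqI[OF _ z(2)]) (use xG zG in \<open>simp add: cancel_left\<close>)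
      then have "x \<in> Q z g q" using Q(2)[OF z(1) ga] by blast
      ultimately show "x \<in> V" unfolding V_def q_def by (intro UN_I) auto
    qed
    ultimately show ?thesis using US by (intro exI[of _ V]) blast
  qed
qed

lemma tau_closed_borel:
  assumes "closedin (tau a) C" shows "\<exists>Q. pi0 T (1 + a) Q \<and> C = S a \<inter> Q"
proof -
  obtain V where V: "sigma0 T (1 + a) V" "S a - C = S a \<inter> V"
    using tau_open_borel[of a "S a - C"] assms by (auto simp: closedin_def)
  then have "C = S a \<inter> (topspace T - V)"
    using closedin_subset[OF assms] S_carrier by auto
  with V(1) show ?thesis by (blast intro: pi0_complement)
qed

text \<open>"For all r there is n" becomes a countable intersection of sets \<open>R g m\<close>,
  each a countable union of sets of class \<open>pi0\<close> at 1 + g. Such a union has class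
  \<open>sigma0\<close> one step higher and \<open>pi0\<close> two steps higher, whence the bound on
  b.\<close>

lemma S_borel:
  assumes b: "1 \<le> b" "\<And>g. g < a \<Longrightarrow> 1 + g + 1 + 1 \<le> b" shows "pi0 T b (S a)"
proof -
  obtain D where D: "countable D" "D \<subseteq> N" "\<And>n r. n \<in> N \<Longrightarrow> 0 < r \<Longrightarrow> \<exists>z\<in>D. inv z \<otimes> n \<in> P r"
    by (rule dense_sequence) (rule that)
  have "\<exists>Q. pi0 T (1 + g) Q \<and> (\<lambda>y. z \<otimes> y) ` core g q = S g \<inter> Q" if "z \<in> D" for z g q
  proof -
    have "z \<in> S g" using that D(2) N_subset_S by blast
    from tau_closed_borel[OF closedin_core_left[OF this]] show ?thesis .
  qed
  then obtain Q where Q: "\<And>z g q. z \<in> D \<Longrightarrow> pi0 T (1 + g) (Q z g q)"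
      "\<And>z g q. z \<in> D \<Longrightarrow> (\<lambda>y. z \<otimes> y) ` core g q = S g \<inter> Q z g q"
    by metis
  define q where "q m = inverse (real (Suc m))" for m
  define R where "R g m = (\<Union>z\<in>D. Q z g (q m))" for g m
  have R: "pi0 T b (R g m)" if g: "g < a" for g m
  proof -
    have "sigma0 T (1 + g + 1) (R g m)"
      unfolding R_def using D(1) Q(1) ordinal_less_succ[of "1 + g"]
      by (intro sigma0_UN) (auto intro: pi0_imp_sigma0 order_trans[OF ordinal_one_plus_ge] less_imp_le)
    then have "pi0 T (1 + g + 1 + 1) (R g m)" using ordinal_less_succ by (rule sigma0_imp_pi0)
    then show ?thesis using b(2)[OF g] by (rule pi0_mono[OF metrizable_T])
  qed
  have cl: "pi0 T b (T closure_of N)"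
    using pi0_mono[OF metrizable_T _ b(1)] by (simp add: pi0_one)
  have "S a = T closure_of N \<inter> (\<Inter>i\<in>{..<a} \<times> UNIV. R (fst i) (snd i))" (is "_ = ?I")
  proof
    show "S a \<subseteq> ?I"
    proof
      fix x assume x: "x \<in> S a"
      have "x \<in> R g m" if g: "g < a" for g m
      proof -
        have "0 < q m" by (simp add: q_def)
        then obtain z where z: "z \<in> D" "inv z \<otimes> x \<in> core g (q m)" using near_dense[OF D(2,3) x g] by blast
        then have "x \<in> (\<lambda>y. z \<otimes> y) ` core g (q m)"
          using x D(2) N_carrier S_carrier by (intro image_eqI[OF _ z(2)]) (auto simp: cancel_left subset_iff)
        then show ?thesis unfolding R_def using z(1) Q(2)[OF z(1)] by blast
      qed
      then show "x \<in> ?I" using x by (auto simp: S_iff)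
    qed
    show "?I \<subseteq> S a"
    proof
      fix x assume x: "x \<in> ?I"
      \<comment> \<open>\<open>Q z g q\<close> agrees with the translated core only inside S g, so
        membership in the stages has to be built up by induction on c.\<close>
      have "c \<le> a \<Longrightarrow> x \<in> S c" for c
      proof (induction c rule: less_induct)
        case (less c)
        show ?case
          unfolding S_iff
        proof (intro conjI allI impI)
          show "x \<in> T closure_of N" using x by blast
          then have xG: "x \<in> carrier G" by (simp add: in_closure_of)
          fix g :: countable_ordinal and r :: real assume g: "g < c" and r: "0 < r"
          have ga: "g < a" using g less.prems by (rule less_le_trans)
          obtain m where m: "q m < r" using reals_Archimedean[OF r] by (auto simp: q_def)
          have "x \<in> R g m" using x ga by auto
          then obtain z where z: "z \<in> D" "x \<in> Q z g (q m)" by (auto simp: R_def)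
          have "x \<in> S g" using less.IH[OF g] ga by simp
          then have "x \<in> (\<lambda>y. z \<otimes> y) ` core g (q m)" using Q(2)[OF z(1)] z(2) by blast
          then obtain y where y: "y \<in> core g (q m)" "x = z \<otimes> y" by blast
          have "inv z \<otimes> x \<in> core g r"
            using y core_mono[of "q m" r g] m core_carrier z(1) D(2) N_carrier
            by (auto simp: cancel_left subset_iff)
          then show "\<exists>n\<in>N. inv n \<otimes> x \<in> core g r" using z(1) D(2) by blast
        qed
      qed
      then show "x \<in> S a" by simp
    qed
  qed
  moreover have "pi0 T b (\<Inter>i\<in>{..<a} \<times> UNIV. R (fst i) (snd i))" if "{..<a} \<noteq> {}"
    using that R countable_lessThan_ordinal by (intro pi0_INT countable_SIGMA) auto
  ultimately show ?thesis
    using cl pi0_Int[OF cl] by (cases "{..<a} = {}") simp_all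
qed

lemma ordinal_succ_mono: "c \<le> d \<Longrightarrow> c + 1 \<le> d + (1 :: countable_ordinal)"
  by (simp add: ordinal_succ_le_iff ordinal_less_plus_one_iff)

lemma S_borel_succ: "pi0 T (1 + a + 1) (S a)"
proof (rule S_borel)
  show "1 \<le> 1 + a + 1" using ordinal_one_plus_ge[of a] ordinal_less_succ[of "1 + a"] by simp
  fix g assume "g < a"
  then have "1 + (g + 1) \<le> 1 + a" by (simp add: ordinal_plus_le_iff ordinal_succ_le_iff)
  then show "1 + g + 1 + 1 \<le> 1 + a + 1" unfolding ordinal_plus_succ by (rule ordinal_succ_mono)
qed

lemma gamma_class_S: "gamma_class T a (S a)"
proof (cases "a = 0 \<or> is_limit a")
  case True
  have "1 + g + 1 + 1 \<le> 1 + a" if g: "g < a" for g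
  proof -
    have "is_limit a" using True g zero_le_ordinal[of g] by auto
    \<comment> \<open>Below a limit the two extra steps of \<open>S_borel\<close> are free, which is
      why the class at a limit is \<open>pi0\<close> at 1 + a itself.\<close>
    then have "g + 1 + 1 < a" using g by (intro ordinal_succ_less_limit)
    then have "1 + (g + 1 + 1) \<le> 1 + a" by (simp add: ordinal_plus_le_iff less_imp_le)
    then show ?thesis by (simp add: ordinal_plus_succ)
  qed
  then show ?thesis using True S_borel[OF ordinal_one_plus_ge, of a a] by (simp add: gamma_class_def)
qed (use S_borel_succ in \<open>simp add: gamma_class_def\<close>)

lemma gamma_class_imp: "gamma_class T a H \<Longrightarrow> pi0 T (1 + a + 1) H"
  using pi0_mono[OF metrizable_T, of "1 + a" H "1 + a + 1"] ordinal_less_succ[of "1 + a"]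
  by (auto simp: gamma_class_def less_imp_le split: if_splits)

theorem phantom_subgroup_eq: "phantom_subgroup G T N a = S a"
  unfolding phantom_subgroup_def
proof (rule Least_equality)
  show "polish_subgroup G T (S a) \<and> N \<subseteq> S a \<and> gamma_class T a (S a)"
    using polish_subgroup_S N_subset_S gamma_class_S by blast
  show "S a \<subseteq> H" if "polish_subgroup G T H \<and> N \<subseteq> H \<and> gamma_class T a H" for H
    using that S_least gamma_class_imp by (auto simp: polish_subgroup_def)
qed

subsection \<open>The phantom length exists\<close>

lemma p_open_mapping_hom: "top_group_hom K X (G\<lparr>carrier := S a\<rparr>) (tau a) p"
proof -
  interpret KX: top_group K X by (rule top_group_K)
  interpret Sa: top_group "G\<lparr>carrier := S a\<rparr>" "tau a" by (rule top_group_S)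
  show ?thesis
  proof unfold_locales
    show "p \<in> hom K (G\<lparr>carrier := S a\<rparr>)"
      using N_subset_S[of a] by (auto simp: hom_def N_def)
    show "completely_metrizable_space X" "second_countable X" "completely_metrizable_space (tau a)"
      by (fact complete_X second_countable_X completely_metrizable_tau)+
    fix x y assume x: "x \<in> carrier K" and y: "y \<in> carrier (G\<lparr>carrier := S a\<rparr>)" and ne: "p x \<noteq> y"
    have "Hausdorff_space (tau a)"
      using completely_metrizable_imp_metrizable_space[OF completely_metrizable_tau]
      by (rule metrizable_imp_Hausdorff_space)
    moreover have "p x \<in> S a" using x N_subset_S[of a] by (auto simp: N_def)
    ultimately obtain A B where AB: "openin (tau a) A" "openin (tau a) B" "p x \<in> A" "y \<in> B" "disjnt A B"
      unfolding Hausdorff_space_def using y ne by simp meson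
    have "openin X {z \<in> carrier K. p z \<in> A}"
      using openin_continuous_map_preimage[OF continuous_map_p_tau AB(1)] by simp
    moreover have "p ` {z \<in> carrier K. p z \<in> A} \<inter> B = {}" using AB(5) by (auto simp: disjnt_def)
    ultimately show "\<exists>U V. openin X U \<and> x \<in> U \<and> openin (tau a) V \<and> y \<in> V \<and> p ` U \<inter> V = {}"
      using AB x by (intro exI[of _ "{z \<in> carrier K. p z \<in> A}"] exI[of _ B]) simp
  qed
qed

text \<open>The hypothesis says that p is almost open into S a. Hence it is open, and N contains a
  \<open>tau a\<close> neighbourhood of the identity; a dense subgroup with interior is the whole
  group.\<close>

lemma S_eq_N_if_core_nbhds:
  assumes "\<And>r. 0 < r \<Longrightarrow> \<exists>U. openin (tau a) U \<and> \<one> \<in> U \<and> U \<subseteq> core a r"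
  shows "S a = N"
proof -
  interpret Sa: top_group "G\<lparr>carrier := S a\<rparr>" "tau a" by (rule top_group_S)
  have "\<exists>U. openin (tau a) U \<and> \<one>\<^bsub>G\<lparr>carrier := S a\<rparr>\<^esub> \<in> U \<and> U \<subseteq> p ` carrier K"
  proof (rule top_group_hom.open_mapping_almost_open[OF p_open_mapping_hom])
    fix V assume V: "openin X V" "\<one>\<^bsub>K\<^esub> \<in> V"
    then obtain r where r: "0 < r" "{k \<in> carrier K. dist \<one>\<^bsub>K\<^esub> k < r} \<subseteq> V"
      unfolding openin_X_iff by meson
    then have "core a r \<subseteq> tau a closure_of (p ` V)"
      unfolding core_eq P_def by (intro closure_of_mono image_mono)
    with assms[OF r(1)] show "\<one>\<^bsub>G\<lparr>carrier := S a\<rparr>\<^esub> \<in> tau a interior_of (tau a closure_of (p ` V))"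
      unfolding interior_of_def by auto
  qed auto
  then obtain U where U: "openin (tau a) U" "\<one> \<in> U" "U \<subseteq> N" by (auto simp: N_def)
  have "S a \<subseteq> N"
  proof
    fix x assume x: "x \<in> S a"
    have xG: "x \<in> carrier G" using x S_carrier by blast
    have "openin (tau a) ((\<lambda>y. x \<otimes> y) ` U)" using Sa.openin_left_image[of x U] x U(1) by simp
    moreover have "x \<in> (\<lambda>y. x \<otimes> y) ` U" by (rule image_eqI[OF _ U(2)]) (use xG in simp)
    moreover have "x \<in> tau a closure_of N" using x dense_N by simp
    ultimately obtain n where n: "n \<in> N" "n \<in> (\<lambda>y. x \<otimes> y) ` U" unfolding in_closure_of by meson
    then obtain u where u: "u \<in> N" "n = x \<otimes> u" using U(3) by blast
    then have "x = n \<otimes> inv u" using xG N_carrier by (auto simp: m_assoc subset_iff)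
    then show "x \<in> N" using n u N_mult N_inv by blast
  qed
  with N_subset_S show ?thesis by blast
qed

lemma core_nbhd_succ:
  assumes "b < a" "0 < r" obtains U where "openin (tau a) U" "\<one> \<in> U" "U \<subseteq> core b r"
proof -
  have "(carrier G, r, {b}) \<in> index a \<one>"
    using assms openin_topspace[of T] by (simp add: index_iff)
  from nb_open[OF S_closed(3) this] obtain U where "openin (tau a) U" "\<one> \<in> U" "U \<subseteq> nb a \<one> (carrier G, r, {b})"
    by blast
  then show thesis using S_carrier by (intro that[of U]) (auto simp: nb_iff subset_iff)
qed

text \<open>\<open>R a\<close> records which of countably many basic sets \<open>Bl d m\<close> of N
  miss which \<open>core a (q j)\<close>. It grows with a, so it agrees at some a and a + 1. Since
  the complement of a core pulls back to an open subset of K, equal records put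
  \<open>core a (q j) \<inter> N\<close> inside \<open>core (a + 1) (q j)\<close>. The former core
  is a neighbourhood at stage a + 1 and N is dense there, so the latter cores are neighbourhoods
  too.\<close>

lemma S_reaches_N: "\<exists>a. S a = N"
proof -
  obtain D where D: "countable D" "D \<subseteq> carrier K" "X closure_of D = carrier K"
    using separable_K by (auto simp: separable_space_def)
  define q where "q m = inverse (real (Suc m))" for m
  define Bl where "Bl d m = p ` {k \<in> carrier K. dist d k < q m}" for d m
  define R where "R a = {(d, m, j). d \<in> D \<and> Bl d m \<inter> core a (q j) = {}}" for a
  have "\<exists>a. R (a + 1) = R a"
  proof (rule increasing_subsets_stabilize)
    show "R a \<subseteq> R b" if "a \<le> b" for a b
      using core_antimono[OF that] by (auto simp: R_def)
    show "countable (D \<times> (UNIV :: nat set) \<times> (UNIV :: nat set))"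
      using D(1) by (intro countable_SIGMA) auto
    show "R a \<subseteq> D \<times> UNIV \<times> UNIV" for a by (auto simp: R_def)
  qed
  then obtain a where a: "R (a + 1) = R a" by blast
  let ?s = "a + 1"
  have as: "a < ?s" by (rule ordinal_less_succ)
  have sub: "core a (q j) \<inter> N \<subseteq> core ?s (q j)" for j
  proof (rule subsetI, rule ccontr)
    fix n assume n: "n \<in> core a (q j) \<inter> N" "n \<notin> core ?s (q j)"
    then obtain k where k: "k \<in> carrier K" "n = p k" by (auto simp: N_def)
    have "openin (tau ?s) (S ?s - core ?s (q j))"
      unfolding core_eq using closedin_closure_of[of "tau ?s"] by (metis closedin_def topspace_tau)
    from openin_continuous_map_preimage[OF continuous_map_p_tau this]
    have "openin X {h \<in> carrier K. p h \<in> S ?s - core ?s (q j)}" by simp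
    moreover have "k \<in> {h \<in> carrier K. p h \<in> S ?s - core ?s (q j)}"
      using k n N_subset_S[of ?s] by auto
    ultimately obtain e where e: "e > 0" "{h \<in> carrier K. dist k h < e} \<subseteq> {h \<in> carrier K. p h \<in> S ?s - core ?s (q j)}"
      unfolding openin_X_iff by meson
    obtain m where m: "q m < e / 2" using reals_Archimedean[of "e / 2"] e(1) by (auto simp: q_def)
    have qm: "0 < q m" by (simp add: q_def)
    have "k \<in> X closure_of D" using D(3) k by simp
    moreover have "openin X {h \<in> carrier K. dist k h < q m}" by (rule openin_X_ball)
    moreover have "k \<in> {h \<in> carrier K. dist k h < q m}" using k qm by simp
    ultimately obtain d where d: "d \<in> D" "d \<in> carrier K" "dist k d < q m"
      unfolding in_closure_of by (metis (mono_tags, lifting) mem_Collect_eq)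
    have "Bl d m \<inter> core ?s (q j) = {}"
    proof -
      have "dist k h < e" if "dist d h < q m" for h
        using dist_triangle[of k h d] that d(3) m by simp
      then show ?thesis using e(2) by (auto simp: Bl_def)
    qed
    then have "(d, m, j) \<in> R ?s" using d by (simp add: R_def)
    then have "Bl d m \<inter> core a (q j) = {}" unfolding a by (simp add: R_def)
    moreover have "n \<in> Bl d m" unfolding Bl_def using k d by (intro image_eqI[of _ _ k]) (auto simp: dist_commute)
    ultimately show False using n by blast
  qed
  have "S ?s = N"
  proof (rule S_eq_N_if_core_nbhds)
    fix r :: real assume "0 < r"
    then obtain j where j: "q j < r" using reals_Archimedean by (auto simp: q_def)
    have "0 < q j" by (simp add: q_def)
    from core_nbhd_succ[OF as this] obtain U where U: "openin (tau ?s) U" "\<one> \<in> U" "U \<subseteq> core a (q j)" by blast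
    have "U \<subseteq> tau ?s closure_of (U \<inter> N)"
      using openin_Int_closure_of_subset[OF U(1), of N] openin_subset[OF U(1)] dense_N[of ?s] by auto
    also have "\<dots> \<subseteq> tau ?s closure_of (core ?s (q j))"
      using U(3) sub by (intro closure_of_mono) blast
    also have "\<dots> = core ?s (q j)" unfolding core_eq by simp
    also have "\<dots> \<subseteq> core ?s r" using j by (intro core_mono) simp
    finally show "\<exists>U. openin (tau ?s) U \<and> \<one> \<in> U \<and> U \<subseteq> core ?s r" using U(1,2) by blast
  qed
  then show ?thesis by blast
qed

lemma Sigma2_tau_borel:
  assumes "sigma0 (tau a) (1 + 1) A" shows "\<exists>B. sigma0 T (1 + a + 1) B \<and> A = S a \<inter> B"
proof -
  have "(1 :: countable_ordinal) < 1 + 1" by (rule ordinal_less_succ)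
  then obtain C where C: "A = (\<Union>n :: nat. C n)" "\<And>n. \<exists>b. 1 \<le> b \<and> b < 1 + 1 \<and> pi0 (tau a) b (C n)"
    using sigma0_cases_Union[OF assms] by metis
  have "closedin (tau a) (C n)" for n
    using C(2)[of n] by (auto simp: ordinal_less_plus_one_iff pi0_one dest: order.antisym)
  from tau_closed_borel[OF this] obtain Q where Q: "\<And>n. pi0 T (1 + a) (Q n)" "\<And>n. C n = S a \<inter> Q n"
    by metis
  have "sigma0 T (1 + a + 1) (\<Union>n. Q n)"
    using Q(1) ordinal_less_succ by (intro sigma0_UN_nat pi0_imp_sigma0)
  moreover have "A = S a \<inter> (\<Union>n. Q n)" unfolding C(1) Q(2) by blast
  ultimately show ?thesis by blast
qed

text \<open>Sets of class 2 for \<open>tau a\<close> are traces of sets of class 1 + a + 1 for T.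
  Hence N has class \<open>pi0\<close> at 1 + (a + 1) + 1, where \<open>S_least\<close> applies to
  stage a + 1. This is the counterpart of \<open>HalfEps a < Whole (a + 1)\<close>.\<close>

lemma difference_imp_next:
  assumes "difference_pi0 (tau a) (1 + 1) N" shows "S (a + 1) = N"
proof -
  obtain B C where BC: "pi0 (tau a) (1 + 1) B" "sigma0 (tau a) (1 + 1) C" "N = B \<inter> C"
    using assms unfolding difference_pi0_def by blast
  obtain B' where B': "sigma0 T (1 + a + 1) B'" "S a - B = S a \<inter> B'"
    using Sigma2_tau_borel[of a "S a - B"] BC(1) by (auto simp: pi0_iff)
  obtain C' where C': "sigma0 T (1 + a + 1) C'" "C = S a \<inter> C'"
    using Sigma2_tau_borel[OF BC(2)] by blast
  have "B \<subseteq> S a" using BC(1) by (auto simp: pi0_iff)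
  then have B_eq: "B = S a \<inter> (topspace T - B')" using B'(2) S_carrier by auto
  have less: "1 + a + 1 < 1 + a + 1 + 1" by (rule ordinal_less_succ)
  note mono = pi0_mono[OF metrizable_T _ less_imp_le[OF less]]
  have "pi0 T (1 + a + 1 + 1) ((S a \<inter> (topspace T - B')) \<inter> (S a \<inter> C'))"
    using mono[OF S_borel_succ] mono[OF pi0_complement[OF B'(1)]] sigma0_imp_pi0[OF C'(1) less]
    by (intro pi0_Int)
  then have "pi0 T (1 + (a + 1) + 1) N"
    unfolding ordinal_plus_succ[of 1 a] BC(3) C'(2) using B_eq by simp
  then have "S (a + 1) \<subseteq> N" by (intro S_least subgroup_N) auto
  with N_subset_S show ?thesis by blast
qed

definition is_length :: "fractional_ordinal \<Rightarrow> bool" where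
  "is_length l \<longleftrightarrow> (\<forall>a. (l \<le> Whole a \<longleftrightarrow> S a = N) \<and> (l \<le> Half a \<longleftrightarrow> sigma0 (tau a) (1 + 1) N) \<and>
     (l \<le> HalfEps a \<longleftrightarrow> difference_pi0 (tau a) (1 + 1) N))"

lemma is_length_unique:
  assumes "is_length l" "is_length l'" shows "l = l'"
proof -
  have "l \<le> x \<longleftrightarrow> l' \<le> x" for x using assms unfolding is_length_def by (cases x) blast+
  then show ?thesis by (meson order.antisym order_refl)
qed

text \<open>Let a0 be the least stage where the weakest of the three conditions holds. All three
  fail below a0 and all hold above it, by \<open>difference_imp_next\<close>; the length is read off
  from the strongest condition that holds at a0.\<close>

lemma ex_length: "\<exists>l. is_length l"
proof -
  have whole_half: "sigma0 (tau a) (1 + 1) N" if "S a = N" for a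
  proof -
    have "metrizable_space (tau a)"
      by (rule completely_metrizable_imp_metrizable_space[OF completely_metrizable_tau])
    moreover have "sigma0 (tau a) 1 N" using openin_topspace[of "tau a"] that by (simp add: sigma0_one)
    ultimately show ?thesis using ordinal_one_plus_ge by (rule sigma0_mono)
  qed
  have half_eps: "difference_pi0 (tau a) (1 + 1) N" if "sigma0 (tau a) (1 + 1) N" for a
  proof -
    have "metrizable_space (tau a)"
      by (rule completely_metrizable_imp_metrizable_space[OF completely_metrizable_tau])
    moreover have "pi0 (tau a) 1 (S a)" using closedin_topspace[of "tau a"] by (simp add: pi0_one)
    ultimately have "pi0 (tau a) (1 + 1) (S a)" using ordinal_one_plus_ge by (rule pi0_mono)
    moreover have "N = S a \<inter> N" using N_subset_S[of a] by blast
    ultimately show ?thesis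
      unfolding difference_pi0_def using that by (intro exI[of _ "S a"] exI[of _ N]) simp
  qed
  have mono: "S b = N" if "S a = N" "a \<le> b" for a b
    using that S_antimono[OF that(2)] N_subset_S[of b] by blast
  define a0 where "a0 = (LEAST a. difference_pi0 (tau a) (1 + 1) N)"
  have ex: "difference_pi0 (tau a0) (1 + 1) N"
    unfolding a0_def using S_reaches_N whole_half half_eps by (metis LeastI)
  have below: "\<not> difference_pi0 (tau a) (1 + 1) N" if "a < a0" for a
    using that unfolding a0_def by (rule not_less_Least)
  have above: "S a = N" if "a0 < a" for a
    using mono[OF difference_imp_next[OF ex]] that by (simp add: ordinal_succ_le_iff)
  define l where "l = (if S a0 = N then Whole a0 else if sigma0 (tau a0) (1 + 1) N then Half a0 else HalfEps a0)"
  have "(l \<le> Whole a \<longleftrightarrow> S a = N) \<and> (l \<le> Half a \<longleftrightarrow> sigma0 (tau a) (1 + 1) N) \<and>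
     (l \<le> HalfEps a \<longleftrightarrow> difference_pi0 (tau a) (1 + 1) N)" for a
  proof (cases a a0 rule: linorder_cases)
    case less
    then show ?thesis
      using below[OF less] whole_half half_eps by (auto simp: l_def less_eq_fractional_ordinal_def)
  next
    case equal
    then show ?thesis
      using ex whole_half half_eps by (auto simp: l_def less_eq_fractional_ordinal_def)
  next
    case greater
    then show ?thesis
      using above[OF greater] whole_half half_eps by (auto simp: l_def less_eq_fractional_ordinal_def)
  qed
  then show ?thesis unfolding is_length_def by blast
qed

lemma phantom_length_is_length: "is_length (phantom_length G T N)"
proof -
  have "phantom_length G T N = (THE l. is_length l)"
    unfolding phantom_length_def is_length_def phantom_subgroup_eq polish_topology_of_S Let_def ..
  then show ?thesis using theI'[of is_length] ex_length is_length_unique by metis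
qed

lemma phantom_length_le_Whole: "phantom_length G T N \<le> Whole a \<longleftrightarrow> S a = N"
  using phantom_length_is_length unfolding is_length_def by blast

end

subsection \<open>Limit lengths are excluded\<close>

text \<open>The restriction to \<open>P e\<close> selects the square roots near the identity: an
  element of order two, for instance, has its square in every \<open>P s\<close>. The factor 2/3
  fits the estimate in \<open>doubling_automorphisms\<close>.\<close>

locale doubling_polish_cover = polish_cover +
  assumes doubling: "\<exists>e>0. \<forall>x\<in>P e. \<forall>s. 0 < s \<longrightarrow> s \<le> e \<longrightarrow> x \<otimes> x \<in> P s \<longrightarrow> x \<in> P (2 * s / 3)"
begin

text \<open>
  By the doubling property the squaring map contracts a neighbourhood \<open>V\<close> of the identity with
  \<open>V \<inter> N \<subseteq> P e\<close> to arbitrarily small \<open>P r\<close>; so \<open>tau b\<close> induces on \<open>N\<close> its own topology.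
\<close>

lemma S_eq_N_if_nbhd:
  assumes e: "0 < e" "\<And>x s. x \<in> P e \<Longrightarrow> 0 < s \<Longrightarrow> s \<le> e \<Longrightarrow> x \<otimes> x \<in> P s \<Longrightarrow> x \<in> P (2 * s / 3)"
    and V: "openin (tau b) V" "\<one> \<in> V" "V \<inter> N \<subseteq> P e"
  shows "S b = N"
proof (rule S_eq_N_if_core_nbhds)
  interpret Sb: top_group "G\<lparr>carrier := S b\<rparr>" "tau b" by (rule top_group_S)
  have step: "\<exists>U. openin (tau b) U \<and> \<one> \<in> U \<and> U \<inter> N \<subseteq> P ((2 / 3) ^ k * e)" for k
  proof (induction k)
    case 0
    then show ?case using V by auto
  next
    case (Suc k)
    then obtain U where U: "openin (tau b) U" "\<one> \<in> U" "U \<inter> N \<subseteq> P ((2 / 3) ^ k * e)" by blast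
    \<comment> \<open>Intersecting with V at every step keeps x itself in \<open>P e\<close>, which
      the doubling property asks for besides the bound on the square.\<close>
    define W where "W = {x \<in> topspace (tau b). x \<otimes> x \<in> U} \<inter> V"
    have "continuous_map (tau b) (tau b) (\<lambda>x. x \<otimes> x)"
      using Sb.continuous_map_mult[of "tau b" "\<lambda>x. x" "\<lambda>x. x"] by simp
    then have "openin (tau b) W"
      unfolding W_def using U(1) V(1) by (intro openin_Int openin_continuous_map_preimage)
    moreover have "\<one> \<in> W" using U(2) V(2) S_closed(3) by (simp add: W_def)
    moreover have "W \<inter> N \<subseteq> P ((2 / 3) ^ Suc k * e)"
    proof
      fix x assume x: "x \<in> W \<inter> N"
      then have "x \<otimes> x \<in> P ((2 / 3) ^ k * e)" using U(3) N_mult by (auto simp: W_def)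
      moreover have "x \<in> P e" using x V(3) by (auto simp: W_def)
      moreover have "(2 / 3) ^ k * e \<le> e" using e(1) power_le_one[of "2 / 3 :: real" k] by simp
      ultimately show "x \<in> P ((2 / 3) ^ Suc k * e)"
        using e(2)[of x "(2 / 3) ^ k * e"] e(1) by (simp add: mult.assoc)
    qed
    ultimately show ?case by blast
  qed
  fix r :: real assume r: "0 < r"
  obtain k where k: "(2 / 3) ^ k < r / e"
    using real_arch_pow_inv[of "r / e" "2 / 3"] r e(1) by auto
  then have "(2 / 3) ^ k * e \<le> r" using e(1) by (simp add: field_simps)
  then obtain U where U: "openin (tau b) U" "\<one> \<in> U" "U \<inter> N \<subseteq> P r"
    using step[of k] P_mono by (meson order_trans)
  have "U \<subseteq> tau b closure_of (U \<inter> N)"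
    using openin_Int_closure_of_subset[OF U(1), of N] openin_subset[OF U(1)] dense_N[of b] by auto
  also have "\<dots> \<subseteq> core b r" unfolding core_eq using U(3) by (rule closure_of_mono)
  finally show "\<exists>U. openin (tau b) U \<and> \<one> \<in> U \<and> U \<subseteq> core b r" using U(1,2) by blast
qed

lemma limit_stage_not_first:
  assumes a: "is_limit a" "S a = N" shows "\<exists>b<a. S b = N"
proof -
  obtain e where e: "0 < e" "\<And>x s. x \<in> P e \<Longrightarrow> 0 < s \<Longrightarrow> s \<le> e \<Longrightarrow> x \<otimes> x \<in> P s \<Longrightarrow> x \<in> P (2 * s / 3)"
    using doubling by blast
  have "\<exists>U. openin (tau a) U \<and> \<one>\<^bsub>G\<lparr>carrier := S a\<rparr>\<^esub> \<in> U \<and> U \<subseteq> p ` {k \<in> carrier K. dist \<one>\<^bsub>K\<^esub> k < e}"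
    using a(2) e(1) openin_X_ball
    by (intro top_group_hom.open_mapping_surj[OF p_open_mapping_hom]) (auto simp: N_def)
  then obtain U where U: "openin (tau a) U" "\<one> \<in> U" "U \<subseteq> P e" by (auto simp: P_def)
  obtain V r F where i: "(V, r, F) \<in> index a \<one>" "nb a \<one> (V, r, F) \<subseteq> U"
    using U(1,2) unfolding openin_tau by (metis prod_cases3)
  have F: "finite F" "F \<subseteq> {..<a}" "0 < r" "openin T V" "\<one> \<in> V" using i(1) by (auto simp: index_iff)
  \<comment> \<open>Finitely many stages enter the neighbourhood, so a single stage g < a dominates
    them.\<close>
  define g where "g = Max (insert 0 F)"
  have "0 < a" using a(1) zero_le_ordinal[of a] by (auto simp: is_limit_def)
  moreover have "g \<in> insert 0 F" unfolding g_def using F(1) by (intro Max_in) auto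
  ultimately have ga: "g < a" using F(2) by auto
  have gF: "c \<le> g" if "c \<in> F" for c using that F(1) by (auto simp: g_def)
  obtain s where s: "0 < s" "\<And>b. core b s \<subseteq> V" by (rule core_small[OF F(4,5)]) (rule that)
  have "core g (min r s) \<inter> N \<subseteq> nb a \<one> (V, r, F)"
  proof
    fix x assume x: "x \<in> core g (min r s) \<inter> N"
    then have "x \<in> V" using s(2)[of g] core_mono[of "min r s" s g] by auto
    moreover have "x \<in> core c r" if "c \<in> F" for c
      using x core_antimono[OF gF[OF that]] core_mono[of "min r s" r g] by auto
    moreover have "inv \<one> \<otimes> x = x" using x N_carrier by auto
    ultimately show "x \<in> nb a \<one> (V, r, F)" using x a(2) by (simp add: nb_iff)
  qed
  then have "core g (min r s) \<inter> N \<subseteq> P e" using i(2) U(3) by blast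
  moreover have "0 < min r s" using F s by simp
  \<comment> \<open>A core of stage g is known to be a neighbourhood of the identity at stage g + 1;
    only for a limit is this still below a.\<close>
  from core_nbhd_succ[OF ordinal_less_succ this]
  obtain W where "openin (tau (g + 1)) W" "\<one> \<in> W" "W \<subseteq> core g (min r s)" by blast
  ultimately have "S (g + 1) = N" using e by (intro S_eq_N_if_nbhd[of e "g + 1" W]) auto
  moreover have "g + 1 < a" using a(1) ga by (rule ordinal_succ_less_limit)
  ultimately show ?thesis by blast
qed

theorem phantom_length_not_limit: "\<not> is_limit_ordinal (phantom_length G T N)"
proof
  assume "is_limit_ordinal (phantom_length G T N)"
  then obtain a where a: "phantom_length G T N = Whole a" "is_limit a"
    by (auto simp: is_limit_ordinal_def)
  then have "S a = N" using phantom_length_le_Whole[of a] by simp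
  then obtain b where b: "b < a" "S b = N" using limit_stage_not_first[OF a(2)] by blast
  then have "Whole a \<le> Whole b" using phantom_length_le_Whole[of b] a(1) by simp
  with b(1) show False by (auto simp: less_eq_fractional_ordinal_def)
qed

end

section \<open>Unital C*-algebras\<close>

lemma scaleC_one: "1 *\<^sub>C x = (x :: 'a :: unital_cstar_algebra)"
  using scaleC_of_real[of 1 x] by simp

lemma scaleC_zero: "c *\<^sub>C 0 = (0 :: 'a :: unital_cstar_algebra)"
  using scaleC_add_right[of c 0 "0 :: 'a"] by simp

lemma scaleC_minus: "c *\<^sub>C (- x) = - (c *\<^sub>C x :: 'a :: unital_cstar_algebra)"
  using scaleC_add_right[of c x "- x"] by (simp add: scaleC_zero eq_neg_iff_add_eq_0 add.commute)

lemma scaleC_minus_left: "(- c) *\<^sub>C x = - (c *\<^sub>C x :: 'a :: unital_cstar_algebra)"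
  using scaleC_scaleC[of c "- 1" x] scaleC_of_real[of "- 1" x] by (simp add: scaleC_minus)

lemma scaleC_diff: "c *\<^sub>C (x - y) = c *\<^sub>C x - (c *\<^sub>C y :: 'a :: unital_cstar_algebra)"
  using scaleC_add_right[of c x "- y"] by (simp add: scaleC_minus)

lemma star_scaleR: "star (r *\<^sub>R x) = r *\<^sub>R star (x :: 'a :: unital_cstar_algebra)"
  using star_scaleC[of "complex_of_real r" x] by (simp add: scaleC_of_real)

lemma star_zero: "star 0 = (0 :: 'a :: unital_cstar_algebra)"
  using star_scaleR[of 0 "0 :: 'a"] by simp

lemma star_minus: "star (- x) = - star (x :: 'a :: unital_cstar_algebra)"
  using star_scaleR[of "- 1" x] by simp

lemma star_diff: "star (x - y) = star x - star (y :: 'a :: unital_cstar_algebra)"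
  using star_add[of x "- y"] by (simp add: star_minus)

lemma star_one: "star 1 = (1 :: 'a :: unital_cstar_algebra)"
  by (metis mult_1_left mult_1_right star_mult star_star)

lemma norm_star: "norm (star x) = norm (x :: 'a :: unital_cstar_algebra)"
proof -
  have *: "norm y \<le> norm (star y)" for y :: 'a
  proof (cases "y = 0")
    case False
    have "norm y * norm y = norm (star y * y)" by (simp add: cstar_identity power2_eq_square)
    also have "\<dots> \<le> norm (star y) * norm y" by (rule norm_mult_ineq)
    finally show ?thesis using False by simp
  qed simp
  show ?thesis using *[of x] *[of "star x"] by (simp add: star_star)
qed

lemma bounded_linear_star: "bounded_linear (star :: 'a :: unital_cstar_algebra \<Rightarrow> 'a)"
  by (rule bounded_linear_intro[of _ 1]) (simp_all add: star_add star_scaleR norm_star)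

lemma continuous_on_star [continuous_intros]:
  "continuous_on A f \<Longrightarrow> continuous_on A (\<lambda>x. star (f x :: 'a :: unital_cstar_algebra))"
  by (rule bounded_linear.continuous_on[OF bounded_linear_star])

lemma bounded_linear_scaleC: "bounded_linear (\<lambda>x :: 'a :: unital_cstar_algebra. c *\<^sub>C x)"
proof (rule bounded_linear_intro[of _ "cmod c"])
  fix r and x :: 'a
  show "c *\<^sub>C (r *\<^sub>R x) = r *\<^sub>R c *\<^sub>C x"
    by (simp add: scaleC_of_real[symmetric] scaleC_scaleC mult.commute)
qed (simp_all add: scaleC_add_right norm_scaleC)

lemma continuous_on_scaleC [continuous_intros]:
  "continuous_on A f \<Longrightarrow> continuous_on A (\<lambda>x. c *\<^sub>C (f x :: 'a :: unital_cstar_algebra))"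
  by (rule bounded_linear.continuous_on[OF bounded_linear_scaleC])

lemma separable_space_top_of_set:
  assumes "separable_space (euclidean :: 'a :: metric_space topology)"
  shows "separable_space (top_of_set (A :: 'a set))"
  using separable_metrizable_imp_second_countable[OF assms metrizable_space_euclidean]
  by (intro second_countable_imp_separable_space second_countable_subtopology)

section \<open>Derivations\<close>

text \<open>Self-adjoint elements carry their own norm here. As \<open>ad\<close> has the central
  elements as kernel, the image of the ball of radius r is the open ball of the quotient norm on the
  inner derivations.\<close>

definition selfadjoint_group :: "'a :: unital_cstar_algebra monoid" where
  "selfadjoint_group = \<lparr>carrier = {h. star h = h}, mult = (+), one = 0\<rparr>"

definition inner_blinfun :: "'a :: unital_cstar_algebra \<Rightarrow> 'a \<Rightarrow>\<^sub>L 'a" where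
  "inner_blinfun h = Blinfun (ad (\<i> *\<^sub>C h))"

lemma norm_ad_le: "norm (ad x y) \<le> 2 * norm x * norm (y :: 'a :: unital_cstar_algebra)"
proof -
  have "norm (ad x y) \<le> norm (x * y) + norm (y * x)" unfolding ad_def by (rule norm_triangle_ineq4)
  also have "\<dots> \<le> norm x * norm y + norm y * norm x" by (intro add_mono norm_mult_ineq)
  finally show ?thesis by (simp add: mult_ac)
qed

lemma bounded_linear_ad: "bounded_linear (ad x :: 'a :: unital_cstar_algebra \<Rightarrow> 'a)"
  by (rule bounded_linear_intro[of _ "2 * norm x"])
    (use norm_ad_le[of x] in \<open>auto simp: ad_def algebra_simps\<close>)

lemma inner_blinfun_apply: "blinfun_apply (inner_blinfun h) = ad (\<i> *\<^sub>C h)"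
  unfolding inner_blinfun_def by (rule bounded_linear_Blinfun_apply[OF bounded_linear_ad])

lemma inner_blinfun_add: "inner_blinfun (h + k) = inner_blinfun h + inner_blinfun k"
  by (rule blinfun_eqI) (simp add: inner_blinfun_apply blinfun.add_left ad_def scaleC_add_right algebra_simps)

lemma norm_inner_blinfun: "norm (inner_blinfun h) \<le> 2 * norm h"
  by (rule norm_blinfun_bound) (use norm_ad_le[of "\<i> *\<^sub>C h"] in \<open>auto simp: inner_blinfun_apply norm_scaleC\<close>)

lemma inn_space_eq: "inn_space = inner_blinfun ` carrier selfadjoint_group"
  by (auto simp: inn_space_def inner_derivation_def selfadjoint_group_def inner_blinfun_apply image_iff
      simp flip: blinfun_apply_inject)

lemma star_derivation_inner: "star h = h \<Longrightarrow> star_derivation (ad (\<i> *\<^sub>C h))"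
  unfolding star_derivation_def clinear_map_def
  by (auto simp: ad_def algebra_simps scaleC_diff mult_scaleC_left mult_scaleC_right scaleC_scaleC
      star_diff star_mult star_scaleC mult.commute)
     (simp_all add: scaleC_minus_left scaleC_add_right)

lemma inn_subset_aut: "inn_space \<subseteq> aut_space"
  by (auto simp: inn_space_def aut_space_def inner_derivation_def star_derivation_inner)

lemma closed_aut_space: "closed (aut_space :: ('a :: unital_cstar_algebra \<Rightarrow>\<^sub>L 'a) set)"
  unfolding aut_space_def star_derivation_def clinear_map_def
  by (intro closed_Collect_conj closed_Collect_all closed_Collect_imp closed_Collect_eq
      open_Collect_const continuous_intros)

text \<open>The derivations are closed among the bounded operators, so the closure may be taken
  there, and it is complete.\<close>

lemma ph1_aut_eq: "ph1_aut = closure (inn_space :: ('a :: unital_cstar_algebra \<Rightarrow>\<^sub>L 'a) set)"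
proof -
  have "closure (inn_space :: ('a \<Rightarrow>\<^sub>L 'a) set) \<subseteq> aut_space"
    by (rule closure_minimal[OF inn_subset_aut closed_aut_space])
  moreover have "aut_space \<inter> inn_space = (inn_space :: ('a \<Rightarrow>\<^sub>L 'a) set)"
    using inn_subset_aut by blast
  ultimately show ?thesis
    unfolding ph1_aut_def closure_of_subtopology by auto
qed

lemma subspace_closure:
  fixes A :: "'a :: real_normed_vector set"
  assumes "subspace A" shows "subspace (closure A)"
proof (rule subspaceI)
  show "0 \<in> closure A" using closure_subset subspace_0[OF assms] by blast
  show "x + y \<in> closure A" if xy: "x \<in> closure A" "y \<in> closure A" for x y
  proof -
    obtain f g where "\<forall>n. f n \<in> A" "f \<longlonglongrightarrow> x" "\<forall>n. g n \<in> A" "g \<longlonglongrightarrow> y"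
      using xy unfolding closure_sequential by blast
    then show ?thesis
      unfolding closure_sequential using assms
      by (intro exI[of _ "\<lambda>n. f n + g n"]) (auto intro: tendsto_add subspace_add)
  qed
  show "c *\<^sub>R x \<in> closure A" if "x \<in> closure A" for c x
  proof -
    have "c *\<^sub>R x \<in> closure ((*\<^sub>R) c ` A)" using that unfolding closure_scaleR[symmetric] by blast
    moreover have "(*\<^sub>R) c ` A \<subseteq> A" using assms by (auto intro: subspace_scale)
    ultimately show ?thesis using closure_mono by blast
  qed
qed

lemma selfadjoint_group_simps [simp]:
  "carrier selfadjoint_group = {h. star h = h}" "mult selfadjoint_group = (+)" "one selfadjoint_group = 0"
  by (simp_all add: selfadjoint_group_def)

lemma group_selfadjoint: "group (selfadjoint_group :: 'a :: unital_cstar_algebra monoid)"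
proof (rule groupI)
  show "\<exists>y\<in>carrier selfadjoint_group. y \<otimes>\<^bsub>selfadjoint_group\<^esub> x = \<one>\<^bsub>selfadjoint_group\<^esub>"
    if "x \<in> carrier selfadjoint_group" for x :: 'a
    using that by (intro bexI[of _ "- x"]) (auto simp: star_minus)
qed (auto simp: star_add star_zero add.assoc)

lemma ph1_aut_group_simps [simp]:
  "carrier ph1_aut_group = ph1_aut" "mult ph1_aut_group = (+)" "one ph1_aut_group = 0"
  by (simp_all add: ph1_aut_group_def)

lemma subspace_inn: "subspace (inn_space :: ('a :: unital_cstar_algebra \<Rightarrow>\<^sub>L 'a) set)"
proof -
  have "inner_blinfun (r *\<^sub>R h) = r *\<^sub>R inner_blinfun h" for r and h :: 'a
  proof (rule blinfun_eqI)
    fix x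
    have "\<i> *\<^sub>C (r *\<^sub>R h) = r *\<^sub>R \<i> *\<^sub>C h"
      by (simp add: linear_simps(5)[OF bounded_linear_scaleC])
    then show "blinfun_apply (inner_blinfun (r *\<^sub>R h)) x = blinfun_apply (r *\<^sub>R inner_blinfun h) x"
      by (simp add: inner_blinfun_apply blinfun.scaleR_left ad_def algebra_simps)
  qed
  then have "linear (inner_blinfun :: 'a \<Rightarrow> _)"
    by (intro linearI) (simp_all add: inner_blinfun_add)
  moreover have "subspace {h :: 'a. star h = h}"
    by (auto simp: subspace_def star_zero star_add star_scaleR)
  ultimately show ?thesis
    unfolding inn_space_eq by (simp add: linear_subspace_image)
qed

lemma subspace_ph1_aut: "subspace (ph1_aut :: ('a :: unital_cstar_algebra \<Rightarrow>\<^sub>L 'a) set)"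
  unfolding ph1_aut_eq by (rule subspace_closure[OF subspace_inn])

lemma group_ph1_aut: "group (ph1_aut_group :: ('a :: unital_cstar_algebra \<Rightarrow>\<^sub>L 'a) monoid)"
proof (rule groupI)
  show "\<exists>y\<in>carrier ph1_aut_group. y \<otimes>\<^bsub>ph1_aut_group\<^esub> x = \<one>\<^bsub>ph1_aut_group\<^esub>"
    if "x \<in> carrier ph1_aut_group" for x :: "'a \<Rightarrow>\<^sub>L 'a"
    using that subspace_neg[OF subspace_ph1_aut] by (intro bexI[of _ "- x"]) auto
qed (auto simp: add.assoc intro: subspace_add[OF subspace_ph1_aut] subspace_0[OF subspace_ph1_aut])

lemma inv_ph1_aut: "x \<in> ph1_aut \<Longrightarrow> inv\<^bsub>ph1_aut_group\<^esub> x = - (x :: 'a :: unital_cstar_algebra \<Rightarrow>\<^sub>L 'a)"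
  using subspace_neg[OF subspace_ph1_aut] by (intro group.inv_equality[OF group_ph1_aut]) auto

lemma topological_group_ph1_aut:
  "topological_group ph1_aut_group (top_of_set (ph1_aut :: ('a :: unital_cstar_algebra \<Rightarrow>\<^sub>L 'a) set))"
  unfolding topological_group_def
proof (intro conjI)
  let ?A = "ph1_aut :: ('a \<Rightarrow>\<^sub>L 'a) set"
  have "prod_topology (top_of_set ?A) (top_of_set ?A) = top_of_set (?A \<times> ?A)"
    by (simp add: subtopology_Times)
  then show "continuous_map (prod_topology (top_of_set ?A) (top_of_set ?A)) (top_of_set ?A)
      (\<lambda>(x, y). x \<otimes>\<^bsub>ph1_aut_group\<^esub> y)"
    by (auto simp: case_prod_unfold intro!: continuous_intros subspace_add[OF subspace_ph1_aut])
  have "continuous_map (top_of_set ?A) (top_of_set ?A) uminus"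
    by (auto intro!: continuous_intros subspace_neg[OF subspace_ph1_aut])
  then show "continuous_map (top_of_set ?A) (top_of_set ?A) (m_inv ph1_aut_group)"
    by (rule continuous_map_eq) (simp add: inv_ph1_aut)
qed (simp_all add: group_ph1_aut)

section \<open>Derivations as a Polish cover with halving\<close>

lemma polish_cover_derivations:
  assumes sep: "separable_space (euclidean :: 'a :: unital_cstar_algebra topology)"
  shows "polish_cover ph1_aut_group (top_of_set (ph1_aut :: ('a \<Rightarrow>\<^sub>L 'a) set)) selfadjoint_group inner_blinfun"
proof (intro polish_cover.intro top_group.intro polish_cover_axioms.intro)
  show "topological_group ph1_aut_group (top_of_set (ph1_aut :: ('a \<Rightarrow>\<^sub>L 'a) set))"
    by (rule topological_group_ph1_aut)
  show "completely_metrizable_space (top_of_set (ph1_aut :: ('a \<Rightarrow>\<^sub>L 'a) set))"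
    by (rule completely_metrizable_space_closedin[OF completely_metrizable_space_euclidean])
      (simp add: ph1_aut_eq)
  show "group (selfadjoint_group :: 'a monoid)" by (rule group_selfadjoint)
  show "closed (carrier (selfadjoint_group :: 'a monoid))"
    by (auto intro!: closed_Collect_eq continuous_intros)
  show "separable_space (top_of_set (carrier (selfadjoint_group :: 'a monoid)))"
    using sep by (rule separable_space_top_of_set)
  have p_in: "inner_blinfun h \<in> ph1_aut" if "star h = h" for h :: 'a
    using that closure_subset[of inn_space] unfolding ph1_aut_eq inn_space_eq by auto
  then show "inner_blinfun \<in> hom (selfadjoint_group :: 'a monoid) ph1_aut_group"
    by (auto simp: hom_def inner_blinfun_add)
  have "dist (inner_blinfun h) (inner_blinfun k) \<le> 2 * dist h k" for h k :: 'a
  proof -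
    have "inner_blinfun h - inner_blinfun k = inner_blinfun (h - k)"
      using inner_blinfun_add[of "h - k" k] by (simp add: algebra_simps)
    then show ?thesis using norm_inner_blinfun[of "h - k"] by (simp add: dist_norm)
  qed
  then have "2-lipschitz_on {h :: 'a. star h = h} inner_blinfun" by (intro lipschitz_onI) auto
  then show "continuous_map (top_of_set (carrier (selfadjoint_group :: 'a monoid))) (top_of_set ph1_aut) inner_blinfun"
    using p_in by (auto intro: lipschitz_on_continuous_on)
  \<comment> \<open>The group is commutative, so conjugation is trivial and k' = k.\<close>
  show "\<exists>k'\<in>carrier selfadjoint_group. dist \<one>\<^bsub>selfadjoint_group\<^esub> k' \<le> dist \<one>\<^bsub>selfadjoint_group\<^esub> k \<and>
      inner_blinfun k' = g \<otimes>\<^bsub>ph1_aut_group\<^esub> inner_blinfun k \<otimes>\<^bsub>ph1_aut_group\<^esub> inv\<^bsub>ph1_aut_group\<^esub> g"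
    if "g \<in> carrier ph1_aut_group" "k \<in> carrier selfadjoint_group" for g and k :: 'a
    using that by (intro bexI[of _ k]) (auto simp: inv_ph1_aut)
qed auto

text \<open>In a real vector space x + x determines x. If x + x comes from k, then x comes from k /
  2, whose norm is below s / 2; so any positive e will do, and 1 is chosen.\<close>

lemma doubling_derivations:
  assumes sep: "separable_space (euclidean :: 'a :: unital_cstar_algebra topology)"
  shows "doubling_polish_cover ph1_aut_group (top_of_set (ph1_aut :: ('a \<Rightarrow>\<^sub>L 'a) set)) selfadjoint_group inner_blinfun"
proof -
  interpret polish_cover ph1_aut_group "top_of_set (ph1_aut :: ('a \<Rightarrow>\<^sub>L 'a) set)" selfadjoint_group inner_blinfun
    by (rule polish_cover_derivations[OF sep])
  show ?thesis
  proof (unfold_locales, intro exI[of _ 1] conjI ballI allI impI)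
    fix x and s :: real assume s: "0 < s" and x: "x \<otimes>\<^bsub>ph1_aut_group\<^esub> x \<in> P s"
    then obtain k :: 'a where k: "star k = k" "norm k < s" "x + x = inner_blinfun k"
      by (auto simp: P_def dist_norm)
    let ?h = "(1 / 2) *\<^sub>R k"
    have "?h + ?h = k" by (simp flip: scaleR_add_left)
    then have "inner_blinfun ?h + inner_blinfun ?h = x + x"
      using k(3) by (simp flip: inner_blinfun_add)
    then have "2 *\<^sub>R inner_blinfun ?h = 2 *\<^sub>R x" by (simp only: scaleR_2)
    then have "x = inner_blinfun ?h" by simp
    moreover have "norm ?h < 2 * s / 3" using k(2) s by simp
    ultimately show "x \<in> P (2 * s / 3)"
      unfolding P_def using k(1) by (intro image_eqI[of _ _ ?h]) (auto simp: star_scaleR dist_norm)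
  qed simp
qed

lemma derivation_length_not_limit:
  assumes sep: "separable_space (euclidean :: 'a :: unital_cstar_algebra topology)"
  shows "\<not> is_limit_ordinal (derivation_length TYPE('a))"
proof -
  interpret doubling_polish_cover ph1_aut_group "top_of_set (ph1_aut :: ('a \<Rightarrow>\<^sub>L 'a) set)" selfadjoint_group inner_blinfun
    by (rule doubling_derivations[OF sep])
  have "\<not> is_limit_ordinal (phantom_length ph1_aut_group (top_of_set (ph1_aut :: ('a \<Rightarrow>\<^sub>L 'a) set)) inn_space)"
    using phantom_length_not_limit unfolding N_def inn_space_eq .
  moreover have "is_limit_ordinal l" if "is_limit_ordinal (plus_fractional 1 l)" for l
    using that is_limit_one_plus by (cases l) (auto simp: is_limit_ordinal_def)
  moreover have "\<not> is_limit_ordinal (Whole 0)" by (simp add: is_limit_ordinal_def is_limit_def)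
  ultimately show ?thesis unfolding derivation_length_def by auto
qed

unbundle no m_inv_syntax

section \<open>Automorphisms are isometric\<close>

lemma norm_one_le: "norm (1 :: 'a :: unital_cstar_algebra) \<le> 1"
proof -
  have "norm (1 :: 'a) = (norm (1 :: 'a))\<^sup>2"
    using cstar_identity[of "1 :: 'a"] by (simp add: star_one)
  then have "norm (1 :: 'a) = 0 \<or> norm (1 :: 'a) = 1" by (simp add: power2_eq_square)
  then show ?thesis by auto
qed

text \<open>The square root \<open>1 - y\<close> of \<open>1 - x\<close> is found by iterating \<open>y \<mapsto> (x + y\<^sup>2) / 2\<close>.\<close>

lemma sqrt_near_one:
  fixes x :: "'a :: unital_cstar_algebra"
  assumes "norm x < 1"
  obtains y where "norm y \<le> norm x" "(1 - y) * (1 - y) = 1 - x" "star x = x \<Longrightarrow> star y = y"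
    "\<And>z. x * z = z * x \<Longrightarrow> y * z = z * y"
proof -
  \<comment> \<open>Norm bound, self-adjointness and commutation with the commutant of x define a
    closed set that the iteration preserves, so the fixed point inherits them.\<close>
  define A where "A = {y. norm y \<le> norm x \<and> (star x = x \<longrightarrow> star y = y) \<and> (\<forall>z. x * z = z * x \<longrightarrow> y * z = z * y)}"
  define f where "f y = (1 / 2) *\<^sub>R (x + y * y)" for y
  have "closed A"
    unfolding A_def
    by (intro closed_Collect_conj closed_Collect_all closed_Collect_imp closed_Collect_eq closed_Collect_le
        open_Collect_const continuous_intros)
  then have "complete A" by (simp add: complete_eq_closed)
  moreover have "A \<noteq> {}" by (auto simp: A_def star_zero intro!: exI[of _ 0])
  moreover have "f ` A \<subseteq> A"
  proof (rule image_subsetI)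
    fix y assume "y \<in> A"
    then have y: "norm y \<le> norm x" "star x = x \<Longrightarrow> star y = y" "\<And>z. x * z = z * x \<Longrightarrow> y * z = z * y"
      unfolding A_def by blast+
    have "norm (f y) \<le> (1 / 2) * (norm x + norm y * norm y)"
      unfolding f_def using norm_triangle_ineq[of x "y * y"] norm_mult_ineq[of y y] by simp
    also have "norm y * norm y \<le> norm x * 1"
      using y(1) assms by (intro mult_mono) auto
    finally have "norm (f y) \<le> norm x" by simp
    moreover have "star (f y) = f y" if "star x = x"
      using that y(2)[OF that] by (simp add: f_def star_scaleR star_add star_mult)
    moreover have "f y * z = z * f y" if z: "x * z = z * x" for z
    proof -
      have "y * z = z * y" by (rule y(3)[OF z])
      then have "y * y * z = z * (y * y)" by (metis mult.assoc)
      then show ?thesis using z by (simp add: f_def distrib_left distrib_right)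
    qed
    ultimately show "f y \<in> A" unfolding A_def by blast
  qed
  moreover have "dist (f y) (f z) \<le> norm x * dist y z" if yz: "y \<in> A" "z \<in> A" for y z
  proof -
    have "f y - f z = (1 / 2) *\<^sub>R (y * (y - z) + (y - z) * z)"
      by (simp add: f_def algebra_simps)
    then have "dist (f y) (f z) = (1 / 2) * norm (y * (y - z) + (y - z) * z)"
      by (simp add: dist_norm)
    also have "\<dots> \<le> (1 / 2) * (norm y * norm (y - z) + norm (y - z) * norm z)"
      using norm_triangle_ineq[of "y * (y - z)" "(y - z) * z"] norm_mult_ineq[of y "y - z"]
        norm_mult_ineq[of "y - z" z] by simp
    also have "\<dots> \<le> (1 / 2) * (norm x * norm (y - z) + norm (y - z) * norm x)"
      using yz unfolding A_def by (intro mult_left_mono add_mono mult_right_mono) auto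
    also have "\<dots> = norm x * dist y z" by (simp add: dist_norm)
    finally show ?thesis .
  qed
  ultimately have "\<exists>!y. y \<in> A \<and> f y = y"
    using assms by (intro Banach_fix[of A "norm x"]) auto
  then obtain y where y: "y \<in> A" "f y = y" by blast
  \<comment> \<open>At the fixed point 2 y = x + y y, which is (1 - y)(1 - y) = 1 - x.\<close>
  have "2 *\<^sub>R y = 2 *\<^sub>R f y" using y(2) by simp
  then have "y + y = x + y * y" by (simp add: f_def scaleR_2)
  then have sq: "(1 - y) * (1 - y) = 1 - x"
    by (simp add: algebra_simps)
  have A: "norm y \<le> norm x" "star x = x \<Longrightarrow> star y = y" "\<And>z. x * z = z * x \<Longrightarrow> y * z = z * y"
    using y(1) unfolding A_def by blast+
  show thesis by (rule that[OF A(1) sq A(2,3)])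
qed

lemma unitary_norm_le: "unitary u \<Longrightarrow> norm (u :: 'a :: unital_cstar_algebra) \<le> 1"
proof -
  assume "unitary u"
  then have "(norm u)\<^sup>2 = norm (1 :: 'a)" using cstar_identity[of u] by (simp add: unitary_def)
  then have "(norm u)\<^sup>2 \<le> 1" using norm_one_le[where 'a = 'a] by linarith
  then show ?thesis using power2_le_imp_le[of "norm u" 1] by simp
qed

lemma unitary_norm_mult:
  fixes u x :: "'a :: unital_cstar_algebra"
  shows "unitary u \<Longrightarrow> norm (u * x) = norm x" and "unitary u \<Longrightarrow> norm (x * u) = norm x"
proof -
  assume u: "unitary u"
  have *: "norm (v * y) = norm y" if "star v * v = 1" for v y :: 'a
  proof -
    have "star (v * y) * (v * y) = star y * (star v * v) * y" by (simp add: star_mult mult.assoc)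
    then have "(norm (v * y))\<^sup>2 = (norm y)\<^sup>2" using that by (simp flip: cstar_identity)
    then show ?thesis by simp
  qed
  show "norm (u * x) = norm x" using * u by (simp add: unitary_def)
  have "norm (star u * star x) = norm (star x)" using u by (intro *) (simp add: unitary_def star_star)
  then show "norm (x * u) = norm x" by (metis norm_star star_mult)
qed

lemma star_automorphismD:
  assumes "star_automorphism f"
  shows "bij f" "f (x + y) = f x + f y" "f (c *\<^sub>C x) = c *\<^sub>C f x" "f (x * y) = f x * f y" "f (star x) = star (f x)"
  using assms by (auto simp: star_automorphism_def clinear_map_def)

lemma star_automorphism_scaleR: "star_automorphism f \<Longrightarrow> f (r *\<^sub>R x) = r *\<^sub>R f x"
  by (simp add: star_automorphismD flip: scaleC_of_real)

lemma star_automorphism_diff: "star_automorphism f \<Longrightarrow> f (x - y) = f x - f y"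
  using star_automorphismD(2)[of f x "- y"] star_automorphism_scaleR[of f "- 1" y] by simp

lemma star_automorphism_one: "star_automorphism f \<Longrightarrow> f 1 = 1"
proof -
  assume f: "star_automorphism f"
  obtain y where "f y = 1" using star_automorphismD(1)[OF f] by (metis bij_pointE)
  then show ?thesis using star_automorphismD(4)[OF f, of 1 y] by simp
qed

lemma star_automorphism_unitary: "star_automorphism f \<Longrightarrow> unitary u \<Longrightarrow> unitary (f u)"
  unfolding unitary_def by (metis star_automorphismD(4,5) star_automorphism_one)

text \<open>A self-adjoint contraction is the real part of a unitary, and automorphisms preserve unitaries.\<close>

lemma star_automorphism_norm_le:
  assumes f: "star_automorphism f" shows "norm (f x) \<le> norm (x :: 'a :: unital_cstar_algebra)"
proof -
  have small: "norm (f a) \<le> 1" if a: "star a = a" "norm a < 1" for a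
  proof -
    have "norm (a * a) < 1"
      using norm_mult_ineq[of a a] a(2) mult_strict_mono[of "norm a" 1 "norm a" 1] by simp
    then obtain y where y: "(1 - y) * (1 - y) = 1 - a * a" "star (a * a) = a * a \<Longrightarrow> star y = y"
        "\<And>z. a * a * z = z * (a * a) \<Longrightarrow> y * z = z * y"
      by (rule sqrt_near_one) (rule that)
    define b where "b = 1 - y"
    have sb: "star b = b" using y(2) a(1) by (simp add: b_def star_diff star_one star_mult)
    have "y * a = a * y" by (rule y(3)) (simp add: mult.assoc)
    then have ab: "b * a = a * b" by (simp add: b_def algebra_simps)
    have bb: "b * b = 1 - a * a" using y(1) by (simp add: b_def)
    \<comment> \<open>As b is a self-adjoint square root of 1 - a a commuting with a, u is unitary
      with real part a.\<close>
    define u where "u = a + \<i> *\<^sub>C b"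
    have su: "star u = a - \<i> *\<^sub>C b"
      by (simp add: u_def star_add star_scaleC a(1) sb scaleC_minus_left)
    have "(a - \<i> *\<^sub>C b) * (a + \<i> *\<^sub>C b) = a * a + b * b" "(a + \<i> *\<^sub>C b) * (a - \<i> *\<^sub>C b) = a * a + b * b"
      by (simp_all add: algebra_simps mult_scaleC_left mult_scaleC_right scaleC_scaleC ab scaleC_minus_left scaleC_one
          scaleC_diff scaleC_add_right)
    then have "unitary u" unfolding unitary_def su by (simp add: u_def bb)
    then have "norm (f u) \<le> 1" by (intro unitary_norm_le star_automorphism_unitary[OF f])
    moreover have "u + star u = a + a" unfolding su by (simp add: u_def)
    then have "f a + f a = f u + star (f u)"
      by (metis star_automorphismD(2,5)[OF f])
    then have "2 * norm (f a) = norm (f u + star (f u))"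
      by (metis norm_scaleR scaleR_2 abs_numeral)
    then have "2 * norm (f a) \<le> norm (f u) + norm (f u)"
      using norm_triangle_ineq[of "f u" "star (f u)"] by (simp add: norm_star)
    ultimately show ?thesis by simp
  qed
  have sa: "norm (f a) \<le> norm a" if a: "star a = a" for a
  proof (rule dense_ge)
    fix t assume t: "norm a < t"
    then have tp: "0 < t" using norm_ge_zero[of a] by linarith
    have "norm (f ((1 / t) *\<^sub>R a)) \<le> 1"
      using t tp a by (intro small) (simp_all add: star_scaleR)
    then show "norm (f a) \<le> t"
      using tp by (simp add: star_automorphism_scaleR[OF f] field_simps)
  qed
  \<comment> \<open>The C*-identity reduces the general element to the self-adjoint
    \<open>star x * x\<close>.\<close>
  have "(norm (f x))\<^sup>2 = norm (f (star x * x))"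
    by (simp add: star_automorphismD[OF f] flip: cstar_identity)
  also have "\<dots> \<le> norm (star x * x)" by (rule sa) (simp add: star_mult star_star)
  also have "\<dots> = (norm x)\<^sup>2" by (rule cstar_identity)
  finally show ?thesis by (rule power2_le_imp_le) simp
qed

lemma star_automorphism_inv: assumes f: "star_automorphism f" shows "star_automorphism (inv f)"
proof -
  have b: "bij f" by (rule star_automorphismD(1)[OF f])
  have fi: "f (inv f x) = x" "inv f (f x) = x" for x
    using b by (simp_all add: bij_is_surj surj_f_inv_f bij_is_inj)
  have inj: "inv f y = x" if "y = f x" for x y using that fi by simp
  show ?thesis
    unfolding star_automorphism_def clinear_map_def
    by (intro conjI allI bij_imp_bij_inv b; rule inj; simp add: star_automorphismD[OF f] fi)
qed

lemma star_automorphism_norm: "star_automorphism f \<Longrightarrow> norm (f x) = norm x"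
proof (rule antisym)
  assume f: "star_automorphism f"
  show "norm (f x) \<le> norm x" by (rule star_automorphism_norm_le[OF f])
  show "norm x \<le> norm (f x)"
    using star_automorphism_norm_le[OF star_automorphism_inv[OF f], of "f x"] star_automorphismD(1)[OF f]
    by (simp add: bij_is_inj)
qed

lemma star_automorphism_dist: "star_automorphism f \<Longrightarrow> dist (f x) (f y) = dist x y"
  using star_automorphism_norm[of f "x - y"] by (simp add: dist_norm star_automorphism_diff)

section \<open>The automorphism group\<close>

lemma star_automorphism_comp: "star_automorphism f \<Longrightarrow> star_automorphism g \<Longrightarrow> star_automorphism (f \<circ> g)"
  by (auto simp: star_automorphism_def clinear_map_def intro: bij_comp)

lemma star_automorphism_id: "star_automorphism id"
  by (auto simp: star_automorphism_def clinear_map_def)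

lemma Aut_group_simps [simp]:
  "carrier Aut_group = Aut" "mult Aut_group = (\<circ>)" "one Aut_group = id"
  by (simp_all add: Aut_group_def)

lemma mem_Aut [simp]: "f \<in> Aut \<longleftrightarrow> star_automorphism f"
  by (simp add: Aut_def)

lemma group_Aut: "group (Aut_group :: ('a :: unital_cstar_algebra \<Rightarrow> 'a) monoid)"
proof (rule groupI)
  show "\<exists>y\<in>carrier Aut_group. y \<otimes>\<^bsub>Aut_group\<^esub> f = \<one>\<^bsub>Aut_group\<^esub>"
    if "f \<in> carrier Aut_group" for f :: "'a \<Rightarrow> 'a"
    using that star_automorphismD(1)[of f]
    by (intro bexI[of _ "inv f"]) (auto simp: star_automorphism_inv bij_is_inj)
qed (auto simp: star_automorphism_comp star_automorphism_id comp_assoc)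

lemma inv_Aut: "star_automorphism f \<Longrightarrow> m_inv Aut_group f = inv f"
  using star_automorphismD(1)[of f]
  by (intro group.inv_equality[OF group_Aut]) (auto simp: star_automorphism_inv bij_is_inj)

lemma topspace_Aut_topology [simp]: "topspace Aut_topology = Aut"
  by (simp add: Aut_topology_def)

lemma continuous_map_Aut_eval: "continuous_map Aut_topology euclidean (\<lambda>f. f x)"
  unfolding Aut_topology_def
  by (intro continuous_map_from_subtopology continuous_map_product_projection) simp

lemma openin_Aut_eval: "open U \<Longrightarrow> openin Aut_topology {f \<in> Aut. f x \<in> U}"
  using openin_continuous_map_preimage[OF continuous_map_Aut_eval, of U x] by simp

lemma continuous_map_into_Aut:
  "(\<And>x. continuous_map X euclidean (\<lambda>z. f z x)) \<Longrightarrow> f ` topspace X \<subseteq> Aut \<Longrightarrow> continuous_map X Aut_topology f"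
  unfolding Aut_topology_def
  by (auto simp: continuous_map_in_subtopology continuous_map_componentwise_UNIV)

text \<open>Isometry makes both operations continuous for pointwise convergence: the distance from
  f'(g x) to f'(g' x) is that from g x to g' x, and the distance from \<open>inv f x\<close> to
  \<open>inv g x\<close> is that from \<open>g (inv f x)\<close> to x.\<close>

lemma topological_group_Aut:
  "topological_group Aut_group (Aut_topology :: ('a :: unital_cstar_algebra \<Rightarrow> 'a) topology)"
  unfolding topological_group_def
proof (intro conjI)
  show "continuous_map (prod_topology Aut_topology Aut_topology) (Aut_topology :: ('a \<Rightarrow> 'a) topology)
      (\<lambda>(f, g). f \<otimes>\<^bsub>Aut_group\<^esub> g)"
  proof (rule continuous_map_into_Aut)
    fix x :: 'a
    have "continuous_map (prod_topology Aut_topology Aut_topology) euclidean (\<lambda>(f, g). f (g x))"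
    proof (rule continuous_map_prod_nbhdsI)
      fix f g :: "'a \<Rightarrow> 'a" and U assume "f \<in> topspace Aut_topology" "g \<in> topspace Aut_topology"
        and U: "openin euclidean U" "f (g x) \<in> U"
      then have fg: "star_automorphism f" "star_automorphism g" by auto
      obtain e where e: "e > 0" "ball (f (g x)) e \<subseteq> U"
        using U by (auto simp: open_contains_ball)
      let ?V = "{f' \<in> Aut. f' (g x) \<in> ball (f (g x)) (e / 2)}"
      let ?W = "{g' \<in> Aut. g' x \<in> ball (g x) (e / 2)}"
      have "f' (g' x) \<in> U" if "f' \<in> ?V" "g' \<in> ?W" for f' g'
      proof -
        have "dist (f (g x)) (f' (g' x)) \<le> dist (f (g x)) (f' (g x)) + dist (f' (g x)) (f' (g' x))"
          by (rule dist_triangle)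
        also have "\<dots> < e" using that by (simp add: star_automorphism_dist)
        finally show ?thesis using e(2) by auto
      qed
      moreover have "openin Aut_topology ?V" "openin Aut_topology ?W" by (intro openin_Aut_eval open_ball)+
      ultimately show "\<exists>V W. openin Aut_topology V \<and> openin Aut_topology W \<and> f \<in> V \<and> g \<in> W \<and>
          (\<forall>v\<in>V. \<forall>w\<in>W. v (w x) \<in> U)"
        using fg e(1) by (intro exI[of _ ?V] exI[of _ ?W]) auto
    qed simp
    then show "continuous_map (prod_topology Aut_topology Aut_topology) euclidean
        (\<lambda>z. (case z of (f, g) \<Rightarrow> f \<otimes>\<^bsub>Aut_group\<^esub> g) x)"
      by (simp add: case_prod_unfold)
  qed (auto simp: star_automorphism_comp)
  show "continuous_map Aut_topology (Aut_topology :: ('a \<Rightarrow> 'a) topology) (m_inv Aut_group)"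
  proof (rule continuous_map_into_Aut)
    fix x :: 'a
    show "continuous_map Aut_topology euclidean (\<lambda>f. (m_inv Aut_group f) x)"
    proof (rule continuous_map_nbhdsI)
      fix f :: "'a \<Rightarrow> 'a" and U assume "f \<in> topspace Aut_topology"
        and U: "openin euclidean U" "(m_inv Aut_group f) x \<in> U"
      then have f: "star_automorphism f" by simp
      obtain e where e: "e > 0" "ball (inv f x) e \<subseteq> U"
        using U f by (auto simp: open_contains_ball inv_Aut)
      let ?V = "{g \<in> Aut. g (inv f x) \<in> ball x e}"
      have fx: "f (inv f x) = x" using star_automorphismD(1)[OF f] by (simp add: bij_is_surj surj_f_inv_f)
      have "(m_inv Aut_group g) x \<in> U" if g: "g \<in> ?V" for g
      proof -
        have ga: "star_automorphism g" using g by simp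
        have "g (inv g x) = x" using star_automorphismD(1)[OF ga] by (simp add: bij_is_surj surj_f_inv_f)
        then have "dist (inv f x) (inv g x) = dist (g (inv f x)) x"
          using star_automorphism_dist[OF ga, of "inv f x" "inv g x"] by simp
        then show ?thesis using g e(2) by (auto simp: inv_Aut dist_commute)
      qed
      moreover have "openin Aut_topology ?V" by (intro openin_Aut_eval open_ball)
      ultimately show "\<exists>V. openin Aut_topology V \<and> f \<in> V \<and> (\<forall>v\<in>V. (m_inv Aut_group v) x \<in> U)"
        using f e(1) fx by (intro exI[of _ ?V]) auto
    qed simp
  qed (auto simp: inv_Aut star_automorphism_inv)
qed (simp_all add: group_Aut)

lemma star_automorphisms_converge:
  assumes f: "\<And>k. star_automorphism (f k)" and D: "closure D = UNIV"
    and conv: "\<And>y. y \<in> D \<Longrightarrow> convergent (\<lambda>k. f k y)"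
  shows "convergent (\<lambda>k. f k (x :: 'a :: unital_cstar_algebra))"
proof (rule Cauchy_convergent, rule metric_CauchyI)
  fix e :: real assume e: "0 < e"
  have "x \<in> closure D" using D by simp
  then obtain y where y: "y \<in> D" "dist y x < e / 3"
    unfolding closure_approachable using e by (meson zero_less_divide_iff zero_less_numeral)
  have "Cauchy (\<lambda>k. f k y)" using conv[OF y(1)] by (rule convergent_Cauchy)
  then obtain M where M: "\<And>m n. M \<le> m \<Longrightarrow> M \<le> n \<Longrightarrow> dist (f m y) (f n y) < e / 3"
    using metric_CauchyD[of _ "e / 3"] e by force
  have "dist (f m x) (f n x) < e" if mn: "M \<le> m" "M \<le> n" for m n
  proof -
    have "dist (f m x) (f n x) \<le> dist (f m x) (f m y) + (dist (f m y) (f n y) + dist (f n y) (f n x))"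
      using dist_triangle[of "f m x" "f n x" "f m y"] dist_triangle[of "f m y" "f n x" "f n y"] by linarith
    then show ?thesis using M[OF mn] y(2) by (simp add: star_automorphism_dist[OF f] dist_commute)
  qed
  then show "\<exists>M. \<forall>m\<ge>M. \<forall>n\<ge>M. dist (f m x) (f n x) < e" by blast
qed

text \<open>Convergence of the inverses is a separate assumption, since a pointwise limit of
  automorphisms is multiplicative and isometric but can fail to be onto.\<close>

lemma star_automorphism_limit:
  assumes f: "\<And>k. star_automorphism (f k)"
    and F: "\<And>x. (\<lambda>k. f k x) \<longlonglongrightarrow> F x" and F': "\<And>x. (\<lambda>k. inv (f k) x) \<longlonglongrightarrow> F' x"
  shows "star_automorphism F" "inv F = (F' :: 'a :: unital_cstar_algebra \<Rightarrow> 'a)"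
proof -
  have fi: "f k (inv (f k) x) = x" "inv (f k) (f k x) = x" for k x
    using star_automorphismD(1)[OF f] by (simp_all add: bij_is_surj surj_f_inv_f bij_is_inj)
  have *: "h (h' x) = x"
    if g: "\<And>k. star_automorphism (g k)" and h: "\<And>x. (\<lambda>k. g k x) \<longlonglongrightarrow> h x"
      and h': "(\<lambda>k. g' k x) \<longlonglongrightarrow> h' x" and gg: "\<And>k x. g k (g' k x) = x"
    for g g' and h h' :: "'a \<Rightarrow> 'a" and x
  proof (rule LIMSEQ_unique[OF h])
    have "(\<lambda>k. dist (g k (h' x)) x) \<longlonglongrightarrow> 0"
    proof -
      have "dist (g k (h' x)) x = dist (g' k x) (h' x)" for k
        using star_automorphism_dist[OF g, of k "h' x" "g' k x"] by (simp add: gg dist_commute)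
      then show ?thesis using iffD1[OF tendsto_dist_iff h'] by simp
    qed
    then show "(\<lambda>k. g k (h' x)) \<longlonglongrightarrow> x" by (rule iffD2[OF tendsto_dist_iff])
  qed
  have FF': "F (F' x) = x" for x by (rule *[OF f F F' fi(1)])
  have F'F: "F' (F x) = x" for x
    by (rule *[where g = "\<lambda>k. inv (f k)", OF star_automorphism_inv[OF f] F' F fi(2)])
  have "bij F" by (rule o_bij[of F']) (auto simp: FF' F'F)
  moreover have "F (x + y) = F x + F y" for x y
    using tendsto_add[OF F[of x] F[of y]]
    by (intro LIMSEQ_unique[OF F]) (simp add: star_automorphismD(2)[OF f])
  moreover have "F (c *\<^sub>C x) = c *\<^sub>C F x" for c x
    using bounded_linear.tendsto[OF bounded_linear_scaleC F[of x], of c]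
    by (intro LIMSEQ_unique[OF F]) (simp add: star_automorphismD(3)[OF f])
  moreover have "F (x * y) = F x * F y" for x y
    using tendsto_mult[OF F[of x] F[of y]]
    by (intro LIMSEQ_unique[OF F]) (simp add: star_automorphismD(4)[OF f])
  moreover have "F (star x) = star (F x)" for x
    using bounded_linear.tendsto[OF bounded_linear_star F[of x]]
    by (intro LIMSEQ_unique[OF F]) (simp add: star_automorphismD(5)[OF f])
  ultimately show "star_automorphism F" by (simp add: star_automorphism_def clinear_map_def)
  show "inv F = F'" by (rule inv_unique_comp) (auto simp: FF' F'F)
qed

text \<open>An automorphism is encoded by its values and those of its inverse on a dense sequence.\<close>

lemma completely_metrizable_Aut:
  assumes sep: "separable_space (euclidean :: 'a :: unital_cstar_algebra topology)"
  shows "completely_metrizable_space (Aut_topology :: ('a \<Rightarrow> 'a) topology)"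
proof -
  obtain D :: "'a set" where D: "countable D" "closure D = UNIV"
    using sep by (auto simp: separable_space_def)
  have ne: "D \<noteq> {}" using D(2) by auto
  define d where "d = from_nat_into D"
  have dD: "range d = D" unfolding d_def using D(1) ne by (simp add: range_from_nat_into)
  \<comment> \<open>The second coordinate makes the inverses converge along with the automorphisms,
    so that the image is closed.\<close>
  define \<Phi> :: "('a \<Rightarrow> 'a) \<Rightarrow> nat \<Rightarrow> 'a \<times> 'a" where "\<Phi> f = (\<lambda>n. (f (d n), inv f (d n)))" for f
  have near: "\<exists>n. dist (d n) x < e" if "0 < e" for x e
  proof -
    have "x \<in> closure D" using D(2) by simp
    then show ?thesis using that dD unfolding closure_approachable by blast
  qed
  have estimate: "dist (f x) (g x) \<le> dist (f (d n)) (g (d n)) + 2 * dist (d n) x"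
    if fg: "star_automorphism f" "star_automorphism g" for f g n x
    using dist_triangle[of "f x" "g x" "f (d n)"] dist_triangle[of "f (d n)" "g x" "g (d n)"]
    by (simp add: star_automorphism_dist[OF fg(1)] star_automorphism_dist[OF fg(2)] dist_commute)
  have inj: "inj_on \<Phi> Aut"
  proof (rule inj_onI)
    fix f g :: "'a \<Rightarrow> 'a" assume fg: "f \<in> Aut" "g \<in> Aut" and eq: "\<Phi> f = \<Phi> g"
    have eq': "f (d n) = g (d n)" for n using fun_cong[OF eq, of n] by (simp add: \<Phi>_def)
    show "f = g"
    proof
      fix x
      have "dist (f x) (g x) \<le> e" if e: "0 < e" for e
      proof -
        obtain n where "dist (d n) x < e / 2" using near[of "e / 2" x] e by auto
        then show ?thesis using estimate[of f g x n] fg eq'[of n] by simp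
      qed
      then have "dist (f x) (g x) \<le> 0" by (rule field_le_epsilon[of _ 0, simplified])
      then show "f x = g x" by simp
    qed
  qed
  have closed: "closed (\<Phi> ` Aut)"
    unfolding closed_sequential_limits
  proof (intro allI impI)
    fix h l assume hl: "(\<forall>k. h k \<in> \<Phi> ` Aut) \<and> h \<longlonglongrightarrow> l"
    then obtain f where f: "\<And>k. star_automorphism (f k)" "\<And>k. h k = \<Phi> (f k)"
      unfolding image_iff by (metis mem_Aut)
    have "(\<lambda>k. h k n) \<longlonglongrightarrow> l n" for n
      using continuous_on_tendsto_compose[OF continuous_on_product_coordinates[of n], of h l] hl by simp
    then have "(\<lambda>k. fst (h k n)) \<longlonglongrightarrow> fst (l n)" "(\<lambda>k. snd (h k n)) \<longlonglongrightarrow> snd (l n)" for n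
      by (auto intro: tendsto_fst tendsto_snd)
    then have lim: "(\<lambda>k. f k (d n)) \<longlonglongrightarrow> fst (l n)" "(\<lambda>k. inv (f k) (d n)) \<longlonglongrightarrow> snd (l n)" for n
      unfolding f(2) by (simp_all add: \<Phi>_def)
    have conv: "convergent (\<lambda>k. f k x)" "convergent (\<lambda>k. inv (f k) x)" for x
    proof -
      show "convergent (\<lambda>k. f k x)"
        by (rule star_automorphisms_converge[OF f(1) D(2)]) (use lim(1) dD convergent_def in blast)
      show "convergent (\<lambda>k. inv (f k) x)"
        by (rule star_automorphisms_converge[OF star_automorphism_inv[OF f(1)] D(2)])
          (use lim(2) dD convergent_def in blast)
    qed
    define F where "F x = lim (\<lambda>k. f k x)" for x
    define F' where "F' x = lim (\<lambda>k. inv (f k) x)" for x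
    have F: "(\<lambda>k. f k x) \<longlonglongrightarrow> F x" and F': "(\<lambda>k. inv (f k) x) \<longlonglongrightarrow> F' x" for x
      using conv unfolding F_def F'_def by (simp_all add: convergent_LIMSEQ_iff)
    note aut = star_automorphism_limit[OF f(1) F F']
    have "\<Phi> F = l"
      using LIMSEQ_unique[OF F lim(1)] LIMSEQ_unique[OF F' lim(2)]
      by (auto simp: \<Phi>_def aut(2) prod_eq_iff)
    with aut(1) show "l \<in> \<Phi> ` Aut" by (intro image_eqI[of _ _ F]) simp_all
  qed
  define \<Psi> where "\<Psi> = inv_into Aut \<Phi>"
  have \<Psi>: "\<Psi> (\<Phi> f) = f" if "f \<in> Aut" for f
    unfolding \<Psi>_def using inj that by (rule inv_into_f_f)
  have "homeomorphic_maps Aut_topology (top_of_set (\<Phi> ` Aut)) \<Phi> \<Psi>"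
    unfolding homeomorphic_maps_def
  proof (intro conjI)
    show "continuous_map Aut_topology (top_of_set (\<Phi> ` Aut)) \<Phi>"
    proof -
      have "continuous_map Aut_topology Aut_topology (m_inv (Aut_group :: ('a \<Rightarrow> 'a) monoid))"
        using topological_group_Aut[where 'a = 'a] by (simp add: topological_group_def)
      then have "continuous_map (Aut_topology :: ('a \<Rightarrow> 'a) topology) Aut_topology inv"
        by (rule continuous_map_eq) (simp add: inv_Aut)
      from continuous_map_compose[OF this continuous_map_Aut_eval]
      have "continuous_map (Aut_topology :: ('a \<Rightarrow> 'a) topology) euclidean (\<lambda>f. (f (d n), inv f (d n)))" for n
        using continuous_map_Aut_eval continuous_map_paired[of "Aut_topology :: ('a \<Rightarrow> 'a) topology" euclidean euclidean
            "\<lambda>f. f (d n)" "\<lambda>f. inv f (d n)"] by (simp add: comp_def)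
      then show ?thesis
        by (auto simp: continuous_map_in_subtopology \<Phi>_def continuous_map_componentwise_UNIV
            simp flip: euclidean_product_topology)
    qed
    show "continuous_map (top_of_set (\<Phi> ` Aut)) Aut_topology \<Psi>"
    proof (rule continuous_map_into_Aut)
      fix x
      show "continuous_map (top_of_set (\<Phi> ` Aut)) euclidean (\<lambda>h. \<Psi> h x)"
      proof (rule continuous_map_nbhdsI)
        fix h U assume "h \<in> topspace (top_of_set (\<Phi> ` Aut))" and U: "openin euclidean U" "\<Psi> h x \<in> U"
        then obtain f where f: "f \<in> Aut" "h = \<Phi> f" by auto
        obtain e where e: "e > 0" "ball (f x) e \<subseteq> U"
          using U f by (auto simp: open_contains_ball \<Psi>)
        \<comment> \<open>One coordinate suffices: closeness e / 2 at \<open>d n\<close> and twice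
          the distance e / 4 from \<open>d n\<close> to x add up to e in
          \<open>estimate\<close>.\<close>
        obtain n where n: "dist (d n) x < e / 4" using near[of "e / 4" x] e by auto
        let ?O = "(\<lambda>h :: nat \<Rightarrow> 'a \<times> 'a. fst (h n)) -` ball (f (d n)) (e / 2)"
        have "continuous_on UNIV (\<lambda>h :: nat \<Rightarrow> 'a \<times> 'a. fst (h n))"
          by (intro continuous_on_fst continuous_on_product_coordinates)
        then have "open ?O" by (intro open_vimage) auto
        then have "openin (top_of_set (\<Phi> ` Aut)) (\<Phi> ` Aut \<inter> ?O)" by (rule openin_open_Int)
        moreover have "\<Psi> k x \<in> U" if k: "k \<in> \<Phi> ` Aut \<inter> ?O" for k
        proof -
          obtain g where g: "g \<in> Aut" "k = \<Phi> g" using k by blast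
          have "dist (f (d n)) (g (d n)) < e / 2" using k g by (simp add: \<Phi>_def)
          then have "dist (f x) (g x) < e" using estimate[of f g x n] f g n by simp
          then show ?thesis using e(2) g by (auto simp: \<Psi>)
        qed
        moreover have "h \<in> \<Phi> ` Aut \<inter> ?O" using f e(1) by (auto simp: \<Phi>_def)
        ultimately show "\<exists>V. openin (top_of_set (\<Phi> ` Aut)) V \<and> h \<in> V \<and> (\<forall>v\<in>V. \<Psi> v x \<in> U)" by blast
      qed simp
    qed (use \<Psi> in auto)
  qed (use \<Psi> in auto)
  then have "(Aut_topology :: ('a \<Rightarrow> 'a) topology) homeomorphic_space top_of_set (\<Phi> ` Aut)"
    unfolding homeomorphic_space_def by blast
  moreover have "completely_metrizable_space (top_of_set (\<Phi> ` Aut))"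
    using closed by (intro completely_metrizable_space_closedin[OF completely_metrizable_space_euclidean]) simp
  ultimately show ?thesis by (simp add: homeomorphic_completely_metrizable_space)
qed

section \<open>Inner automorphisms\<close>

definition unitary_group :: "'a :: unital_cstar_algebra monoid" where
  "unitary_group = \<lparr>carrier = {u. unitary u}, mult = (*), one = 1\<rparr>"

lemma unitary_group_simps [simp]:
  "carrier unitary_group = {u. unitary u}" "mult unitary_group = (*)" "one unitary_group = 1"
  by (simp_all add: unitary_group_def)

lemma unitary_star: "unitary u \<Longrightarrow> unitary (star u)"
  by (simp add: unitary_def star_star)

lemma unitary_one: "unitary 1"
  by (simp add: unitary_def star_one)

lemma unitary_cancel:
  assumes "unitary u" shows "star u * (u * x) = x" "u * (star u * x) = x"
  using assms by (simp_all add: unitary_def flip: mult.assoc)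

lemma unitary_mult: "unitary u \<Longrightarrow> unitary v \<Longrightarrow> unitary (u * v)"
  unfolding unitary_def star_mult by (metis mult.assoc mult_1_left)

lemma group_unitary: "group (unitary_group :: 'a :: unital_cstar_algebra monoid)"
proof (rule groupI)
  show "\<exists>y\<in>carrier unitary_group. y \<otimes>\<^bsub>unitary_group\<^esub> u = \<one>\<^bsub>unitary_group\<^esub>"
    if "u \<in> carrier unitary_group" for u :: 'a
    using that by (intro bexI[of _ "star u"]) (auto simp: unitary_star, simp add: unitary_def)
qed (auto simp: unitary_mult unitary_one mult.assoc)

lemma Ad_mult: "Ad (u * v) = Ad u \<circ> Ad v"
  by (rule ext) (simp add: Ad_def star_mult mult.assoc)

lemma star_automorphism_Ad: assumes u: "unitary u" shows "star_automorphism (Ad u)"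
proof -
  have "bij (Ad u)"
    by (rule o_bij[of "Ad (star u)"])
      (use u in \<open>auto simp: Ad_def fun_eq_iff mult.assoc star_star unitary_cancel, simp_all add: unitary_def\<close>)
  moreover have "Ad u (x * y) = Ad u x * Ad u y" for x y
    using u by (simp add: Ad_def mult.assoc unitary_cancel)
  ultimately show ?thesis
    by (simp add: star_automorphism_def clinear_map_def Ad_def distrib_left distrib_right
        mult_scaleC_left mult_scaleC_right star_mult star_star mult.assoc)
qed

lemma conj_Ad: "star_automorphism g \<Longrightarrow> g \<circ> Ad u \<circ> inv g = Ad (g u)"
proof
  fix x assume g: "star_automorphism g"
  have "g (inv g x) = x" using star_automorphismD(1)[OF g] by (simp add: bij_is_surj surj_f_inv_f)
  then show "(g \<circ> Ad u \<circ> inv g) x = Ad (g u) x"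
    by (simp add: Ad_def star_automorphismD(4,5)[OF g])
qed

lemma polish_cover_automorphisms:
  assumes sep: "separable_space (euclidean :: 'a :: unital_cstar_algebra topology)"
  shows "polish_cover Aut_group (Aut_topology :: ('a \<Rightarrow> 'a) topology) unitary_group Ad"
proof (intro polish_cover.intro top_group.intro polish_cover_axioms.intro)
  show "topological_group Aut_group (Aut_topology :: ('a \<Rightarrow> 'a) topology)"
    by (rule topological_group_Aut)
  show "completely_metrizable_space (Aut_topology :: ('a \<Rightarrow> 'a) topology)"
    using sep by (rule completely_metrizable_Aut)
  show "group (unitary_group :: 'a monoid)" by (rule group_unitary)
  show "closed (carrier (unitary_group :: 'a monoid))"
    unfolding unitary_group_simps unitary_def
    by (intro closed_Collect_conj closed_Collect_eq continuous_intros)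
  show "separable_space (top_of_set (carrier (unitary_group :: 'a monoid)))"
    using sep by (rule separable_space_top_of_set)
  show "Ad \<in> hom (unitary_group :: 'a monoid) Aut_group"
    by (auto simp: hom_def Ad_mult star_automorphism_Ad)
  show "continuous_map (top_of_set (carrier (unitary_group :: 'a monoid))) Aut_topology Ad"
  proof (rule continuous_map_into_Aut)
    show "continuous_map (top_of_set (carrier (unitary_group :: 'a monoid))) euclidean (\<lambda>u. Ad u x)" for x
      unfolding Ad_def by (auto intro!: continuous_intros)
  qed (auto simp: star_automorphism_Ad)
  show "dist (k \<otimes>\<^bsub>unitary_group\<^esub> x) (k \<otimes>\<^bsub>unitary_group\<^esub> y) = dist x y"
    if "k \<in> carrier unitary_group" for k x y :: 'a
    using that unitary_norm_mult(1)[of k "x - y"] by (simp add: dist_norm right_diff_distrib)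
  show "dist (x \<otimes>\<^bsub>unitary_group\<^esub> k) (y \<otimes>\<^bsub>unitary_group\<^esub> k) = dist x y"
    if "k \<in> carrier unitary_group" for k x y :: 'a
    using that unitary_norm_mult(2)[of k "x - y"] by (simp add: dist_norm left_diff_distrib)
  \<comment> \<open>Conjugating \<open>Ad k\<close> by g gives \<open>Ad (g k)\<close>, and g k is
    as far from 1 as k because g is isometric and fixes 1.\<close>
  show "\<exists>k'\<in>carrier unitary_group. dist \<one>\<^bsub>unitary_group\<^esub> k' \<le> dist \<one>\<^bsub>unitary_group\<^esub> k \<and>
      Ad k' = g \<otimes>\<^bsub>Aut_group\<^esub> Ad k \<otimes>\<^bsub>Aut_group\<^esub> m_inv Aut_group g"
    if "g \<in> carrier Aut_group" "k \<in> carrier unitary_group" for g and k :: 'a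
    using that star_automorphism_dist[of g 1 k] star_automorphism_one[of g]
    by (intro bexI[of _ "g k"]) (auto simp: inv_Aut conj_Ad star_automorphism_unitary)
qed

lemma Inn_eq: "Inn = Ad ` carrier unitary_group"
  by (auto simp: Inn_def)

section \<open>Square roots modulo central unitaries\<close>

lemma Ad_eq_imp_central:
  assumes u: "unitary u" and v: "unitary v" and eq: "Ad u = Ad v"
  shows "star v * u * y = y * (star v * u)"
proof -
  have "star v * Ad u y * u = star v * Ad v y * u" using eq by simp
  then have "star v * (u * (y * (star u * u))) = star v * (v * (y * (star v * u)))"
    by (simp add: Ad_def mult.assoc)
  then show ?thesis using u v by (simp add: unitary_cancel mult.assoc) (simp add: unitary_def)
qed

text \<open>The square root \<open>t\<close> is unitary because \<open>star t * t\<close> is close to \<open>1\<close> and squares to \<open>1\<close>.\<close>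

lemma central_unitary_sqrt:
  fixes z :: "'a :: unital_cstar_algebra"
  assumes z: "unitary z" "\<And>y. z * y = y * z" "norm (1 - z) \<le> 3 / 8"
  obtains t where "unitary t" "\<And>y. t * y = y * t" "t * t = z" "norm (1 - t) \<le> 3 / 8"
proof -
  \<comment> \<open>The commutation clause of \<open>sqrt_near_one\<close> makes the root central;
    3/8 is the bound that \<open>doubling_automorphisms\<close> provides.\<close>
  obtain y where y: "norm y \<le> norm (1 - z)" "(1 - y) * (1 - y) = 1 - (1 - z)"
      "\<And>x. (1 - z) * x = x * (1 - z) \<Longrightarrow> y * x = x * y"
    using sqrt_near_one[of "1 - z"] z(3) by (smt (verit) divide_less_eq_1_pos)
  define t where "t = 1 - y"
  have tt: "t * t = z" using y(2) by (simp add: t_def)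
  have nt: "norm (1 - t) \<le> 3 / 8" using y(1) z(3) by (simp add: t_def)
  have "y * x = x * y" for x by (rule y(3)) (simp add: left_diff_distrib right_diff_distrib z(2))
  then have tc: "t * x = x * t" for x by (simp add: t_def left_diff_distrib right_diff_distrib)
  define q where "q = star t * t"
  have "q * q = star t * (t * (star t * t))" by (simp add: q_def mult.assoc)
  also have "\<dots> = (star t * star t) * (t * t)" using tc[of "star t * t"] by (simp add: mult.assoc)
  also have "\<dots> = 1" using z(1) tt by (simp add: unitary_def flip: star_mult)
  finally have qq: "q * q = 1" .
  have "norm t \<le> 11 / 8"
    using norm_triangle_ineq4[of 1 "1 - t"] norm_one_le[where 'a = 'a] nt by simp
  have "q - 1 = star (t - 1) * t + (t - 1)"
    by (simp add: q_def star_diff star_one left_diff_distrib)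
  then have "norm (q - 1) = norm (star (t - 1) * t + (t - 1))" by (rule arg_cong)
  also have "\<dots> \<le> norm (star (t - 1)) * norm t + norm (t - 1)"
    using norm_triangle_ineq[of "star (t - 1) * t" "t - 1"] norm_mult_ineq[of "star (t - 1)" t] by linarith
  also have "\<dots> \<le> 3 / 8 * (11 / 8) + 3 / 8"
    using nt \<open>norm t \<le> 11 / 8\<close> by (intro add_mono mult_mono) (simp_all add: norm_star norm_minus_commute)
  finally have q1: "norm (q - 1) < 2" by simp
  \<comment> \<open>For q with q q = 1 this equation forces the norm of q - 1 to be 0 or at least 2;
    the estimate above, 57/64, excludes the latter.\<close>
  have "(q - 1) * (q - 1) = 2 *\<^sub>R (1 - q)"
    using qq by (simp add: algebra_simps scaleR_2)
  then have "2 * norm (q - 1) \<le> norm (q - 1) * norm (q - 1)"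
    using norm_mult_ineq[of "q - 1" "q - 1"] by (simp add: norm_minus_commute)
  then have "norm (q - 1) = 0"
    using q1 norm_ge_zero[of "q - 1"] by (metis mult_right_le_imp_le not_less order.order_iff_strict)
  then have "star t * t = 1" by (simp add: q_def)
  then have "unitary t" using tc[of "star t"] by (simp add: unitary_def)
  then show thesis using tc tt nt by (rule that)
qed

text \<open>If x = \<open>Ad u\<close> and x x = \<open>Ad w\<close>, then u u = w z with z a
  central unitary near 1. Dividing u by a central square root t of z changes neither
  \<open>Ad u\<close> nor unitarity and gives v with v v = w exactly; v is still near 1, so its
  distance to 1 is governed by that of w.\<close>

lemma doubling_automorphisms:
  assumes sep: "separable_space (euclidean :: 'a :: unital_cstar_algebra topology)"
  shows "doubling_polish_cover Aut_group (Aut_topology :: ('a \<Rightarrow> 'a) topology) unitary_group Ad"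
proof -
  interpret polish_cover Aut_group "Aut_topology :: ('a \<Rightarrow> 'a) topology" unitary_group Ad
    by (rule polish_cover_automorphisms[OF sep])
  show ?thesis
  \<comment> \<open>The radius 1/8 gives 1 - z norm at most 3/8, from two copies of 1 - u and one of
    1 - w. It then gives v - 1 norm at most 3/8 + 1/8 = 1/2.\<close>
  proof (unfold_locales, intro exI[of _ "1 / 8"] conjI ballI allI impI)
    fix x and s :: real assume "x \<in> P (1 / 8)" and s: "0 < s" "s \<le> 1 / 8" and "x \<otimes>\<^bsub>Aut_group\<^esub> x \<in> P s"
    then obtain u w :: 'a where u: "unitary u" "norm (1 - u) < 1 / 8" "x = Ad u"
        and w: "unitary w" "norm (1 - w) < s" "x \<circ> x = Ad w"
      by (auto simp: P_def dist_norm)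
    have uu: "unitary (u * u)" using u(1) u(1) by (rule unitary_mult)
    have Ad_uu: "Ad (u * u) = Ad w" using w(3) u(3) by (simp add: Ad_mult)
    define z where "z = star w * (u * u)"
    have z: "unitary z" unfolding z_def by (intro unitary_mult unitary_star uu w(1))
    have zc: "z * y = y * z" for y
      using Ad_eq_imp_central[OF uu w(1) Ad_uu] by (simp add: z_def)
    have "norm (1 - z) = norm (star w * (w - u * u))"
      using w(1) by (simp add: z_def right_diff_distrib unitary_def)
    also have "\<dots> = norm (w - u * u)" by (rule unitary_norm_mult(1)[OF unitary_star[OF w(1)]])
    also have "w - u * u = (u * (1 - u) + (1 - u)) - (1 - w)" by (simp add: algebra_simps)
    also have "norm \<dots> \<le> norm (u * (1 - u)) + norm (1 - u) + norm (1 - w)"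
      using norm_triangle_ineq4[of "u * (1 - u) + (1 - u)" "1 - w"]
        norm_triangle_ineq[of "u * (1 - u)" "1 - u"] by linarith
    also have "norm (u * (1 - u)) = norm (1 - u)" by (rule unitary_norm_mult(1)[OF u(1)])
    finally have nz: "norm (1 - z) \<le> 3 / 8" using u(2) w(2) s(2) by linarith
    obtain t where t: "unitary t" "\<And>y. t * y = y * t" "t * t = z" "norm (1 - t) \<le> 3 / 8"
      using z zc nz by (rule central_unitary_sqrt) (rule that)
    have tsc: "star t * y = y * star t" for y
      using arg_cong[OF t(2)[of "star y"], of star] by (simp add: star_mult star_star)
    define v where "v = u * star t"
    have v: "unitary v" unfolding v_def by (intro unitary_mult unitary_star u(1) t(1))
    have "v * v = u * (star t * u) * star t" by (simp add: v_def mult.assoc)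
    also have "\<dots> = u * u * star (t * t)" by (simp add: tsc[of u] star_mult mult.assoc)
    also have "u * u = w * z" using w(1) by (simp add: z_def unitary_cancel)
    also have "w * z * star (t * t) = w" using z by (simp add: t(3) mult.assoc unitary_def)
    finally have vv: "v * v = w" .
    have "v - 1 = (u - t) * star t" using t(1) by (simp add: v_def left_diff_distrib unitary_def)
    then have "norm (v - 1) = norm (u - t)" by (simp add: unitary_norm_mult(2)[OF unitary_star[OF t(1)]])
    also have "u - t = (1 - t) - (1 - u)" by simp
    also have "norm \<dots> \<le> norm (1 - t) + norm (1 - u)" by (rule norm_triangle_ineq4)
    finally have nv: "norm (v - 1) \<le> 1 / 2" using t(4) u(2) by linarith
    \<comment> \<open>With v - 1 of norm at most 1/2 the quadratic term is at most half the norm of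
      v - 1, and 1 / (2 - 1/2) is the factor 2/3.\<close>
    have "2 *\<^sub>R (v - 1) = (w - 1) - (v - 1) * (v - 1)"
      unfolding vv[symmetric] by (simp add: algebra_simps scaleR_2)
    then have "2 * norm (v - 1) \<le> norm (w - 1) + norm ((v - 1) * (v - 1))"
      using norm_triangle_ineq4[of "w - 1" "(v - 1) * (v - 1)"] by (metis norm_scaleR abs_numeral)
    also have "norm ((v - 1) * (v - 1)) \<le> norm (v - 1) * norm (v - 1)" by (rule norm_mult_ineq)
    also have "\<dots> \<le> 1 / 2 * norm (v - 1)" using nv by (intro mult_right_mono) auto
    finally have "norm (1 - v) < 2 * s / 3" using w(2) by (simp add: norm_minus_commute)
    moreover have "x = Ad v"
    proof
      fix y
      have "Ad v y = u * (star t * y) * (t * star u)"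
        by (simp add: v_def Ad_def star_mult star_star mult.assoc)
      also have "\<dots> = u * y * (star t * t) * star u" by (simp add: tsc[of y] mult.assoc)
      finally show "x y = Ad v y" using t(1) by (simp add: u(3) Ad_def unitary_def)
    qed
    ultimately show "x \<in> P (2 * s / 3)"
      unfolding P_def using v by (intro image_eqI[of _ _ v]) (auto simp: dist_norm)
  qed simp
qed

lemma automorphism_length_not_limit:
  assumes sep: "separable_space (euclidean :: 'a :: unital_cstar_algebra topology)"
  shows "\<not> is_limit_ordinal (automorphism_length TYPE('a))"
proof -
  interpret doubling_polish_cover Aut_group "Aut_topology :: ('a \<Rightarrow> 'a) topology" unitary_group Ad
    by (rule doubling_automorphisms[OF sep])
  show ?thesis
    using phantom_length_not_limit unfolding N_def automorphism_length_def Inn_eq .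
qed

theorem corollary9p16:
  assumes "separable_space (euclidean :: 'a :: unital_cstar_algebra topology)"
  shows "\<not> is_limit_ordinal (derivation_length TYPE('a)) \<and>
         \<not> is_limit_ordinal (automorphism_length TYPE('a))"
  using derivation_length_not_limit[OF assms] automorphism_length_not_limit[OF assms] ..

end
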